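(* Let $N\ge2$, $p,q\in(1,\infty)$, $R>0$, $f\in C[0,R)$, and set $\kappa=\frac{p-1}{q-1}$ and $d=\frac{(N-1)(q-1)}{p-1}+1$. Let $d$ be an integer and let $B_R\subset\mathbb{R}^d$ be the ball of radius $R$ centred at the origin. Then $v$ is a weak supersolution to $-\kappa\Delta_q^d v\ge f$ in $(0,R)$ if and only if the function $u(x):=v(|x|)$ is a weak supersolution to $-\Delta_q u=f(|x|)$ in $B_R\subset\mathbb{R}^d$.
   Context: Weighted spaces. $L^q(r^{d-1},(0,R))$ is the set of measurable $v:(0,R)\to\mathbb{R}$ with $\int_0^R|v|^q r^{d-1}\,dr<\infty$. $W^{1,q}(r^{d-1},(0,R))$ is the set of $v\in L^q(r^{d-1},(0,R))$ whose distributional derivative $v'$ on $(0,R)$ belongs to $L^q(r^{d-1},(0,R))$. One-dimensional equation. Formally $\Delta_q^d v=|v'|^{q-2}\big((q-1)v''+\frac{d-1}{r}v'\big)$. A function $v$ is a weak supersolution to $-\kappa\Delta_q^d v\ge f$ in $(0,R)$ if $v\in W^{1,q}(r^{d-1},(0,R'))$ for all $R'\in(0,R)$ and $$\int_0^R \kappa|v'|^{q-2}v'\varphi' r^{d-1}-\varphi f r^{d-1}\,dr\ge 0$$ for all non-negative $\varphi\in C_0^\infty(-R,R)$. $q$-Laplace equation in dimension $d$. $\Delta_q$ is the usual $q$-Laplacian in $\mathbb{R}^d$. A function $u\in W^{1,q}_{loc}(B_R)$ is a weak supersolution to $-\Delta_q u=f(|x|)$ in $B_R$ (that is, a weak supersolution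 to $-\Delta_q u\ge f(|x|)$) if $$\int_{B_R}|Du|^{q-2}Du\cdot D\varphi-\varphi f(|x|)\,dx\ge0$$ for all non-negative $\varphi\in C_0^\infty(B_R)$.
   Formalization: The equation in the ball is taken as -Δ_q u = f(|x|)/κ instead of -Δ_q u = f(|x|); as printed the equivalence fails for κ ≠ 1 (N=3, p=3, q=2, so κ=2, d=2, with v=-r², f=8), and the two agree when κ = 1. *)

theory Defs
  imports "HOL-Analysis.Analysis"
begin

text \<open>A single set of definitions serves both Euclidean space and the real line: for
  \<open>'a = real\<close> the basis is \<open>{1}\<close> and \<open>inner\<close> is multiplication, so \<open>has_weak_gradient\<close> is the
  one-dimensional distributional derivative.\<close>

primrec Ck :: "nat \<Rightarrow> ('a::euclidean_space \<Rightarrow> real) \<Rightarrow> bool" where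
  "Ck 0 \<phi> \<longleftrightarrow> continuous_on UNIV \<phi>"
| "Ck (Suc k) \<phi> \<longleftrightarrow> (\<forall>x. \<phi> differentiable (at x)) \<and>
      (\<forall>b\<in>Basis. Ck k (\<lambda>x. frechet_derivative \<phi> (at x) b))"

definition test_functions :: "'a::euclidean_space set \<Rightarrow> ('a \<Rightarrow> real) set" where
  "test_functions U = {\<phi>. (\<forall>k. Ck k \<phi>) \<and> compact (closure {x. \<phi> x \<noteq> 0})
      \<and> closure {x. \<phi> x \<noteq> 0} \<subseteq> U}"

definition grad :: "('a::euclidean_space \<Rightarrow> real) \<Rightarrow> 'a \<Rightarrow> 'a" where
  "grad \<phi> x = (\<Sum>b\<in>Basis. frechet_derivative \<phi> (at x) b *\<^sub>R b)"

definition locally_integrable ::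
    "'a::euclidean_space set \<Rightarrow> ('a \<Rightarrow> 'b::euclidean_space) \<Rightarrow> bool" where
  "locally_integrable U g \<longleftrightarrow> (\<forall>K. compact K \<and> K \<subseteq> U \<longrightarrow> set_integrable lebesgue K g)"

definition has_weak_gradient ::
    "'a::euclidean_space set \<Rightarrow> ('a \<Rightarrow> real) \<Rightarrow> ('a \<Rightarrow> 'a) \<Rightarrow> bool" where
  "has_weak_gradient U u G \<longleftrightarrow> locally_integrable U u \<and> locally_integrable U G \<and>
     (\<forall>\<phi>\<in>test_functions U. \<forall>b\<in>Basis.
        (LINT x:U|lebesgue. u x * frechet_derivative \<phi> (at x) b)
          = - (LINT x:U|lebesgue. inner (G x) b * \<phi> x))"

text \<open>\<open>Lq_space \<rho> q U\<close> and \<open>W1q_space \<rho> q U\<close> are the Lebesgue and first-order Sobolev spaces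
  on \<open>U\<close> with respect to the measure with density \<open>\<rho>\<close>.  The distributional derivative itself
  is always taken with respect to Lebesgue measure.\<close>

definition Lq_space ::
    "('a::euclidean_space \<Rightarrow> real) \<Rightarrow> real \<Rightarrow> 'a set \<Rightarrow> ('a \<Rightarrow> 'b::euclidean_space) set" where
  "Lq_space \<rho> q U = {g. set_borel_measurable lebesgue U g \<and>
      set_integrable lebesgue U (\<lambda>x. norm (g x) powr q * \<rho> x)}"

definition W1q_space ::
    "('a::euclidean_space \<Rightarrow> real) \<Rightarrow> real \<Rightarrow> 'a set \<Rightarrow> ('a \<Rightarrow> real) set" where
  "W1q_space \<rho> q U = {u. u \<in> Lq_space \<rho> q U \<and>
      (\<exists>G. has_weak_gradient U u G \<and> G \<in> Lq_space \<rho> q U)}"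

definition W1q_loc :: "real \<Rightarrow> 'a::euclidean_space set \<Rightarrow> ('a \<Rightarrow> real) set" where
  "W1q_loc q U = {u. \<forall>V. open V \<and> compact (closure V) \<and> closure V \<subseteq> U
      \<longrightarrow> u \<in> W1q_space (\<lambda>_. 1) q V}"

text \<open>In the next two definitions the weak derivative is unique up to a null set, so the
  existential quantifier only names it.  The power \<open>0 powr (q - 2)\<close> is \<open>0\<close> for every \<open>q\<close>, which
  realises the usual convention that the field \<open>|z|^(q-2) z\<close> vanishes at \<open>z = 0\<close>.\<close>

text \<open>Weak supersolutions to \<open>- \<kappa> \<Delta>_q^d v \<ge> f\<close> in \<open>(0, R)\<close>.  The fictitious dimension \<open>d\<close> is an
  arbitrary real number, and the test functions need not vanish at \<open>0\<close>.\<close>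

definition radial_weak_supersolution ::
    "real \<Rightarrow> real \<Rightarrow> real \<Rightarrow> real \<Rightarrow> (real \<Rightarrow> real) \<Rightarrow> (real \<Rightarrow> real) \<Rightarrow> bool" where
  "radial_weak_supersolution \<kappa> q d R f v \<longleftrightarrow>
     (\<forall>R'\<in>{0<..<R}. v \<in> W1q_space (\<lambda>r. r powr (d - 1)) q {0<..<R'}) \<and>
     (\<exists>v'. has_weak_gradient {0<..<R} v v' \<and>
        (\<forall>\<phi>\<in>test_functions {-R<..<R}. (\<forall>r. \<phi> r \<ge> 0) \<longrightarrow>
           (LINT r:{0<..<R}|lebesgue.
              \<kappa> * \<bar>v' r\<bar> powr (q - 2) * v' r * deriv \<phi> r * r powr (d - 1)
                - \<phi> r * f r * r powr (d - 1)) \<ge> 0))"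

text \<open>Weak supersolutions to \<open>- \<Delta>_q u \<ge> f(|x|)\<close> in the ball of radius \<open>R\<close> about the origin.\<close>

definition qLaplace_weak_supersolution ::
    "real \<Rightarrow> real \<Rightarrow> (real \<Rightarrow> real) \<Rightarrow> ('a::euclidean_space \<Rightarrow> real) \<Rightarrow> bool" where
  "qLaplace_weak_supersolution q R f u \<longleftrightarrow>
     u \<in> W1q_loc q (ball 0 R) \<and>
     (\<exists>Du. has_weak_gradient (ball 0 R) u Du \<and>
        (\<forall>\<phi>\<in>test_functions (ball 0 R). (\<forall>x. \<phi> x \<ge> 0) \<longrightarrow>
           (LINT x:ball 0 R|lebesgue.
              norm (Du x) powr (q - 2) * inner (Du x) (grad \<phi> x) - \<phi> x * f (norm x)) \<ge> 0))"

end

theory Submission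
  imports Defs
begin

text \<open>
  In polar coordinates \<open>x = r \<omega>\<close>, Lebesgue measure becomes the product of \<open>n r\<^sup>n\<^sup>-\<^sup>1 dr\<close> and a
  finite measure on the unit sphere.  With \<open>u x = v |x|\<close> and \<open>Du = v' |x| x / |x|\<close>, the two
  weak formulations are therefore matched by transporting test functions: a test function on the
  ball is replaced by its spherical mean, a test function \<open>\<phi>\<close> on \<open>(-R, R)\<close> by the smooth functions
  \<open>\<phi> (sqrt (|x|\<^sup>2 + \<epsilon>))\<close> with \<open>\<epsilon> \<rightarrow> 0\<close>.

  What remains is that \<open>u\<close> has weak gradient \<open>Du\<close> exactly when \<open>v\<close> has weak derivative \<open>v'\<close>.  From
  \<open>v\<close> to \<open>u\<close> this is the divergence theorem on spheres, combined with a cut-off near the origin.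
  From \<open>u\<close> to \<open>v\<close>, the spherical mean of the radial component of \<open>Du\<close> is a weak derivative of
  \<open>v\<close>; uniqueness of weak gradients then shows that \<open>Du\<close> is radial.
\<close>

section \<open>Smooth functions\<close>

text \<open>The equation on the ball carries no factor \<kappa>, hence its right-hand side is f /
  \<kappa>.

  Both inequalities are nonlinear in the gradient but linear in the test function. Once Du is known
  to be radial, the flux is |v'|^(q-2) v' x / |x|, and its pairing with \<phi> on a sphere sees only
  the spherical mean of \<phi>. This is why averaging loses nothing, and why Du has to be shown
  radial before the nonlinear expression is touched.

  The delicate point is the origin. The weak derivative of v is tested only away from 0, whereas the
  weak gradient of u and both inequalities are tested across 0. Since q may exceed the dimension, a
  point may have positive q-capacity and cannot simply be discarded; the oddness of x / |x| is used
  instead.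

  Moreover v is not assumed measurable. Both notions of supersolution ignore null sets, so v can be
  replaced by a Borel function, after which all integrals are taken with respect to
  \<open>lborel\<close>, where product measures are available.\<close>

definition smooth :: "('a::euclidean_space \<Rightarrow> real) \<Rightarrow> bool" where
  "smooth \<phi> \<longleftrightarrow> (\<forall>k. Ck k \<phi>)"

abbreviation partial :: "('a::euclidean_space \<Rightarrow> real) \<Rightarrow> 'a \<Rightarrow> 'a \<Rightarrow> real" where
  "partial \<phi> b \<equiv> (\<lambda>x. frechet_derivative \<phi> (at x) b)"

lemma Ck_Suc_has_derivative:
  "Ck (Suc k) \<phi> \<Longrightarrow> (\<phi> has_derivative frechet_derivative \<phi> (at x)) (at x)"
  by (simp add: frechet_derivative_works)

text \<open>\<open>Ck\<close> is phrased with the chosen derivative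
  \<open>frechet_derivative\<close>; uniqueness of derivatives lets any derivative found by the
  usual rules take its place.\<close>

lemma Ck_SucI:
  assumes "\<And>x. (\<phi> has_derivative D x) (at x)" and "\<And>b. b \<in> Basis \<Longrightarrow> Ck k (\<lambda>x. D x b)"
  shows "Ck (Suc k) \<phi>"
proof -
  have "frechet_derivative \<phi> (at x) = D x" for x
    using assms(1) frechet_derivative_at by metis
  then show ?thesis using assms by (auto simp: differentiable_def)
qed

lemma Ck_Suc_imp_Ck: "Ck (Suc k) \<phi> \<Longrightarrow> Ck k \<phi>"
proof (induction k arbitrary: \<phi>)
  case 0
  then show ?case
    by (auto intro!: continuous_at_imp_continuous_on differentiable_imp_continuous_within)
next
  case (Suc k)
  then show ?case by (metis Ck.simps(2))
qed

lemma Ck_imp_continuous: "Ck k \<phi> \<Longrightarrow> continuous_on UNIV \<phi>"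
  by (induction k) (use Ck_Suc_imp_Ck in \<open>auto simp del: Ck.simps(2)\<close>)

lemma Ck_const: "Ck k (\<lambda>x. c)"
proof (induction k arbitrary: c)
  case (Suc k)
  show ?case by (rule Ck_SucI[where D="\<lambda>x h. 0"]) (auto intro: Suc)
qed simp

lemma Ck_add: "Ck k f \<Longrightarrow> Ck k g \<Longrightarrow> Ck k (\<lambda>x. f x + g x)"
proof (induction k arbitrary: f g)
  case (Suc k)
  show ?case
    by (rule Ck_SucI, rule has_derivative_add[OF Ck_Suc_has_derivative Ck_Suc_has_derivative])
      (use Suc in auto)
qed (auto intro: continuous_intros)

lemma Ck_sum: "(\<And>i. i \<in> I \<Longrightarrow> Ck k (f i)) \<Longrightarrow> Ck k (\<lambda>x. \<Sum>i\<in>I. f i x)"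
  by (induction I rule: infinite_finite_induct) (auto intro: Ck_const Ck_add)

lemma Ck_mult: "Ck k f \<Longrightarrow> Ck k g \<Longrightarrow> Ck k (\<lambda>x. f x * g x)"
proof (induction k arbitrary: f g)
  case (Suc k)
  \<comment> \<open>The product rule keeps one factor undifferentiated, so f and g themselves are
    needed at order k.\<close>
  note * = Suc.prems[THEN Ck_Suc_imp_Ck]
  show ?case
    by (rule Ck_SucI, rule has_derivative_mult[OF Ck_Suc_has_derivative Ck_Suc_has_derivative])
      (use Suc * in \<open>auto intro!: Ck_add Suc.IH\<close>)
qed (auto intro: continuous_intros)

lemma Ck_prod: "(\<And>i. i \<in> I \<Longrightarrow> Ck k (f i)) \<Longrightarrow> Ck k (\<lambda>x. \<Prod>i\<in>I. f i x)"
  by (induction I rule: infinite_finite_induct) (auto intro: Ck_const Ck_mult)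

lemma Ck_inner: "Ck k (\<lambda>x. x \<bullet> c)"
proof (cases k)
  case (Suc j)
  show ?thesis unfolding Suc
    by (rule Ck_SucI[where D="\<lambda>x h. h \<bullet> c"])
      (auto intro: Ck_const intro!: derivative_eq_intros)
qed (auto intro: continuous_intros)

lemma frechet_derivative_real:
  fixes \<psi> :: "real \<Rightarrow> real"
  assumes "\<psi> differentiable (at x)"
  shows "frechet_derivative \<psi> (at x) h = h * deriv \<psi> x"
proof -
  have "(\<psi> has_real_derivative deriv \<psi> x) (at x)"
    using assms DERIV_deriv_iff_real_differentiable by blast
  from frechet_derivative_at[OF this[unfolded has_field_derivative_def]] show ?thesis
    by (metis mult.commute)
qed

lemma Ck_Suc_realI:
  assumes "\<And>x. (\<psi> has_real_derivative \<psi>' x) (at x)" and "Ck k \<psi>'"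
  shows "Ck (Suc k) \<psi>"
  by (rule Ck_SucI[where D="\<lambda>x. (*) (\<psi>' x)"]) (use assms in \<open>auto simp: has_field_derivative_def\<close>)

lemma Ck_Suc_realD:
  fixes \<psi> :: "real \<Rightarrow> real"
  assumes "Ck (Suc k) \<psi>"
  shows "(\<psi> has_real_derivative deriv \<psi> x) (at x)" and "Ck k (deriv \<psi>)"
proof -
  have d: "\<psi> differentiable (at x)" for x using assms by simp
  then show "(\<psi> has_real_derivative deriv \<psi> x) (at x)"
    using DERIV_deriv_iff_real_differentiable by blast
  show "Ck k (deriv \<psi>)" using assms by (simp add: frechet_derivative_real[OF d])
qed

text \<open>The chain rule leaves \<open>deriv \<psi>\<close> composed with the same inner function,
  so the induction varies \<psi> and keeps g fixed.\<close>

lemma Ck_compose: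
  fixes \<psi> :: "real \<Rightarrow> real"
  shows "Ck k \<psi> \<Longrightarrow> Ck k g \<Longrightarrow> Ck k (\<lambda>x. \<psi> (g x))"
proof (induction k arbitrary: \<psi>)
  case 0
  then show ?case
    by (auto intro: continuous_on_compose2)
next
  case (Suc k)
  note d = Ck_Suc_realD[OF Suc.prems(1)]
  show ?case
    by (rule Ck_SucI, rule DERIV_compose_FDERIV[OF d(1) Ck_Suc_has_derivative[OF Suc.prems(2)]])
      (use Suc d(2) Ck_Suc_imp_Ck[OF Suc.prems(2)] in \<open>auto intro!: Ck_mult\<close>)
qed

lemma smooth_add: "smooth f \<Longrightarrow> smooth g \<Longrightarrow> smooth (\<lambda>x. f x + g x)"
  and smooth_mult: "smooth f \<Longrightarrow> smooth g \<Longrightarrow> smooth (\<lambda>x. f x * g x)"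
  and smooth_const: "smooth (\<lambda>x. c)"
  and smooth_inner: "smooth (\<lambda>x. x \<bullet> w)"
  and smooth_prod: "(\<And>i. i \<in> I \<Longrightarrow> smooth (h i)) \<Longrightarrow> smooth (\<lambda>x. \<Prod>i\<in>I. h i x)"
  and smooth_compose: "smooth \<psi> \<Longrightarrow> smooth g \<Longrightarrow> smooth (\<lambda>x. \<psi> (g x))"
  unfolding smooth_def by (blast intro: Ck_add Ck_mult Ck_const Ck_inner Ck_prod Ck_compose)+

lemma smooth_ident: "smooth (\<lambda>x::real. x)"
  using smooth_inner[of "1::real"] by simp

lemma smooth_power: "smooth f \<Longrightarrow> smooth (\<lambda>x. f x ^ m)"
  by (induction m) (auto intro: smooth_mult smooth_const)

lemma smooth_has_derivative:
  "smooth \<phi> \<Longrightarrow> (\<phi> has_derivative frechet_derivative \<phi> (at x)) (at x)"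
  using Ck_Suc_has_derivative unfolding smooth_def by blast

lemma smooth_continuous: "smooth \<phi> \<Longrightarrow> continuous_on UNIV \<phi>"
  using Ck_imp_continuous unfolding smooth_def by blast

lemma smooth_partial: "smooth \<phi> \<Longrightarrow> b \<in> Basis \<Longrightarrow> smooth (partial \<phi> b)"
  unfolding smooth_def by (metis Ck.simps(2))

lemma smooth_DERIV:
  fixes \<psi> :: "real \<Rightarrow> real"
  assumes "smooth \<psi>"
  shows "(\<psi> has_real_derivative deriv \<psi> x) (at x)"
  using Ck_Suc_realD assms unfolding smooth_def by blast

lemma smooth_deriv: "smooth \<psi> \<Longrightarrow> smooth (deriv \<psi>)"
  using Ck_Suc_realD unfolding smooth_def by blast

lemma frechet_derivative_eq_grad:
  assumes "\<phi> differentiable (at x)"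
  shows "frechet_derivative \<phi> (at x) h = grad \<phi> x \<bullet> h"
proof -
  have lin: "linear (frechet_derivative \<phi> (at x))"
    using assms by (rule linear_frechet_derivative)
  have "frechet_derivative \<phi> (at x) h = frechet_derivative \<phi> (at x) (\<Sum>b\<in>Basis. (h \<bullet> b) *\<^sub>R b)"
    by (simp add: euclidean_representation)
  also have "\<dots> = (\<Sum>b\<in>Basis. (h \<bullet> b) * frechet_derivative \<phi> (at x) b)"
    by (simp add: linear_sum[OF lin] linear_cmul[OF lin])
  also have "\<dots> = grad \<phi> x \<bullet> h"
    by (simp add: grad_def inner_sum_left inner_sum_right mult.commute inner_commute)
  finally show ?thesis .
qed

lemma smooth_grad_derivative: "smooth \<phi> \<Longrightarrow> (\<phi> has_derivative (\<lambda>h. grad \<phi> x \<bullet> h)) (at x)"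
proof -
  assume d: "smooth \<phi>"
  then have "frechet_derivative \<phi> (at x) = (\<lambda>h. grad \<phi> x \<bullet> h)"
    using smooth_has_derivative[OF d, of x]
    by (auto simp: fun_eq_iff differentiable_def intro!: frechet_derivative_eq_grad)
  then show ?thesis using smooth_has_derivative[OF d, of x] by simp
qed

lemma grad_inner_Basis: "b \<in> Basis \<Longrightarrow> grad \<phi> x \<bullet> b = partial \<phi> b x"
  by (simp add: grad_def inner_sum_left inner_Basis if_distrib sum.delta cong: if_cong)

lemma smooth_grad_continuous: "smooth \<phi> \<Longrightarrow> continuous_on UNIV (grad \<phi>)"
  unfolding grad_def by (intro continuous_intros smooth_continuous smooth_partial)

lemma has_derivative_grad: "(\<phi> has_derivative (\<lambda>h. g \<bullet> h)) (at x) \<Longrightarrow> grad \<phi> x = g"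
  by (metis frechet_derivative_at grad_inner_Basis euclidean_eqI)

section \<open>Bump functions and smooth functions of the norm\<close>

text \<open>Differentiating f / x^m produces f' / x^m and f / x^(m+1), two quotients of the same
  form. The smoothness of \<open>exp_bump\<close> and \<open>smooth_divide_power\<close> both rest
  on this.\<close>

lemma DERIV_divide_power:
  fixes f :: "real \<Rightarrow> real"
  assumes "(f has_real_derivative f') (at x)" and "x \<noteq> 0"
  shows "((\<lambda>x. f x / x ^ m) has_real_derivative f' / x ^ m - m * (f x / x ^ Suc m)) (at x)"
proof -
  \<comment> \<open>The form m x^m / x, instead of m x^(m-1), avoids truncated subtraction at m =
    0.\<close>
  have "((\<lambda>x. x ^ m) has_real_derivative m * x ^ m / x) (at x)"
    using DERIV_pow[of m x UNIV] assms(2) by (cases m) auto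
  moreover have "(f' * x ^ m - f x * (m * x ^ m / x)) / (x ^ m * x ^ m) =
      f' / x ^ m - m * (f x / x ^ Suc m)"
    using assms(2) by (simp add: field_simps)
  ultimately show ?thesis
    using DERIV_divide[OF assms(1), of "\<lambda>x. x ^ m"] assms(2) by fastforce
qed

text \<open>Up to integer factors this family is closed under differentiation.\<close>

definition exp_bump :: "nat \<Rightarrow> real \<Rightarrow> real" where
  "exp_bump m x = (if x > 0 then exp (- (1 / x)) / x ^ m else 0)"

text \<open>With t = 1 / x the claim on the right of 0 is that exp t outgrows t^m; on the left the
  function is 0.\<close>

lemma exp_bump_tendsto_0: "(exp_bump m \<longlongrightarrow> 0) (at 0)"
proof -
  have "((\<lambda>x. inverse x ^ m / exp (inverse x)) \<longlongrightarrow> (0::real)) (at_right 0)"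
    by (rule filterlim_compose[OF tendsto_power_div_exp_0 filterlim_inverse_at_top_right])
  then have "(exp_bump m \<longlongrightarrow> 0) (at_right 0)"
    by (rule Lim_transform_eventually)
      (auto simp: eventually_at_filter exp_bump_def exp_minus field_simps)
  moreover have "(exp_bump m \<longlongrightarrow> 0) (at_left 0)"
    by (rule Lim_transform_eventually[OF tendsto_const])
      (auto simp: eventually_at_filter exp_bump_def)
  ultimately show ?thesis by (rule filterlim_split_at[rotated])
qed

lemma exp_bump_DERIV:
  "(exp_bump m has_real_derivative exp_bump (m + 2) x - m * exp_bump (m + 1) x) (at x)"
proof (cases "x = 0")
  case True
  \<comment> \<open>At 0 the difference quotient of \<open>exp_bump m\<close> is
    \<open>exp_bump (Suc m)\<close>, which tends to 0.\<close>
  have "((\<lambda>h. (exp_bump m (0 + h) - exp_bump m 0) / h) \<longlongrightarrow> 0) (at 0)"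
    by (rule Lim_transform_eventually[OF exp_bump_tendsto_0[of "Suc m"]])
      (auto simp: eventually_at_filter exp_bump_def)
  then show ?thesis using True unfolding DERIV_def by (simp add: exp_bump_def)
next
  case False
  show ?thesis
  proof (cases "x > 0")
    case True
    have "((\<lambda>x. exp (- (1 / x))) has_real_derivative exp (- (1 / x)) / x\<^sup>2) (at x)"
      using True by (auto intro!: derivative_eq_intros simp: power2_eq_square)
    from DERIV_divide_power[OF this, of m]
    have "((\<lambda>x. exp (- (1 / x)) / x ^ m) has_real_derivative
        exp_bump (m + 2) x - m * exp_bump (m + 1) x) (at x)"
      using True by (simp add: exp_bump_def power2_eq_square mult_ac)
    then show ?thesis
      by (rule has_field_derivative_transform_within_open[where S="{0<..}"])
        (use True in \<open>auto simp: exp_bump_def\<close>)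
  next
    case neg: False
    have "((\<lambda>x. 0::real) has_real_derivative exp_bump (m + 2) x - m * exp_bump (m + 1) x) (at x)"
      using neg by (auto simp: exp_bump_def)
    then show ?thesis
      by (rule has_field_derivative_transform_within_open[where S="{..<0}"])
        (use neg False in \<open>auto simp: exp_bump_def\<close>)
  qed
qed

lemma smooth_exp_bump: "smooth (exp_bump m)"
proof -
  have "Ck k (exp_bump m)" for k
  proof (induction k arbitrary: m)
    case 0
    show ?case
      using DERIV_isCont[OF exp_bump_DERIV] by (auto intro!: continuous_at_imp_continuous_on)
  next
    case (Suc k)
    have "Ck k (\<lambda>x. exp_bump (m + 2) x + (- real m) * exp_bump (m + 1) x)"
      by (intro Ck_add Ck_mult Ck_const Suc)
    then show ?case using Ck_Suc_realI[OF exp_bump_DERIV] by simp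
  qed
  then show ?thesis by (simp add: smooth_def)
qed

lemma exp_bump_nonneg: "exp_bump m x \<ge> 0"
  by (simp add: exp_bump_def)

lemma exp_bump_0_le_1: "exp_bump 0 x \<le> 1"
  by (simp add: exp_bump_def)

text \<open>The constant c keeps the base away from 0, so that every real power is smooth at the
  origin as well. The exponent drops by 1 under differentiation and therefore varies in the
  induction. The case a = 1/2 yields sqrt(|x|^2 + c).\<close>

lemma Ck_powr_norm:
  fixes c a :: real
  assumes "c > 0"
  shows "Ck k (\<lambda>x::'a::euclidean_space. (x \<bullet> x + c) powr a)"
proof (induction k arbitrary: a)
  case 0
  have "x \<bullet> x + c \<noteq> 0" for x :: 'a using assms by (smt (verit) inner_ge_zero)
  then show ?case by (auto intro!: continuous_intros)
next
  case (Suc k)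
  have pos: "x \<bullet> x + c > 0" for x :: 'a using assms by (smt (verit) inner_ge_zero)
  show ?case
  proof (rule Ck_SucI)
    fix x :: 'a
    show "((\<lambda>x. (x \<bullet> x + c) powr a) has_derivative
        (\<lambda>h. (2 * (x \<bullet> h)) * (a * (x \<bullet> x + c) powr (a - 1)))) (at x)"
      by (rule DERIV_compose_FDERIV[where f="\<lambda>z. z powr a" and g="\<lambda>x. x \<bullet> x + c",
            OF has_real_derivative_powr[OF pos]])
        (auto intro!: derivative_eq_intros simp: inner_commute)
    fix b :: 'a
    show "Ck k (\<lambda>x. 2 * (x \<bullet> b) * (a * (x \<bullet> x + c) powr (a - 1)))"
      by (intro Ck_mult Ck_const Ck_inner Suc)
  qed
qed

lemma deriv_eq_0_outside:
  fixes \<phi> :: "real \<Rightarrow> real"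
  assumes "closed K" and "\<And>x. x \<notin> K \<Longrightarrow> \<phi> x = 0" and "x \<notin> K"
  shows "deriv \<phi> x = 0"
proof (rule DERIV_imp_deriv)
  show "(\<phi> has_real_derivative 0) (at x)"
    by (rule has_field_derivative_transform_within_open[OF DERIV_const, where S="- K"])
      (use assms in auto)
qed

lemma deriv_eq_0_below:
  fixes \<psi> :: "real \<Rightarrow> real"
  assumes "\<And>s. s < a \<Longrightarrow> \<psi> s = 0" and "s < a"
  shows "deriv \<psi> s = 0"
  by (rule deriv_eq_0_outside[of "{a..}"]) (use assms in auto)

text \<open>As \<zeta> vanishes below a > 0, the pole of 1 / s^m is never met. The derivative is a
  combination of two quotients of the same kind, so the induction runs over all \<zeta> and m at
  once.\<close>

lemma smooth_divide_power:
  fixes \<zeta> :: "real \<Rightarrow> real"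
  assumes "smooth \<zeta>" and "\<And>s. s < a \<Longrightarrow> \<zeta> s = 0" and "a > 0"
  shows "smooth (\<lambda>s. \<zeta> s / s ^ m)"
proof -
  have main: "((\<lambda>s. \<zeta> s / s ^ m) has_real_derivative
      deriv \<zeta> s / s ^ m + (- real m) * (\<zeta> s / s ^ Suc m)) (at s)"
    if "smooth \<zeta>" and z: "\<And>s. s < a \<Longrightarrow> \<zeta> s = 0" for s m and \<zeta> :: "real \<Rightarrow> real"
  proof (cases "s < a")
    case True
    have "((\<lambda>s. 0) has_real_derivative
        deriv \<zeta> s / s ^ m + (- real m) * (\<zeta> s / s ^ Suc m)) (at s)"
      using True deriv_eq_0_below[OF z] z by simp
    then show ?thesis
      by (rule has_field_derivative_transform_within_open[where S="{..<a}"])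
        (use True z in auto)
  next
    case False
    then show ?thesis using \<open>a > 0\<close> DERIV_divide_power[OF smooth_DERIV[OF that(1), of s], of m]
      by simp
  qed
  have "Ck k (\<lambda>s. \<zeta> s / s ^ m)" for k
    using assms(1,2)
  proof (induction k arbitrary: \<zeta> m)
    case 0
    show ?case
      using DERIV_isCont[OF main[OF 0]] by (auto intro!: continuous_at_imp_continuous_on)
  next
    case (Suc k)
    show ?case
    proof (rule Ck_Suc_realI[OF main])
      show "Ck k (\<lambda>s. deriv \<zeta> s / s ^ m + - real m * (\<zeta> s / s ^ Suc m))"
        by (intro Ck_add Ck_mult Ck_const Suc.IH smooth_deriv deriv_eq_0_below[where \<psi>=\<zeta>] Suc.prems)
    qed (use Suc.prems in auto)
  qed
  then show ?thesis by (simp add: smooth_def)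
qed

text \<open>The formula holds at the origin too: the function is constant near 0, and
  \<open>sgn 0 = 0\<close>.\<close>

lemma norm_compose_has_derivative:
  fixes x :: "'a::euclidean_space"
  assumes "\<And>s. (\<zeta> has_real_derivative \<zeta>' s) (at s)" and "\<And>s. s < a \<Longrightarrow> \<zeta> s = 0" and "a > 0"
  shows "((\<lambda>x. \<zeta> (norm x)) has_derivative (\<lambda>h. (\<zeta>' (norm x) *\<^sub>R sgn x) \<bullet> h)) (at x)"
proof (cases "x = 0")
  case True
  have "((\<lambda>x. \<zeta> (norm x)) has_derivative (\<lambda>h. 0)) (at x)"
    by (rule has_derivative_transform_within_open[OF has_derivative_const, where s="ball 0 a"])
      (use assms True in auto)
  then show ?thesis using True by simp
next
  case False
  then show ?thesis
    using DERIV_compose_FDERIV[OF assms(1) has_derivative_norm[OF False]]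
    by (simp add: inner_commute mult.commute)
qed

text \<open>The derivative in direction b is the function \<zeta>'(s) / s at s = |x|, again smooth
  and zero near 0, times the linear function x \<bullet> b. The induction hypothesis applies to that
  quotient.\<close>

lemma smooth_compose_norm:
  fixes \<zeta> :: "real \<Rightarrow> real"
  assumes "smooth \<zeta>" and "\<And>s. s < a \<Longrightarrow> \<zeta> s = 0" and "a > 0"
  shows "smooth (\<lambda>x::'a::euclidean_space. \<zeta> (norm x))"
proof -
  have "Ck k (\<lambda>x::'a. \<zeta> (norm x))" for k
    using assms(1,2)
  proof (induction k arbitrary: \<zeta>)
    case 0
    then show ?case
      using smooth_continuous by (auto intro: continuous_on_compose2 continuous_intros)
  next
    case (Suc k)
    show ?case
    proof (rule Ck_SucI[OF norm_compose_has_derivative[OF smooth_DERIV]])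
      fix b :: 'a
      have sm: "smooth (\<lambda>s. deriv \<zeta> s / s ^ 1)"
        by (rule smooth_divide_power) (use Suc.prems assms(3) deriv_eq_0_below[where \<psi>=\<zeta>] in \<open>auto intro: smooth_deriv\<close>)
      have "Ck k (\<lambda>x. (deriv \<zeta> (norm x) / norm x ^ 1) * (x \<bullet> b))"
        by (intro Ck_mult Ck_inner Suc.IH[OF sm]) (use deriv_eq_0_below[where \<psi>=\<zeta>] Suc.prems in auto)
      then show "Ck k (\<lambda>x. (deriv \<zeta> (norm x) *\<^sub>R sgn x) \<bullet> b)"
        by (simp add: sgn_div_norm divide_inverse mult.assoc)
    qed (use Suc assms in auto)
  qed
  then show ?thesis by (simp add: smooth_def)
qed

section \<open>Test functions and weak gradients\<close>

text \<open>Together with the elimination rule below, this replaces the support by any compact set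
  off which the function vanishes, so that closures need not be computed later.\<close>

lemma test_functionsI:
  assumes "smooth \<phi>" and "compact K" and "K \<subseteq> U" and "\<And>x. x \<notin> K \<Longrightarrow> \<phi> x = 0"
  shows "\<phi> \<in> test_functions U"
proof -
  have *: "{x. \<phi> x \<noteq> 0} \<subseteq> K" using assms(4) by auto
  have sub: "closure {x. \<phi> x \<noteq> 0} \<subseteq> K"
    using * compact_imp_closed[OF assms(2)] by (rule closure_minimal)
  have "bounded {x. \<phi> x \<noteq> 0}"
    using compact_imp_bounded[OF assms(2)] * by (rule bounded_subset)
  then have "compact (closure {x. \<phi> x \<noteq> 0})" by simp
  then show ?thesis
    using assms(1) subset_trans[OF sub assms(3)] by (simp add: test_functions_def smooth_def)
qed

lemma test_functionsE:
  assumes "\<phi> \<in> test_functions U"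
  obtains K where "smooth \<phi>" and "compact K" and "K \<subseteq> U" and "\<And>x. x \<notin> K \<Longrightarrow> \<phi> x = 0"
proof (rule that)
  show "\<phi> x = 0" if "x \<notin> closure {x. \<phi> x \<noteq> 0}" for x
    using that closure_subset[of "{x. \<phi> x \<noteq> 0}"] by auto
qed (use assms in \<open>auto simp: test_functions_def smooth_def\<close>)

lemma test_functions_mono: "U \<subseteq> V \<Longrightarrow> test_functions U \<subseteq> test_functions V"
  by (auto simp: test_functions_def)

lemma frechet_derivative_eq_0_outside:
  fixes \<phi> :: "'a::euclidean_space \<Rightarrow> real"
  assumes "compact K" and "\<And>x. x \<notin> K \<Longrightarrow> \<phi> x = 0" and "x \<notin> K"
  shows "frechet_derivative \<phi> (at x) h = 0"
proof -
  note closed = compact_imp_closed[OF assms(1)]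
  have "(\<phi> has_derivative (\<lambda>h. 0)) (at x)"
    by (rule has_derivative_transform_within_open[OF has_derivative_const, where s="- K"])
      (use assms closed in auto)
  from frechet_derivative_at[OF this] show ?thesis by metis
qed

lemma grad_eq_0_outside:
  fixes \<phi> :: "'a::euclidean_space \<Rightarrow> real"
  assumes "compact K" and "\<And>x. x \<notin> K \<Longrightarrow> \<phi> x = 0" and "x \<notin> K"
  shows "grad \<phi> x = 0"
  by (simp add: grad_def frechet_derivative_eq_0_outside[OF assms])

lemma continuous_compact_support_bounded:
  fixes \<phi> :: "'a::euclidean_space \<Rightarrow> 'b::real_normed_vector"
  assumes "continuous_on UNIV \<phi>" and "compact K" and "\<And>x. x \<notin> K \<Longrightarrow> \<phi> x = 0"
  obtains B where "B > 0" and "\<And>x. norm (\<phi> x) \<le> B"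
proof -
  have "bounded (\<phi> ` K)"
    using assms by (meson compact_continuous_image compact_imp_bounded continuous_on_subset subset_UNIV)
  then obtain B where B: "B > 0" "\<And>x. x \<in> K \<Longrightarrow> norm (\<phi> x) \<le> B"
    unfolding bounded_pos by blast
  have "norm (\<phi> x) \<le> B" for x
    using B assms(3)[of x] by (cases "x \<in> K") auto
  with B(1) show ?thesis by (rule that)
qed

section \<open>Test functions filling a box\<close>

text \<open>A factor at distance t > 0 from a face of the box equals exp(-1 / (m t)) with m = k + 1.
  Growing k drives it to 1, so these functions, bounded by 1, approximate the indicator of the open
  box.\<close>

definition box_bump :: "nat \<Rightarrow> 'a::euclidean_space \<Rightarrow> 'a \<Rightarrow> 'a \<Rightarrow> real" where
  "box_bump k a c x = (\<Prod>b\<in>Basis. exp_bump 0 (Suc k * (x \<bullet> b - a \<bullet> b)) * exp_bump 0 (Suc k * (c \<bullet> b - x \<bullet> b)))"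

lemma smooth_box_bump: "smooth (box_bump k a c)"
proof -
  have "smooth (\<lambda>x. \<Prod>b\<in>Basis. exp_bump 0 (Suc k * (x \<bullet> b + - (a \<bullet> b))) *
      exp_bump 0 (Suc k * (c \<bullet> b + (-1) * (x \<bullet> b))))"
    by (intro smooth_prod smooth_mult smooth_compose[OF smooth_exp_bump] smooth_add smooth_const smooth_inner)
  then show ?thesis unfolding box_bump_def[abs_def] by simp
qed

lemma box_bump_eq_0:
  assumes "x \<notin> box a c" shows "box_bump k a c x = 0"
proof -
  obtain b where b: "b \<in> Basis" "x \<bullet> b \<le> a \<bullet> b \<or> c \<bullet> b \<le> x \<bullet> b"
    using assms by (auto simp: mem_box not_less)
  then have "exp_bump 0 (Suc k * (x \<bullet> b - a \<bullet> b)) = 0 \<or> exp_bump 0 (Suc k * (c \<bullet> b - x \<bullet> b)) = 0"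
    by (auto simp: exp_bump_def zero_less_mult_iff simp del: of_nat_Suc)
  then show ?thesis
    unfolding box_bump_def using b(1) by (intro prod_zero bexI[of _ b]) auto
qed

lemma box_bump_bounds: "0 \<le> box_bump k a c x" "box_bump k a c x \<le> 1"
  unfolding box_bump_def
  by (auto intro!: prod_nonneg prod_le_1 mult_nonneg_nonneg mult_le_one exp_bump_nonneg exp_bump_0_le_1)

lemma exp_bump_scaled_tendsto_1:
  fixes t :: real
  assumes "t > 0" shows "(\<lambda>k. exp_bump 0 (Suc k * t)) \<longlonglongrightarrow> 1"
proof -
  have "(\<lambda>k. exp (- ((1 / t) * inverse (Suc k)))) \<longlonglongrightarrow> exp (- ((1 / t) * 0))"
    by (intro tendsto_intros LIMSEQ_inverse_real_of_nat)
  then show ?thesis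
    using assms by (simp add: exp_bump_def divide_inverse mult.commute zero_less_mult_iff)
qed

lemma box_bump_tendsto:
  fixes x :: "'a::euclidean_space"
  shows "(\<lambda>k. box_bump k a c x) \<longlonglongrightarrow> indicator (box a c) x"
proof (cases "x \<in> box a c")
  case True
  have "(\<lambda>k. box_bump k a c x) \<longlonglongrightarrow> (\<Prod>b\<in>(Basis :: 'a set). 1 * 1)"
    unfolding box_bump_def
    by (intro tendsto_prod tendsto_mult exp_bump_scaled_tendsto_1) (use True in \<open>auto simp: mem_box\<close>)
  then show ?thesis using True by simp
qed (simp add: box_bump_eq_0)

lemma box_bump_test:
  assumes "cbox a c \<subseteq> U" shows "box_bump k a c \<in> test_functions U"
  by (rule test_functionsI[OF smooth_box_bump compact_cbox assms])
    (use box_bump_eq_0 box_subset_cbox in blast)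

section \<open>Integrals of almost everywhere equal functions\<close>

lemma continuous_measurable_lebesgue:
  fixes \<phi> :: "'a::euclidean_space \<Rightarrow> 'b::topological_space"
  assumes "continuous_on UNIV \<phi>" shows "\<phi> \<in> borel_measurable lebesgue"
  using assms by (intro measurable_completion) (simp add: borel_measurable_continuous_onI)

text \<open>Completeness of Lebesgue measure carries measurability over to an almost everywhere
  equal function. If neither function is integrable, both integrals are 0 by convention.\<close>

lemma integral_lebesgue_cong_AE:
  fixes f g :: "'a::euclidean_space \<Rightarrow> 'b::euclidean_space"
  assumes "AE x in lebesgue. f x = g x"
  shows "integrable lebesgue f \<longleftrightarrow> integrable lebesgue g" and "integral\<^sup>L lebesgue f = integral\<^sup>L lebesgue g"
proof -
  have sym: "AE x in lebesgue. g x = f x" using assms by (auto elim: eventually_mono)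
  show *: "integrable lebesgue f \<longleftrightarrow> integrable lebesgue g"
    using borel_measurable_AE[OF _ assms] borel_measurable_AE[OF _ sym] assms sym
    by (blast intro: integrable_cong_AE_imp dest: borel_measurable_integrable)
  show "integral\<^sup>L lebesgue f = integral\<^sup>L lebesgue g"
  proof (cases "integrable lebesgue f")
    case True
    with * assms show ?thesis by (intro integral_cong_AE) auto
  next
    case False
    with * show ?thesis by (simp add: not_integrable_integral_eq)
  qed
qed

lemma set_integral_lebesgue_cong_AE:
  fixes f g :: "'a::euclidean_space \<Rightarrow> 'b::euclidean_space"
  assumes "AE x in lebesgue. x \<in> U \<longrightarrow> f x = g x"
  shows "set_integrable lebesgue U f \<longleftrightarrow> set_integrable lebesgue U g"
    and "(LINT x:U|lebesgue. f x) = (LINT x:U|lebesgue. g x)"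
proof -
  have "AE x in lebesgue. indicator U x *\<^sub>R f x = indicator U x *\<^sub>R g x"
    using assms by eventually_elim (auto simp: indicator_def)
  from integral_lebesgue_cong_AE[OF this]
  show "set_integrable lebesgue U f \<longleftrightarrow> set_integrable lebesgue U g"
    and "(LINT x:U|lebesgue. f x) = (LINT x:U|lebesgue. g x)"
    unfolding set_integrable_def set_lebesgue_integral_def by auto
qed

lemma locally_integrable_inner:
  "locally_integrable U G \<Longrightarrow> locally_integrable U (\<lambda>x. G x \<bullet> b)"
  using integrable_inner_left[of b lebesgue]
  by (fastforce simp: locally_integrable_def set_integrable_def)

lemma locally_integrable_diff:
  "locally_integrable U G \<Longrightarrow> locally_integrable U H \<Longrightarrow> locally_integrable U (\<lambda>x. G x - H x)"
  unfolding locally_integrable_def by (auto intro: set_integral_diff)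

lemma set_integrable_mult_compact_support:
  fixes g \<psi> :: "'a::euclidean_space \<Rightarrow> real"
  assumes g: "set_integrable lebesgue K g" and K: "compact K" "K \<subseteq> U"
    and \<psi>: "continuous_on UNIV \<psi>" "\<And>x. x \<notin> K \<Longrightarrow> \<psi> x = 0"
  shows "set_integrable lebesgue U (\<lambda>x. g x * \<psi> x)"
proof -
  obtain B where B: "B > 0" "\<And>x. norm (\<psi> x) \<le> B"
    using continuous_compact_support_bounded[OF \<psi>(1) K(1) \<psi>(2)] by blast
  have eq: "indicator U x *\<^sub>R (g x * \<psi> x) = (indicator K x *\<^sub>R g x) * \<psi> x" for x
    using K(2) \<psi>(2)[of x] by (auto simp: indicator_def)
  have "integrable lebesgue (\<lambda>x. (indicator K x *\<^sub>R g x) * \<psi> x)"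
  proof (rule Bochner_Integration.integrable_bound)
    show "integrable lebesgue (\<lambda>x. B * (indicator K x *\<^sub>R g x))"
      using g unfolding set_integrable_def by (intro integrable_mult_right)
    show "(\<lambda>x. (indicator K x *\<^sub>R g x) * \<psi> x) \<in> borel_measurable lebesgue"
      using g unfolding set_integrable_def
      by (intro borel_measurable_times borel_measurable_integrable continuous_measurable_lebesgue[OF \<psi>(1)])
    show "AE x in lebesgue. norm ((indicator K x *\<^sub>R g x) * \<psi> x) \<le> norm (B * (indicator K x *\<^sub>R g x))"
      using B by (auto simp: abs_mult mult.commute[of B] intro!: mult_left_mono)
  qed
  then show ?thesis unfolding set_integrable_def eq .
qed

section \<open>The fundamental lemma of the calculus of variations\<close>

text \<open>Test with \<open>box_bump k a c\<close> and let k grow; |g| on the closed box is an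
  integrable majorant.\<close>

lemma integral_box_eq_0:
  fixes g :: "'a::euclidean_space \<Rightarrow> real"
  assumes U: "cbox a c \<subseteq> U" and g: "set_integrable lebesgue (cbox a c) g"
    and zero: "\<And>\<psi>. \<psi> \<in> test_functions U \<Longrightarrow> (LINT x:U|lebesgue. g x * \<psi> x) = 0"
  shows "(LINT x:box a c|lebesgue. g x) = 0"
proof -
  let ?h = "\<lambda>x. indicator (cbox a c) x *\<^sub>R g x"
  have int: "integrable lebesgue ?h" using g unfolding set_integrable_def .
  have "(\<lambda>k. \<integral>x. ?h x * box_bump k a c x \<partial>lebesgue) \<longlonglongrightarrow> (\<integral>x. ?h x * indicator (box a c) x \<partial>lebesgue)"
  proof (rule integral_dominated_convergence)
    show "(\<lambda>x. ?h x * box_bump k a c x) \<in> borel_measurable lebesgue" for k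
      using int by (intro borel_measurable_times borel_measurable_integrable
          continuous_measurable_lebesgue[OF smooth_continuous[OF smooth_box_bump]])
    show "(\<lambda>x. ?h x * indicator (box a c) x) \<in> borel_measurable lebesgue"
      using int by (intro borel_measurable_times borel_measurable_integrable borel_measurable_indicator) auto
    show "integrable lebesgue (\<lambda>x. norm (?h x))" using int by (rule integrable_norm)
    show "AE x in lebesgue. (\<lambda>k. ?h x * box_bump k a c x) \<longlonglongrightarrow> ?h x * indicator (box a c) x"
      by (intro AE_I2 tendsto_intros box_bump_tendsto)
    show "AE x in lebesgue. norm (?h x * box_bump k a c x) \<le> norm (?h x)" for k
      using box_bump_bounds[of k a c]
      by (intro AE_I2) (auto simp: abs_mult indicator_def intro!: mult_left_le)
  qed
  moreover have "(\<integral>x. ?h x * box_bump k a c x \<partial>lebesgue) = 0" for k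
  proof -
    have "?h x * box_bump k a c x = indicator U x *\<^sub>R (g x * box_bump k a c x)" for x
      using U box_bump_eq_0[of x a c k] box_subset_cbox[of a c] by (auto simp: indicator_def)
    then show ?thesis using zero[OF box_bump_test[OF U]] unfolding set_lebesgue_integral_def by (simp only:)
  qed
  moreover have "?h x * indicator (box a c) x = indicator (box a c) x *\<^sub>R g x" for x
    using box_subset_cbox[of a c] by (auto simp: indicator_def)
  ultimately show ?thesis
    unfolding set_lebesgue_integral_def by (simp only: LIMSEQ_const_iff)
qed

text \<open>A Dynkin argument: boxes are stable under intersection and generate the Borel sets. The
  vanishing total integral handles complements, countable additivity handles disjoint
  unions.\<close>

lemma AE_eq_0_if_integral_boxes_eq_0:
  fixes h :: "'a::euclidean_space \<Rightarrow> real"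
  assumes int: "integrable lborel h" and all: "integral\<^sup>L lborel h = 0"
    and box: "\<And>a c. (\<integral>x. indicator (box a c) x * h x \<partial>lborel) = 0"
  shows "AE x in lborel. h x = 0"
proof -
  have m: "integrable lborel (\<lambda>x. indicator S x * h x)" if "S \<in> sets borel" for S
    using int that integrable_mult_indicator[of S lborel h] by simp
  have "(\<integral>x. indicator S x * h x \<partial>lborel) = 0" if "S \<in> sets borel" for S
  proof -
    have "Int_stable (range (\<lambda>(a, b). box a b :: 'a set))"
      by (auto simp: Int_stable_def box_Int_box)
    moreover have "range (\<lambda>(a, b). box a b :: 'a set) \<subseteq> Pow UNIV" by simp
    moreover have "S \<in> sigma_sets UNIV (range (\<lambda>(a, b). box a b :: 'a set))"
      using that unfolding borel_eq_box by (simp add: sets_measure_of)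
    ultimately show ?thesis
    proof (induction S rule: sigma_sets_induct_disjoint)
      case (basic A)
      then show ?case using box by auto
    next
      case empty
      then show ?case by simp
    next
      case (compl A)
      have A: "A \<in> sets borel" using compl(1) unfolding borel_eq_box by (simp add: sets_measure_of)
      have "indicator (UNIV - A) x * h x = h x - indicator A x * h x" for x
        by (auto simp: indicator_def)
      then show ?case using compl(2) all int m[OF A] by simp
    next
      case (union A)
      have A: "A i \<in> sets borel" for i
        using union(2) unfolding borel_eq_box by (auto simp: sets_measure_of)
      have "(LINT x:(\<Union>i. A i)|lborel. h x) = (\<Sum>i. (LINT x:A i|lborel. h x))"
        using A union(1) m[of "\<Union>i. A i"]
        by (intro lebesgue_integral_countable_add) (auto simp: disjoint_family_on_def set_integrable_def)
      then show ?case using union(3) unfolding set_lebesgue_integral_def by simp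
    qed
  qed
  then have "AE x in lborel. h x = (\<lambda>x. 0) x"
    by (intro density_unique_real int) (auto simp: set_lebesgue_integral_def)
  then show ?thesis by simp
qed

theorem fundamental_lemma_test_functions:
  fixes g :: "'a::euclidean_space \<Rightarrow> real"
  assumes U: "open U" and g: "locally_integrable U g"
    and zero: "\<And>\<psi>. \<psi> \<in> test_functions U \<Longrightarrow> (LINT x:U|lebesgue. g x * \<psi> x) = 0"
  shows "AE x in lebesgue. x \<in> U \<longrightarrow> g x = 0"
proof -
  have local: "AE x in lebesgue. x \<in> cbox a c \<longrightarrow> g x = 0" if ac: "cbox a c \<subseteq> U" for a c
  proof -
    have gi: "set_integrable lebesgue (cbox a' c') g" if "cbox a' c' \<subseteq> U" for a' c'
      using g that by (auto simp: locally_integrable_def)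
    let ?h = "\<lambda>x. indicator (box a c) x *\<^sub>R g x"
    have hi: "integrable lebesgue ?h"
      using set_integrable_subset[OF gi[OF ac], of "box a c"] box_subset_cbox[of a c]
      unfolding set_integrable_def by simp
    \<comment> \<open>The Dynkin argument lives on Borel sets, so the cut-off of g is replaced by a
      Borel function.\<close>
    then obtain h where h: "h \<in> borel_measurable lborel" "AE x in lborel. ?h x = h x"
      using completion_ex_borel_measurable_real[of ?h lborel] by auto
    have ae: "AE x in lebesgue. ?h x = h x" using h(2) by (rule AE_completion)
    have hi': "integrable lebesgue h" using hi integral_lebesgue_cong_AE(1)[OF ae] by simp
    then have hint: "integrable lborel h" using h(1) by (simp add: integrable_completion)
    have bx: "(\<integral>x. indicator (box a' c') x * h x \<partial>lborel) = 0" for a' c'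
    proof -
      define a'' c'' where "a'' = (\<Sum>i\<in>Basis. max (a' \<bullet> i) (a \<bullet> i) *\<^sub>R i)"
        and "c'' = (\<Sum>i\<in>Basis. min (c' \<bullet> i) (c \<bullet> i) *\<^sub>R i)"
      have e1: "box a' c' \<inter> box a c = box a'' c''"
        unfolding a''_def c''_def by (rule box_Int_box)
      have e2: "cbox a'' c'' \<subseteq> cbox a c"
        unfolding a''_def c''_def by (rule subset_box_imp(1)) simp
      have "AE x in lebesgue. indicator (box a' c') x * h x = indicator (box a'' c'') x *\<^sub>R g x"
        using ae
      proof eventually_elim
        case (elim x)
        then show ?case
          unfolding e1[symmetric] by (auto simp: indicator_def split: if_splits)
      qed
      note ae'' = integral_lebesgue_cong_AE(2)[OF this]
      have "(\<integral>x. indicator (box a' c') x * h x \<partial>lborel) = (\<integral>x. indicator (box a' c') x * h x \<partial>lebesgue)"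
        using h(1) by (subst integral_completion) auto
      also have "\<dots> = (\<integral>x. indicator (box a'' c'') x *\<^sub>R g x \<partial>lebesgue)"
        by (rule ae'')
      also have "\<dots> = 0"
        using integral_box_eq_0[OF _ gi zero, of a'' c''] subset_trans[OF e2 ac]
        unfolding set_lebesgue_integral_def by blast
      finally show ?thesis .
    qed
    have "integral\<^sup>L lborel h = integral\<^sup>L lebesgue h" using h(1) by (simp add: integral_completion)
    also have "\<dots> = (LINT x:box a c|lebesgue. g x)"
      unfolding set_lebesgue_integral_def
      by (rule integral_lebesgue_cong_AE(2)) (use ae in \<open>simp add: eq_commute\<close>)
    also have "\<dots> = 0" using integral_box_eq_0[OF ac gi[OF ac] zero] .
    finally have "AE x in lborel. h x = 0"
      using AE_eq_0_if_integral_boxes_eq_0[OF hint _ bx] by simp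
    then have "AE x in lebesgue. h x = 0" by (rule AE_completion)
    \<comment> \<open>The function h only controls g on the open box, while the countable cover of U
      consists of closed boxes.\<close>
    moreover have "AE x in lebesgue. x \<notin> cbox a c - box a c"
      using negligible_frontier_interval[of a c] by (intro AE_not_in) (simp add: negligible_iff_null_sets)
    ultimately show ?thesis using ae by eventually_elim (auto simp: indicator_def split: if_splits)
  qed
  obtain \<D> :: "'a set set" where D: "countable \<D>" "\<D> \<subseteq> Pow U" "\<And>X. X \<in> \<D> \<Longrightarrow> \<exists>a b. X = cbox a b" "\<Union>\<D> = U"
    by (rule open_countable_Union_open_cbox[OF U]) (rule that)
  have "AE x in lebesgue. \<forall>X\<in>\<D>. x \<in> X \<longrightarrow> g x = 0"
    unfolding AE_ball_countable[OF D(1)] using D(2,3) local by (metis PowD subsetD)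
  then show ?thesis by eventually_elim (use D(4) in auto)
qed

lemma has_weak_gradient_unique:
  fixes u :: "'a::euclidean_space \<Rightarrow> real"
  assumes U: "open U" and G: "has_weak_gradient U u G" and H: "has_weak_gradient U u H"
  shows "AE x in lebesgue. x \<in> U \<longrightarrow> G x = H x"
proof -
  have "AE x in lebesgue. x \<in> U \<longrightarrow> (G x - H x) \<bullet> b = 0" if b: "b \<in> Basis" for b
  proof (rule fundamental_lemma_test_functions[OF U])
    have Gi: "locally_integrable U (\<lambda>x. G x \<bullet> b)" and Hi: "locally_integrable U (\<lambda>x. H x \<bullet> b)"
      using G H unfolding has_weak_gradient_def by (auto intro: locally_integrable_inner)
    show "locally_integrable U (\<lambda>x. (G x - H x) \<bullet> b)"
      using locally_integrable_diff[OF Gi Hi] by (simp add: inner_diff_left)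
    fix \<psi> assume \<psi>: "\<psi> \<in> test_functions U"
    obtain K where K: "smooth \<psi>" "compact K" "K \<subseteq> U" "\<And>x. x \<notin> K \<Longrightarrow> \<psi> x = 0"
      using test_functionsE[OF \<psi>] by metis
    have int: "set_integrable lebesgue U (\<lambda>x. g x * \<psi> x)" if "locally_integrable U g" for g
      by (rule set_integrable_mult_compact_support[OF _ K(2,3) smooth_continuous[OF K(1)] K(4)])
        (use that K(2,3) in \<open>auto simp: locally_integrable_def\<close>)
    have "(LINT x:U|lebesgue. (G x - H x) \<bullet> b * \<psi> x)
        = (LINT x:U|lebesgue. G x \<bullet> b * \<psi> x) - (LINT x:U|lebesgue. H x \<bullet> b * \<psi> x)"
      unfolding set_integral_diff(2)[symmetric, OF int[OF Gi] int[OF Hi]]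
        inner_diff_left left_diff_distrib ..
    moreover have "(LINT x:U|lebesgue. u x * partial \<psi> b x) = - (LINT x:U|lebesgue. F x \<bullet> b * \<psi> x)"
      if "has_weak_gradient U u F" for F
      using that \<psi> b unfolding has_weak_gradient_def by blast
    from this[OF G] this[OF H]
    have "(LINT x:U|lebesgue. G x \<bullet> b * \<psi> x) = (LINT x:U|lebesgue. H x \<bullet> b * \<psi> x)" by simp
    ultimately show "(LINT x:U|lebesgue. (G x - H x) \<bullet> b * \<psi> x) = 0" by simp
  qed
  then have "AE x in lebesgue. \<forall>b\<in>Basis. x \<in> U \<longrightarrow> (G x - H x) \<bullet> b = 0"
    by (subst AE_ball_countable) (auto intro: countable_finite)
  then show ?thesis
  proof eventually_elim
    case (elim x)
    then show ?case
      by (intro impI euclidean_eqI[of "G x"]) (simp add: inner_diff_left)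
  qed
qed

section \<open>Restriction, null sets and Borel representatives\<close>

lemma locally_integrable_subset: "locally_integrable U g \<Longrightarrow> V \<subseteq> U \<Longrightarrow> locally_integrable V g"
  unfolding locally_integrable_def by (meson subset_trans)

text \<open>A test function on V is one on U, and all integrands vanish off its compact set K, so
  the domain of integration can be exchanged.\<close>

lemma has_weak_gradient_subset:
  fixes u :: "'a::euclidean_space \<Rightarrow> real"
  assumes G: "has_weak_gradient U u G" and V: "V \<subseteq> U"
  shows "has_weak_gradient V u G"
  unfolding has_weak_gradient_def
proof (intro conjI ballI)
  show "locally_integrable V u" "locally_integrable V G"
    using G locally_integrable_subset[OF _ V] unfolding has_weak_gradient_def by auto
  fix b :: 'a assume "b \<in> Basis"
  fix \<phi> assume \<phi>: "\<phi> \<in> test_functions V"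
  obtain K where K: "smooth \<phi>" "compact K" "K \<subseteq> V" "\<And>x. x \<notin> K \<Longrightarrow> \<phi> x = 0"
    using test_functionsE[OF \<phi>] by metis
  have "(LINT x:V|lebesgue. u x * partial \<phi> b x) = (LINT x:U|lebesgue. u x * partial \<phi> b x)"
    unfolding set_lebesgue_integral_def
  proof (intro Bochner_Integration.integral_cong refl)
    fix x
    show "indicator V x *\<^sub>R (u x * partial \<phi> b x) = indicator U x *\<^sub>R (u x * partial \<phi> b x)"
      using V K(3) frechet_derivative_eq_0_outside[of K \<phi> x b] K(2) K(4)
      by (auto simp: indicator_def)
  qed
  also have "\<dots> = - (LINT x:U|lebesgue. G x \<bullet> b * \<phi> x)"
    using G \<phi> \<open>b \<in> Basis\<close> test_functions_mono[OF V] unfolding has_weak_gradient_def by blast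
  also have "(LINT x:U|lebesgue. G x \<bullet> b * \<phi> x) = (LINT x:V|lebesgue. G x \<bullet> b * \<phi> x)"
    unfolding set_lebesgue_integral_def
  proof (intro Bochner_Integration.integral_cong refl)
    fix x
    show "indicator U x *\<^sub>R (G x \<bullet> b * \<phi> x) = indicator V x *\<^sub>R (G x \<bullet> b * \<phi> x)"
      using V K(3) K(4)[of x] by (auto simp: indicator_def)
  qed
  finally show "(LINT x:V|lebesgue. u x * partial \<phi> b x) = - (LINT x:V|lebesgue. G x \<bullet> b * \<phi> x)" .
qed

lemma locally_integrable_cong_AE:
  fixes g h :: "'a::euclidean_space \<Rightarrow> 'b::euclidean_space"
  assumes "AE x in lebesgue. x \<in> U \<longrightarrow> g x = h x"
  shows "locally_integrable U g \<longleftrightarrow> locally_integrable U h"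
proof -
  have "set_integrable lebesgue K g \<longleftrightarrow> set_integrable lebesgue K h" if "K \<subseteq> U" for K
    by (rule set_integral_lebesgue_cong_AE) (use assms that in \<open>auto elim!: eventually_mono\<close>)
  then show ?thesis unfolding locally_integrable_def by blast
qed

lemma has_weak_gradient_cong_AE:
  fixes u u' :: "'a::euclidean_space \<Rightarrow> real"
  assumes u: "AE x in lebesgue. x \<in> U \<longrightarrow> u x = u' x" and G: "AE x in lebesgue. x \<in> U \<longrightarrow> G x = G' x"
  shows "has_weak_gradient U u G \<longleftrightarrow> has_weak_gradient U u' G'"
proof -
  have "(LINT x:U|lebesgue. u x * h x) = (LINT x:U|lebesgue. u' x * h x)" for h
    by (rule set_integral_lebesgue_cong_AE) (use u in \<open>auto elim!: eventually_mono\<close>)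
  moreover have "(LINT x:U|lebesgue. G x \<bullet> b * h x) = (LINT x:U|lebesgue. G' x \<bullet> b * h x)" for b h
    by (rule set_integral_lebesgue_cong_AE) (use G in \<open>auto elim!: eventually_mono\<close>)
  ultimately show ?thesis
    unfolding has_weak_gradient_def locally_integrable_cong_AE[OF u] locally_integrable_cong_AE[OF G]
    by simp
qed

text \<open>As an equation between predicates this rewrites below the existential quantifier over
  the gradient.\<close>

lemma has_weak_gradient_cong_AE_fun:
  fixes u u' :: "'a::euclidean_space \<Rightarrow> real"
  assumes "AE x in lebesgue. x \<in> U \<longrightarrow> u x = u' x"
  shows "has_weak_gradient U u = has_weak_gradient U u'"
  using has_weak_gradient_cong_AE[OF assms AE_I2] by blast

lemma Lq_space_cong_AE:
  fixes g h :: "'a::euclidean_space \<Rightarrow> 'b::euclidean_space"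
  assumes "AE x in lebesgue. x \<in> U \<longrightarrow> g x = h x"
  shows "g \<in> Lq_space \<rho> q U \<longleftrightarrow> h \<in> Lq_space \<rho> q U"
proof -
  have "AE x in lebesgue. indicator U x *\<^sub>R g x = indicator U x *\<^sub>R h x"
    using assms by eventually_elim (auto simp: indicator_def)
  moreover from this have "AE x in lebesgue. indicator U x *\<^sub>R h x = indicator U x *\<^sub>R g x"
    by eventually_elim (rule sym)
  ultimately have "set_borel_measurable lebesgue U g \<longleftrightarrow> set_borel_measurable lebesgue U h"
    unfolding set_borel_measurable_def by (metis borel_measurable_AE)
  moreover have "set_integrable lebesgue U (\<lambda>x. norm (g x) powr q * \<rho> x) \<longleftrightarrow>
      set_integrable lebesgue U (\<lambda>x. norm (h x) powr q * \<rho> x)"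
    by (rule set_integral_lebesgue_cong_AE) (use assms in \<open>auto elim!: eventually_mono\<close>)
  ultimately show ?thesis by (simp add: Lq_space_def)
qed

lemma W1q_space_cong_AE:
  fixes u u' :: "'a::euclidean_space \<Rightarrow> real"
  assumes "AE x in lebesgue. x \<in> U \<longrightarrow> u x = u' x"
  shows "u \<in> W1q_space \<rho> q U \<longleftrightarrow> u' \<in> W1q_space \<rho> q U"
  unfolding W1q_space_def using Lq_space_cong_AE[OF assms] has_weak_gradient_cong_AE_fun[OF assms] by simp

lemma radial_weak_supersolution_cong_AE:
  assumes ae: "AE r in lebesgue. r \<in> {0<..<R} \<longrightarrow> v r = v' r"
  shows "radial_weak_supersolution \<kappa> q d R f v \<longleftrightarrow> radial_weak_supersolution \<kappa> q d R f v'"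
proof -
  have "v \<in> W1q_space \<rho> q {0<..<R'} \<longleftrightarrow> v' \<in> W1q_space \<rho> q {0<..<R'}" if "R' \<in> {0<..<R}" for R' \<rho>
    by (rule W1q_space_cong_AE) (use that ae in \<open>auto elim!: eventually_mono\<close>)
  then show ?thesis
    unfolding radial_weak_supersolution_def using has_weak_gradient_cong_AE_fun[OF ae] by simp
qed

lemma qLaplace_weak_supersolution_cong_AE:
  fixes u u' :: "'a::euclidean_space \<Rightarrow> real"
  assumes ae: "AE x in lebesgue. x \<in> ball 0 R \<longrightarrow> u x = u' x"
  shows "qLaplace_weak_supersolution q R f u \<longleftrightarrow> qLaplace_weak_supersolution q R f u'"
proof -
  have "u \<in> W1q_space \<rho> q V \<longleftrightarrow> u' \<in> W1q_space \<rho> q V" if "closure V \<subseteq> ball 0 R" for V \<rho>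
  proof (rule W1q_space_cong_AE)
    have "V \<subseteq> ball 0 R" using that closure_subset by blast
    then show "AE x in lebesgue. x \<in> V \<longrightarrow> u x = u' x"
      using ae by (auto elim!: eventually_mono)
  qed
  then show ?thesis
    unfolding qLaplace_weak_supersolution_def W1q_loc_def using has_weak_gradient_cong_AE_fun[OF ae] by auto
qed

text \<open>The bridge from \<open>lebesgue\<close> to \<open>lborel\<close>, where polar
  coordinates are formulated. Compact sets exhausting U turn local integrability into measurability
  on all of U.\<close>

lemma locally_integrable_Borel_representative:
  fixes g :: "'a::euclidean_space \<Rightarrow> 'b::euclidean_space"
  assumes U: "open U" and g: "locally_integrable U g"
  obtains g' where "g' \<in> borel_measurable borel" and "AE x in lebesgue. x \<in> U \<longrightarrow> g x = g' x"
proof -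
  obtain C where C: "\<And>n. compact (C n)" "\<And>n. C n \<subseteq> U" "\<And>n. C n \<subseteq> C (Suc n)" "(\<Union>n. C n) = U"
    using open_Union_compact_subsets[OF U] by (metis interior_subset subset_trans)
  have m: "(\<lambda>x. indicator U x *\<^sub>R g x) \<in> borel_measurable lebesgue"
  proof (rule borel_measurable_LIMSEQ_metric)
    show "(\<lambda>x. indicator (C n) x *\<^sub>R g x) \<in> borel_measurable lebesgue" for n
      using g C(1,2) unfolding locally_integrable_def set_integrable_def
      by (blast intro: borel_measurable_integrable)
    show "(\<lambda>n. indicator (C n) x *\<^sub>R g x) \<longlonglongrightarrow> indicator U x *\<^sub>R g x" for x
    proof (cases "x \<in> U")
      case True
      then obtain n where "x \<in> C n" using C(4) by blast
      then have "x \<in> C m" if "n \<le> m" for m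
        using lift_Suc_mono_le[of C, OF C(3) that] by blast
      then have "\<forall>\<^sub>F m in sequentially. indicator U x *\<^sub>R g x = indicator (C m) x *\<^sub>R g x"
        using True by (auto simp: eventually_sequentially intro!: exI[of _ n])
      then show ?thesis by (rule Lim_transform_eventually[OF tendsto_const])
    next
      case False
      then have "x \<notin> C n" for n using C(2) by blast
      with False show ?thesis by simp
    qed
  qed
  \<comment> \<open>Borel representatives are taken coordinate by coordinate, since the result about
    completions concerns real functions.\<close>
  have "\<exists>h. h \<in> borel_measurable lborel \<and> (AE x in lborel. (indicator U x *\<^sub>R g x) \<bullet> b = h x)" for b
  proof -
    have "(\<lambda>x. (indicator U x *\<^sub>R g x) \<bullet> b) \<in> borel_measurable (completion lborel)"
      using m by (intro borel_measurable_inner borel_measurable_const)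
    from completion_ex_borel_measurable_real[OF this] show ?thesis by blast
  qed
  then obtain h where h: "\<And>b. h b \<in> borel_measurable lborel"
      "\<And>b. AE x in lborel. (indicator U x *\<^sub>R g x) \<bullet> b = h b x"
    by metis
  have "AE x in lborel. \<forall>b\<in>Basis. (indicator U x *\<^sub>R g x) \<bullet> b = h b x"
    using h(2) by (subst AE_ball_countable) (auto intro: countable_finite)
  then have "AE x in lborel. x \<in> U \<longrightarrow> g x = (\<Sum>b\<in>Basis. h b x *\<^sub>R b)"
  proof eventually_elim
    case (elim x)
    then show ?case by (auto intro!: euclidean_eqI[of "g x"])
  qed
  then have "AE x in lebesgue. x \<in> U \<longrightarrow> g x = (\<Sum>b\<in>Basis. h b x *\<^sub>R b)" by (rule AE_completion)
  moreover have "(\<lambda>x. \<Sum>b\<in>Basis. h b x *\<^sub>R b) \<in> borel_measurable borel"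
    using h(1) by (auto intro!: borel_measurable_sum borel_measurable_scaleR)
  ultimately show ?thesis using that by blast
qed

section \<open>Polar coordinates\<close>

text \<open>The sphere is not needed as a manifold: its measure is the image under \<open>sgn\<close> of Lebesgue
  measure on the unit ball, so its total mass is the volume of the ball and the radial density
  carries the factor \<open>n\<close>.\<close>

definition sphere_measure :: "'a::euclidean_space measure" where
  "sphere_measure = distr (density lborel (indicator (cball 0 1))) borel sgn"

definition radial_density :: "nat \<Rightarrow> real \<Rightarrow> real" where
  "radial_density n r = (if 0 < r then n * r ^ (n - 1) else 0)"

definition radial_measure :: "nat \<Rightarrow> real measure" where
  "radial_measure n = density lborel (radial_density n)"

lemma sgn_borel_measurable [measurable]: "(sgn :: 'a::euclidean_space \<Rightarrow> 'a) \<in> borel_measurable borel"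
  unfolding sgn_div_norm by measurable

lemma norm_scaleR_sgn: "norm x *\<^sub>R sgn x = (x::'a::real_normed_vector)"
  by (cases "x = 0") (simp_all add: sgn_div_norm)

lemma radial_density_measurable [measurable]: "radial_density n \<in> borel_measurable borel"
  unfolding radial_density_def by measurable

lemma radial_density_nonneg [simp]: "0 \<le> radial_density n r"
  by (simp add: radial_density_def)

lemma sets_radial_measure [measurable_cong, simp]: "sets (radial_measure n) = sets borel"
  and space_radial_measure [simp]: "space (radial_measure n) = UNIV"
  by (simp_all add: radial_measure_def)

lemma sets_sphere_measure [measurable_cong, simp]: "sets sphere_measure = sets borel"
  and space_sphere_measure [simp]: "space sphere_measure = UNIV"
  by (simp_all add: sphere_measure_def)

lemma emeasure_sphere_measure:
  fixes B :: "'a::euclidean_space set"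
  assumes [measurable]: "B \<in> sets borel"
  shows "emeasure sphere_measure B = emeasure lborel {x. norm x \<le> 1 \<and> sgn x \<in> B}"
proof -
  have "emeasure sphere_measure B
      = emeasure (density lborel (indicator (cball 0 1))) {x :: 'a. sgn x \<in> B}"
    unfolding sphere_measure_def by (subst emeasure_distr) (auto simp: vimage_def)
  also have "\<dots> = (\<integral>\<^sup>+x. indicator {x. norm x \<le> 1 \<and> sgn x \<in> B} x \<partial>lborel)"
  proof (subst emeasure_density)
    show "(\<integral>\<^sup>+x. indicator (cball 0 1) x * indicator {x::'a. sgn x \<in> B} x \<partial>lborel) =
        (\<integral>\<^sup>+x. indicator {x. norm x \<le> 1 \<and> sgn x \<in> B} x \<partial>lborel)"
      by (rule nn_integral_cong) (simp add: indicator_def)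
  qed (simp_all add: borel_measurable_indicator)
  also have "\<dots> = emeasure lborel {x. norm x \<le> 1 \<and> sgn x \<in> B}"
    by (rule nn_integral_indicator) measurable
  finally show ?thesis .
qed

lemma emeasure_sphere_measure_UNIV:
  "emeasure (sphere_measure :: 'a::euclidean_space measure) UNIV = emeasure lborel (cball (0::'a) 1)"
  by (simp add: emeasure_sphere_measure cball_def)

interpretation sphere: finite_measure "sphere_measure :: 'a::euclidean_space measure"
  by (rule finite_measureI)
    (use emeasure_lborel_cball_finite[of "0::'a" 1] in \<open>simp add: emeasure_sphere_measure_UNIV\<close>)

text \<open>In the normalisation of \<open>sphere_measure\<close> this is the volume of the unit
  ball, that is, the usual surface area divided by the dimension.\<close>

definition sphere_area :: "'a::euclidean_space itself \<Rightarrow> real" where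
  "sphere_area _ = measure (sphere_measure :: 'a measure) UNIV"

lemma sphere_area_pos: "sphere_area TYPE('a::euclidean_space) > 0"
  unfolding sphere_area_def measure_def emeasure_sphere_measure_UNIV
  using content_cball_pos[of 1 "0::'a"] by (simp add: measure_def)

text \<open>The map \<open>sgn\<close> sends the ball into the unit sphere except for the origin,
  which has measure zero. The measure itself is defined on the whole space, so norm 1 is available
  only almost everywhere.\<close>

lemma AE_sphere_norm: "AE w in sphere_measure. norm (w::'a::euclidean_space) = 1"
proof -
  have "AE x in (lborel :: 'a measure). x \<in> cball 0 1 \<longrightarrow> norm (sgn x) = 1"
    using AE_lborel_singleton[of "0::'a"] by eventually_elim (simp add: norm_sgn)
  then have "AE x in density lborel (indicator (cball 0 1)). norm (sgn x :: 'a) = 1"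
    by (subst AE_density) (auto elim: eventually_mono simp: indicator_def borel_measurable_indicator)
  then show ?thesis
    unfolding sphere_measure_def by (subst AE_distr_iff) auto
qed

lemma AE_sphere_inner_le:
  fixes b :: "'a::euclidean_space"
  assumes "b \<in> Basis"
  shows "AE w in sphere_measure. \<bar>w \<bullet> b\<bar> \<le> 1"
  using AE_sphere_norm
proof eventually_elim
  case (elim w)
  then show ?case using Basis_le_norm[OF assms, of w] by simp
qed

lemma emeasure_radial_measure_atMost:
  assumes "n \<ge> 1" shows "emeasure (radial_measure n) {..s} = ennreal (max 0 s ^ n)"
proof -
  have "emeasure (radial_measure n) {..s} = (\<integral>\<^sup>+r. ennreal (radial_density n r) * indicator {..s} r \<partial>lborel)"
    unfolding radial_measure_def by (subst emeasure_density) auto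
  also have "\<dots> = (\<integral>\<^sup>+r. ennreal (n * r ^ (n - 1)) * indicator {0..max 0 s} r \<partial>lborel)"
  proof (rule nn_integral_cong_AE)
    show "AE r in lborel. ennreal (radial_density n r) * indicator {..s} r
        = ennreal (n * r ^ (n - 1)) * indicator {0..max 0 s} r"
      using AE_lborel_singleton[of "0::real"]
      by eventually_elim (auto simp: radial_density_def indicator_def)
  qed
  also have "\<dots> = ennreal (max 0 s ^ n - 0 ^ n)"
    by (rule nn_integral_FTC_Icc) (auto intro!: derivative_eq_intros)
  finally show ?thesis using assms by (simp add: zero_power)
qed

text \<open>For s > 0, dilation by s maps the cone truncated at radius 1 onto the one truncated at s
  and multiplies volume by the power \<open>s ^ DIM('a)\<close>. For s <= 0 the cone is contained in
  {0}.\<close>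

lemma emeasure_cone:
  fixes B :: "'a::euclidean_space set"
  assumes [measurable]: "B \<in> sets borel"
  shows "emeasure lborel {x. norm x \<le> s \<and> sgn x \<in> B} = ennreal (max 0 s ^ DIM('a)) * emeasure sphere_measure B"
proof (cases "s > 0")
  case True
  have "emeasure lborel {x. norm x \<le> s \<and> sgn x \<in> B} =
      emeasure (density (distr lborel borel (\<lambda>x. 0 + s *\<^sub>R x)) (\<lambda>_. \<bar>s\<bar> ^ DIM('a))) {x. norm x \<le> s \<and> sgn x \<in> B}"
    using lborel_affine[of s "0::'a"] True by simp
  also have "\<dots> = ennreal (s ^ DIM('a)) * emeasure (distr lborel borel (\<lambda>x. s *\<^sub>R x)) {x::'a. norm x \<le> s \<and> sgn x \<in> B}"
    using True by (subst emeasure_density_const) auto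
  also have "emeasure (distr lborel borel (\<lambda>x. s *\<^sub>R x)) {x::'a. norm x \<le> s \<and> sgn x \<in> B} =
      emeasure lborel {x. norm x \<le> 1 \<and> sgn x \<in> B}"
  proof (subst emeasure_distr)
    have "norm (s *\<^sub>R x) \<le> s \<longleftrightarrow> norm x \<le> 1" "sgn (s *\<^sub>R x) = sgn x" for x :: 'a
      using True by (simp_all add: sgn_scaleR mult_le_cancel_left1)
    then show "emeasure lborel ((\<lambda>x. s *\<^sub>R x) -` {x::'a. norm x \<le> s \<and> sgn x \<in> B} \<inter> space lborel) =
        emeasure lborel {x. norm x \<le> 1 \<and> sgn x \<in> B}"
      by (simp add: vimage_def)
  qed auto
  finally show ?thesis using True by (simp add: emeasure_sphere_measure)
next
  case False
  then have "{x. norm x \<le> s \<and> sgn x \<in> B} \<subseteq> {0}"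
    by auto (metis norm_le_zero_iff order_trans not_less)
  then have "emeasure lborel {x. norm x \<le> s \<and> sgn x \<in> B} \<le> emeasure lborel {0 :: 'a}"
    by (rule emeasure_mono) simp
  then show ?thesis using False by (simp add: zero_power max_absorb1)
qed

lemma sigma_finite_radial_measure: "sigma_finite_measure (radial_measure n)"
  unfolding radial_measure_def by (subst sigma_finite_measure.sigma_finite_iff_density_finite[OF sigma_finite_lborel]) auto

text \<open>It suffices to compare the measures on products A \<times> B. For fixed B both sides are
  measures in A, here M1 and M2, and \<open>emeasure_cone\<close> says that they agree on
  half-lines, which generate the Borel sets.\<close>

lemma distr_lborel_norm_sgn:
  "distr lborel (borel \<Otimes>\<^sub>M borel) (\<lambda>x::'a::euclidean_space. (norm x, sgn x)) =
    radial_measure DIM('a) \<Otimes>\<^sub>M sphere_measure"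
proof (rule pair_measure_eqI[symmetric])
  show "sigma_finite_measure (radial_measure DIM('a))" by (rule sigma_finite_radial_measure)
  show "sigma_finite_measure (sphere_measure :: 'a measure)" ..
  show "sets (radial_measure DIM('a) \<Otimes>\<^sub>M (sphere_measure :: 'a measure)) =
      sets (distr lborel (borel \<Otimes>\<^sub>M borel) (\<lambda>x::'a. (norm x, sgn x)))"
    by (simp cong: sets_pair_measure_cong)
  fix A and B :: "'a set"
  assume "A \<in> sets (radial_measure DIM('a))" and "B \<in> sets sphere_measure"
  then have A[measurable]: "A \<in> sets borel" and B[measurable]: "B \<in> sets borel" by simp_all
  define M1 where "M1 = density (radial_measure DIM('a)) (\<lambda>_. emeasure sphere_measure B)"
  define M2 where "M2 = distr (density lborel (indicator {x::'a. sgn x \<in> B})) borel norm"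
  have e1: "emeasure M1 C = emeasure (radial_measure DIM('a)) C * emeasure sphere_measure B"
    if "C \<in> sets borel" for C
    unfolding M1_def using that by (subst emeasure_density_const) (auto simp: mult.commute)
  have e2: "emeasure M2 C = emeasure lborel {x. norm x \<in> C \<and> sgn x \<in> B}"
    if C[measurable]: "C \<in> sets borel" for C
  proof -
    have "emeasure M2 C = emeasure (density lborel (indicator {x::'a. sgn x \<in> B})) {x. norm x \<in> C}"
      unfolding M2_def by (subst emeasure_distr) (auto simp: vimage_def)
    also have "\<dots> = (\<integral>\<^sup>+x. indicator {x. norm x \<in> C \<and> sgn x \<in> B} x \<partial>lborel)"
    proof (subst emeasure_density)
      show "(\<integral>\<^sup>+x. indicator {x::'a. sgn x \<in> B} x * indicator {x. norm x \<in> C} x \<partial>lborel) =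
          (\<integral>\<^sup>+x. indicator {x. norm x \<in> C \<and> sgn x \<in> B} x \<partial>lborel)"
        by (rule nn_integral_cong) (auto simp: indicator_def)
    qed simp_all
    also have "\<dots> = emeasure lborel {x. norm x \<in> C \<and> sgn x \<in> B}"
      by (rule nn_integral_indicator) measurable
    finally show ?thesis .
  qed
  have "M1 = M2"
  proof (rule measure_eqI_generator_eq[where \<Omega>=UNIV and E="range (\<lambda>a. {..a})" and A="\<lambda>i. {..real i}"])
    show "Int_stable (range (\<lambda>a. {..a::real}))" by (auto simp: Int_stable_def)
    show "sets M1 = sigma_sets UNIV (range (\<lambda>a. {..a}))" "sets M2 = sigma_sets UNIV (range (\<lambda>a. {..a}))"
      by (simp_all add: M1_def M2_def borel_eq_atMost sets_measure_of)
    show "(\<Union>i. {..real i}) = UNIV" using real_arch_simple by blast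
    show eq: "emeasure M1 X = emeasure M2 X" if X: "X \<in> range (\<lambda>a. {..a})" for X
    proof -
      obtain s where "X = {..s}" using X by blast
      then show ?thesis
        using emeasure_cone[OF B, of s]
        by (simp add: e1 e2 emeasure_radial_measure_atMost Suc_le_eq)
    qed
    show "emeasure M1 {..real i} \<noteq> \<infinity>" for i
      using e1[of "{..real i}"] sphere.emeasure_finite[of B]
      by (simp add: emeasure_radial_measure_atMost ennreal_mult_eq_top_iff Suc_le_eq)
  qed auto
  then have "emeasure M1 A = emeasure M2 A" by simp
  also have "\<dots> = emeasure (distr lborel (borel \<Otimes>\<^sub>M borel) (\<lambda>x::'a. (norm x, sgn x))) (A \<times> B)"
    unfolding e2[OF A] by (subst emeasure_distr) (auto simp: vimage_def)
  finally show "emeasure (radial_measure DIM('a)) A * emeasure sphere_measure B =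
      emeasure (distr lborel (borel \<Otimes>\<^sub>M borel) (\<lambda>x::'a. (norm x, sgn x))) (A \<times> B)"
    by (simp add: e1)
qed

text \<open>The map (r, w) to r w undoes x to (norm x, sgn x), at x = 0 as well.\<close>

lemma distr_polar_lborel:
  "distr (radial_measure DIM('a) \<Otimes>\<^sub>M sphere_measure) borel (\<lambda>(r, w). r *\<^sub>R w) =
    (lborel :: 'a::euclidean_space measure)"
  unfolding distr_lborel_norm_sgn[symmetric]
  by (subst distr_distr) (auto simp: comp_def norm_scaleR_sgn distr_id2 split_beta)

interpretation polar: pair_sigma_finite "radial_measure n" "sphere_measure :: 'a::euclidean_space measure"
  by (simp add: pair_sigma_finite_def sigma_finite_radial_measure sphere.sigma_finite_measure_axioms)

lemma AE_polar:
  fixes P :: "'a::euclidean_space \<Rightarrow> bool"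
  assumes "AE x in lborel. P x"
  shows "AE r in radial_measure DIM('a). AE w in sphere_measure. P (r *\<^sub>R w)"
proof -
  have "AE z in radial_measure DIM('a) \<Otimes>\<^sub>M sphere_measure. P ((\<lambda>(r, w). r *\<^sub>R w) z)"
    using assms unfolding distr_polar_lborel[symmetric]
    by (rule AE_distrD[where M'=borel and P=P, rotated]) measurable
  from polar.AE_pair[OF this] show ?thesis by simp
qed

lemma AE_radial_measure: "n \<ge> 1 \<Longrightarrow> (AE r in radial_measure n. P r) \<longleftrightarrow> (AE r in lborel. r > 0 \<longrightarrow> P r)"
  unfolding radial_measure_def by (subst AE_density) (auto simp: radial_density_def)

lemma integral_radial_measure:
  fixes g :: "real \<Rightarrow> real"
  assumes "g \<in> borel_measurable borel"
  shows "integral\<^sup>L (radial_measure n) g = (\<integral>r. radial_density n r * g r \<partial>lborel)"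
    and "integrable (radial_measure n) g \<longleftrightarrow> integrable lborel (\<lambda>r. radial_density n r * g r)"
  unfolding radial_measure_def using assms by (simp_all add: integral_density integrable_density)

lemma integral_polar:
  fixes F :: "'a::euclidean_space \<Rightarrow> real"
  assumes F: "integrable lborel F"
  shows "integrable (radial_measure DIM('a)) (\<lambda>r. \<integral>w. F (r *\<^sub>R w) \<partial>sphere_measure)"
    and "integral\<^sup>L lborel F = (\<integral>r. (\<integral>w. F (r *\<^sub>R w) \<partial>sphere_measure) \<partial>radial_measure DIM('a))"
proof -
  have [measurable]: "F \<in> borel_measurable borel" using F by simp
  have int: "integrable (radial_measure DIM('a) \<Otimes>\<^sub>M sphere_measure) (\<lambda>(r, w). F (r *\<^sub>R w))"
    using F unfolding distr_polar_lborel[symmetric]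
    by (subst (asm) integrable_distr_eq) (auto simp: case_prod_beta')
  show "integrable (radial_measure DIM('a)) (\<lambda>r. \<integral>w. F (r *\<^sub>R w) \<partial>sphere_measure)"
    using polar.integrable_fst'[OF int] by simp
  have "integral\<^sup>L lborel F = integral\<^sup>L (radial_measure DIM('a) \<Otimes>\<^sub>M sphere_measure) (\<lambda>(r, w). F (r *\<^sub>R w))"
    by (subst distr_polar_lborel[symmetric], subst integral_distr) (auto simp: case_prod_beta')
  also have "\<dots> = (\<integral>r. (\<integral>w. F (r *\<^sub>R w) \<partial>sphere_measure) \<partial>radial_measure DIM('a))"
    using polar.integral_fst'[OF int] by simp
  finally show "integral\<^sup>L lborel F = (\<integral>r. (\<integral>w. F (r *\<^sub>R w) \<partial>sphere_measure) \<partial>radial_measure DIM('a))" .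
qed

lemma distr_lborel_norm:
  "distr lborel borel (norm :: 'a::euclidean_space \<Rightarrow> real) =
    density (radial_measure DIM('a)) (\<lambda>_. ennreal (sphere_area TYPE('a)))"
proof (rule measure_eqI)
  fix A :: "real set" assume "A \<in> sets (distr lborel borel (norm :: 'a \<Rightarrow> real))"
  then have A[measurable]: "A \<in> sets borel" by simp
  have "emeasure (distr lborel borel (norm :: 'a \<Rightarrow> real)) A =
      emeasure (distr lborel (borel \<Otimes>\<^sub>M borel) (\<lambda>x::'a. (norm x, sgn x))) (A \<times> UNIV)"
    by (subst (1 2) emeasure_distr) (auto simp: vimage_def)
  also have "\<dots> = emeasure (radial_measure DIM('a)) A * emeasure (sphere_measure :: 'a measure) UNIV"
    unfolding distr_lborel_norm_sgn by (rule sphere.emeasure_pair_measure_Times) auto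
  finally show "emeasure (distr lborel borel (norm :: 'a \<Rightarrow> real)) A =
      emeasure (density (radial_measure DIM('a)) (\<lambda>_. ennreal (sphere_area TYPE('a)))) A"
    by (simp add: emeasure_density_const sphere_area_def sphere.emeasure_eq_measure mult.commute)
qed simp

text \<open>Obtained from the distribution of the norm and not from \<open>integral_polar\<close>,
  because integrability has to pass in both directions.\<close>

lemma integral_norm_compose:
  fixes g :: "real \<Rightarrow> real"
  assumes [measurable]: "g \<in> borel_measurable borel"
  shows "integrable lborel (\<lambda>x::'a::euclidean_space. g (norm x)) \<longleftrightarrow> integrable (radial_measure DIM('a)) g"
    and "(\<integral>x. g (norm (x::'a)) \<partial>lborel) = sphere_area TYPE('a) * integral\<^sup>L (radial_measure DIM('a)) g"
proof -
  have "integrable lborel (\<lambda>x::'a. g (norm x)) \<longleftrightarrow> integrable (distr lborel borel (norm :: 'a \<Rightarrow> real)) g"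
    by (subst integrable_distr_eq) auto
  also have "\<dots> \<longleftrightarrow> integrable (radial_measure DIM('a)) g"
    unfolding distr_lborel_norm using sphere_area_pos[where 'a='a] by (subst integrable_density) auto
  finally show "integrable lborel (\<lambda>x::'a. g (norm x)) \<longleftrightarrow> integrable (radial_measure DIM('a)) g" .
  have "(\<integral>x. g (norm (x::'a)) \<partial>lborel) = integral\<^sup>L (distr lborel borel (norm :: 'a \<Rightarrow> real)) g"
    by (subst integral_distr) auto
  also have "\<dots> = sphere_area TYPE('a) * integral\<^sup>L (radial_measure DIM('a)) g"
    unfolding distr_lborel_norm using sphere_area_pos[where 'a='a] by (subst integral_density) auto
  finally show "(\<integral>x. g (norm (x::'a)) \<partial>lborel) = sphere_area TYPE('a) * integral\<^sup>L (radial_measure DIM('a)) g" .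
qed

lemma AE_norm_compose:
  fixes P :: "real \<Rightarrow> bool"
  assumes "AE r in lborel. r > 0 \<longrightarrow> P r"
  shows "AE x in lborel. P (norm (x::'a::euclidean_space))"
proof -
  have "AE r in radial_measure DIM('a). P r" using assms by (simp add: AE_radial_measure Suc_le_eq)
  then have "AE r in distr lborel borel (norm :: 'a \<Rightarrow> real). P r"
    unfolding distr_lborel_norm by (subst AE_density) (auto elim: eventually_mono)
  then show ?thesis by (rule AE_distrD[rotated]) simp
qed

section \<open>Differentiation under the integral sign\<close>

text \<open>Dominated convergence along an arbitrary sequence tending to 0; by the mean value
  inequality g dominates the difference quotients.\<close>

lemma has_real_derivative_integral:
  fixes f f' :: "real \<Rightarrow> 'b \<Rightarrow> real"
  assumes int: "\<And>r. integrable M (f r)"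
    and der: "\<And>r w. ((\<lambda>r. f r w) has_real_derivative f' r w) (at r)"
    and bound: "AE w in M. \<forall>r. \<bar>r - r0\<bar> < 1 \<longrightarrow> \<bar>f' r w\<bar> \<le> g w"
    and g: "integrable M g" and f': "f' r0 \<in> borel_measurable M"
  shows "((\<lambda>r. integral\<^sup>L M (f r)) has_real_derivative integral\<^sup>L M (f' r0)) (at r0)"
proof -
  have "((\<lambda>h. (integral\<^sup>L M (f (r0 + h)) - integral\<^sup>L M (f r0)) / h) \<longlongrightarrow> integral\<^sup>L M (f' r0)) (at 0)"
    unfolding tendsto_at_iff_sequentially
  proof (intro allI impI)
    fix X :: "nat \<Rightarrow> real"
    assume X0: "\<forall>i. X i \<in> UNIV - {0}" and X: "X \<longlonglongrightarrow> 0"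
    obtain m where m: "\<And>i. i \<ge> m \<Longrightarrow> \<bar>X i\<bar> < 1"
      using LIMSEQ_D[OF X, of 1] by auto
    \<comment> \<open>The majorant is valid only within distance 1 of r0, so an initial segment of
      the sequence is dropped.\<close>
    define Y where "Y i = X (i + m)" for i
    have Y: "Y i \<noteq> 0" "\<bar>Y i\<bar> < 1" for i using X0 m by (auto simp: Y_def)
    have Y0: "Y \<longlonglongrightarrow> 0" unfolding Y_def by (rule LIMSEQ_ignore_initial_segment[OF X])
    have "(\<lambda>i. \<integral>w. (f (r0 + Y i) w - f r0 w) / Y i \<partial>M) \<longlonglongrightarrow> integral\<^sup>L M (f' r0)"
    proof (rule integral_dominated_convergence[OF f' _ g])
      show "(\<lambda>w. (f (r0 + Y i) w - f r0 w) / Y i) \<in> borel_measurable M" for i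
        using int by (intro borel_measurable_divide borel_measurable_diff) auto
      show "AE w in M. (\<lambda>i. (f (r0 + Y i) w - f r0 w) / Y i) \<longlonglongrightarrow> f' r0 w"
      proof (rule AE_I2)
        fix w
        have "((\<lambda>h. (f (r0 + h) w - f r0 w) / h) \<longlongrightarrow> f' r0 w) (at 0)"
          using der[of w r0] by (simp add: DERIV_def)
        then show "(\<lambda>i. (f (r0 + Y i) w - f r0 w) / Y i) \<longlonglongrightarrow> f' r0 w"
          using Y Y0 unfolding tendsto_at_iff_sequentially by (auto simp: comp_def)
      qed
      show "AE w in M. norm ((f (r0 + Y i) w - f r0 w) / Y i) \<le> g w" for i
        using bound
      proof eventually_elim
        case (elim w)
        have "norm (f (r0 + Y i) w - f r0 w) \<le> g w * norm (r0 + Y i - r0)"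
        proof (rule field_differentiable_bound[where S="ball r0 1" and f'="\<lambda>r. f' r w"])
          show "((\<lambda>r. f r w) has_field_derivative f' z w) (at z within ball r0 1)" for z
            using der has_field_derivative_at_within by blast
        qed (use elim Y in \<open>auto simp: dist_real_def abs_minus_commute\<close>)
        then show ?case using Y[of i] by (simp add: field_simps)
      qed
    qed
    moreover have "(\<integral>w. (f (r0 + Y i) w - f r0 w) / Y i \<partial>M) =
        (integral\<^sup>L M (f (r0 + Y i)) - integral\<^sup>L M (f r0)) / Y i" for i
      by (simp only: integral_divide_zero Bochner_Integration.integral_diff[OF int int])
    ultimately have "(\<lambda>i. (integral\<^sup>L M (f (r0 + Y i)) - integral\<^sup>L M (f r0)) / Y i) \<longlonglongrightarrow> integral\<^sup>L M (f' r0)"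
      by (simp only:)
    then show "((\<lambda>h. (integral\<^sup>L M (f (r0 + h)) - integral\<^sup>L M (f r0)) / h) \<circ> X) \<longlonglongrightarrow> integral\<^sup>L M (f' r0)"
      unfolding Y_def comp_def by (rule LIMSEQ_offset)
  qed
  then show ?thesis by (simp add: DERIV_def)
qed

lemma integrable_continuous_compact_support:
  fixes \<phi> :: "'a::euclidean_space \<Rightarrow> real"
  assumes \<phi>: "continuous_on UNIV \<phi>" and K: "compact K" "\<And>x. x \<notin> K \<Longrightarrow> \<phi> x = 0"
  shows "integrable lborel \<phi>"
proof -
  have "set_integrable lborel K \<phi>"
    unfolding set_integrable_def
    by (rule borel_integrable_compact[OF K(1) continuous_on_subset[OF \<phi>]]) simp
  moreover have "indicator K x *\<^sub>R \<phi> x = \<phi> x" for x using K(2) by (auto simp: indicator_def)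
  ultimately show ?thesis unfolding set_integrable_def by (simp only:)
qed

lemma integral_lborel_translation:
  fixes \<phi> :: "'a::euclidean_space \<Rightarrow> real"
  assumes "\<phi> \<in> borel_measurable borel"
  shows "(\<integral>x. \<phi> (c + x) \<partial>lborel) = integral\<^sup>L lborel \<phi>"
  using integral_distr[of "(+) c" lborel borel \<phi>] assms by (simp add: lborel_distr_plus)

text \<open>By translation invariance the integral of \<phi> (t b + x) over x does not depend on t;
  its derivative at t = 0, taken under the integral, is the integral of the partial
  derivative.\<close>

lemma integral_partial_eq_0:
  fixes \<phi> :: "'a::euclidean_space \<Rightarrow> real"
  assumes \<phi>: "smooth \<phi>" and K: "compact K" "\<And>x. x \<notin> K \<Longrightarrow> \<phi> x = 0" and b: "b \<in> Basis"
  shows "integral\<^sup>L lborel (partial \<phi> b) = 0"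
proof -
  note cont = smooth_continuous[OF \<phi>] and contp = smooth_continuous[OF smooth_partial[OF \<phi> b]]
  have meas[measurable]: "\<phi> \<in> borel_measurable borel" "partial \<phi> b \<in> borel_measurable borel"
    using cont contp by (auto intro: borel_measurable_continuous_onI)
  have p0: "partial \<phi> b x = 0" if "x \<notin> K" for x
    using frechet_derivative_eq_0_outside[of K \<phi> x b] K(1) K(2) that by auto
  obtain B where B: "B > 0" "\<And>x. norm (partial \<phi> b x) \<le> B"
    using continuous_compact_support_bounded[OF contp K(1) p0] by blast
  obtain \<rho> where \<rho>: "\<And>x. x \<in> K \<Longrightarrow> norm x \<le> \<rho>"
    using compact_imp_bounded[OF K(1)] unfolding bounded_iff by blast
  have "((\<lambda>t. \<integral>x. \<phi> (t *\<^sub>R b + x) \<partial>lborel) has_real_derivative (\<integral>x. partial \<phi> b (0 *\<^sub>R b + x) \<partial>lborel)) (at 0)"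
  proof (rule has_real_derivative_integral[where g="\<lambda>x. indicator (cball 0 (\<rho> + 1)) x * B"])
    show "integrable lborel (\<lambda>x. \<phi> (t *\<^sub>R b + x))" for t
    proof (rule integrable_continuous_compact_support)
      show "continuous_on UNIV (\<lambda>x. \<phi> (t *\<^sub>R b + x))"
        by (intro continuous_on_compose2[OF cont] continuous_intros) auto
      show "compact ((+) (- (t *\<^sub>R b)) ` K)" using K(1) by (rule compact_translation)
      show "\<phi> (t *\<^sub>R b + x) = 0" if "x \<notin> (+) (- (t *\<^sub>R b)) ` K" for x
        using that K(2)[of "t *\<^sub>R b + x"] by force
    qed
    show "((\<lambda>t. \<phi> (t *\<^sub>R b + x)) has_real_derivative partial \<phi> b (t *\<^sub>R b + x)) (at t)" for t x
    proof -
      have "((\<lambda>t. t *\<^sub>R b + x) has_derivative (\<lambda>h. h *\<^sub>R b)) (at t)"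
        by (auto intro!: derivative_eq_intros)
      from has_derivative_compose[OF this smooth_has_derivative[OF \<phi>]]
      have "((\<lambda>t. \<phi> (t *\<^sub>R b + x)) has_derivative (\<lambda>h. frechet_derivative \<phi> (at (t *\<^sub>R b + x)) (h *\<^sub>R b))) (at t)" .
      moreover have "frechet_derivative \<phi> (at (t *\<^sub>R b + x)) (h *\<^sub>R b) = partial \<phi> b (t *\<^sub>R b + x) * h" for h
        using smooth_has_derivative[OF \<phi>, THEN has_derivative_linear] by (simp add: linear_cmul)
      ultimately show ?thesis by (simp add: has_field_derivative_def)
    qed
    \<comment> \<open>For |t| < 1 the unit vector b moves points by less than 1, so all translated
      supports lie in the ball of radius \<rho> + 1.\<close>
    show "AE x in lborel. \<forall>t. \<bar>t - 0\<bar> < 1 \<longrightarrow> \<bar>partial \<phi> b (t *\<^sub>R b + x)\<bar> \<le> indicator (cball 0 (\<rho> + 1)) x * B"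
    proof (intro AE_I2 allI impI)
      fix x :: 'a and t :: real assume t: "\<bar>t - 0\<bar> < 1"
      show "\<bar>partial \<phi> b (t *\<^sub>R b + x)\<bar> \<le> indicator (cball 0 (\<rho> + 1)) x * B"
      proof (cases "t *\<^sub>R b + x \<in> K")
        case True
        have "norm x \<le> norm (t *\<^sub>R b + x) + norm (t *\<^sub>R b)"
          by (metis add.commute add_diff_cancel_right' norm_triangle_ineq4)
        then have "norm x \<le> \<rho> + 1" using \<rho>[OF True] t b by simp
        then show ?thesis using B(2)[of "t *\<^sub>R b + x"] by (simp add: indicator_def)
      qed (use p0 B(1) in \<open>simp add: indicator_def\<close>)
    qed
    show "integrable lborel (\<lambda>x::'a. indicator (cball 0 (\<rho> + 1)) x * B)"
      using emeasure_lborel_cball_finite[of "0::'a" "\<rho> + 1"]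
      by (intro integrable_mult_left integrable_real_indicator) auto
    show "(\<lambda>x. partial \<phi> b (0 *\<^sub>R b + x)) \<in> borel_measurable lborel" by simp
  qed
  moreover have "((\<lambda>t. \<integral>x. \<phi> (t *\<^sub>R b + x) \<partial>lborel) has_real_derivative 0) (at 0)"
    by (simp add: integral_lborel_translation)
  ultimately show ?thesis using DERIV_unique by fastforce
qed

lemma partial_one_eq_deriv:
  fixes \<phi> :: "real \<Rightarrow> real"
  assumes "smooth \<phi>" shows "partial \<phi> 1 = deriv \<phi>"
  using smooth_has_derivative[OF assms]
  by (subst fun_eq_iff, subst frechet_derivative_real) (auto simp: differentiable_def)

lemma integral_deriv_eq_0:
  fixes \<phi> :: "real \<Rightarrow> real"
  assumes "smooth \<phi>" and "compact K" and "\<And>x. x \<notin> K \<Longrightarrow> \<phi> x = 0"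
  shows "integral\<^sup>L lborel (deriv \<phi>) = 0"
  using integral_partial_eq_0[OF assms, of 1] by (simp add: partial_one_eq_deriv[OF assms(1)])

section \<open>Spherical integrals\<close>

lemma sphere_integrable_bounded:
  fixes f :: "'a::euclidean_space \<Rightarrow> real"
  assumes "f \<in> borel_measurable borel" and "AE w in sphere_measure. \<bar>f w\<bar> \<le> B"
  shows "integrable sphere_measure f"
  using sphere.integrable_const_bound[of f B] assms by simp

lemma borel_measurable_scaled:
  fixes \<phi> :: "'a::euclidean_space \<Rightarrow> real"
  assumes "\<phi> \<in> borel_measurable borel" shows "(\<lambda>w. \<phi> (r *\<^sub>R w)) \<in> borel_measurable borel"
  using assms by measurable

lemma smooth_borel_measurable: "smooth \<phi> \<Longrightarrow> \<phi> \<in> borel_measurable borel"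
  by (intro borel_measurable_continuous_onI smooth_continuous)

lemma grad_borel_measurable: "smooth \<phi> \<Longrightarrow> grad \<phi> \<in> borel_measurable borel"
  by (intro borel_measurable_continuous_onI smooth_grad_continuous)

text \<open>The weight g is 1 for spherical means and w \<bullet> b in the divergence theorem;
  further products of coordinates of w arise when the formula is iterated.\<close>

lemma sphere_integral_DERIV:
  fixes \<phi> g :: "'a::euclidean_space \<Rightarrow> real"
  assumes \<phi>: "smooth \<phi>" and K: "compact K" "\<And>x. x \<notin> K \<Longrightarrow> \<phi> x = 0"
    and g: "g \<in> borel_measurable borel" "AE w in sphere_measure. \<bar>g w\<bar> \<le> C"
  shows "((\<lambda>r. \<integral>w. g w * \<phi> (r *\<^sub>R w) \<partial>sphere_measure) has_real_derivative
      (\<integral>w. g w * (grad \<phi> (r *\<^sub>R w) \<bullet> w) \<partial>sphere_measure)) (at r)"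
proof -
  note [measurable] = smooth_borel_measurable[OF \<phi>] grad_borel_measurable[OF \<phi>] g(1)
  obtain B where B: "B > 0" "\<And>x. norm (\<phi> x) \<le> B"
    using continuous_compact_support_bounded[OF smooth_continuous[OF \<phi>] K] by blast
  have g0: "grad \<phi> x = 0" if "x \<notin> K" for x
    using grad_eq_0_outside[of K \<phi> x] K(1) K(2) that by auto
  obtain B' where B': "B' > 0" "\<And>x. norm (grad \<phi> x) \<le> B'"
    using continuous_compact_support_bounded[OF smooth_grad_continuous[OF \<phi>] K(1) g0] by blast
  show ?thesis
  proof (rule has_real_derivative_integral[where g="\<lambda>w. C * B'"])
    show "integrable sphere_measure (\<lambda>w. g w * \<phi> (t *\<^sub>R w))" for t
    proof (rule sphere_integrable_bounded)
      show "AE w in sphere_measure. \<bar>g w * \<phi> (t *\<^sub>R w)\<bar> \<le> C * B"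
        using g(2) by eventually_elim (use B(2) in \<open>auto simp: abs_mult intro!: mult_mono'\<close>)
    qed measurable
    show "((\<lambda>t. g w * \<phi> (t *\<^sub>R w)) has_real_derivative g w * (grad \<phi> (t *\<^sub>R w) \<bullet> w)) (at t)" for t w
    proof -
      have "((\<lambda>t. t *\<^sub>R w) has_derivative (\<lambda>h. h *\<^sub>R w)) (at t)"
        by (auto intro!: derivative_eq_intros)
      from has_derivative_compose[OF this smooth_grad_derivative[OF \<phi>]]
      have "((\<lambda>t. \<phi> (t *\<^sub>R w)) has_real_derivative grad \<phi> (t *\<^sub>R w) \<bullet> w) (at t)"
        by (simp add: has_field_derivative_def mult.commute[of _ "grad \<phi> (t *\<^sub>R w) \<bullet> w"])
      then show ?thesis by (rule DERIV_cmult)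
    qed
    show "AE w in sphere_measure. \<forall>t. \<bar>t - r\<bar> < 1 \<longrightarrow> \<bar>g w * (grad \<phi> (t *\<^sub>R w) \<bullet> w)\<bar> \<le> C * B'"
      using g(2) AE_sphere_norm
    proof eventually_elim
      case (elim w)
      have "\<bar>grad \<phi> (t *\<^sub>R w) \<bullet> w\<bar> \<le> B'" for t
        using Cauchy_Schwarz_ineq2[of "grad \<phi> (t *\<^sub>R w)" w] elim(2) B'(2)[of "t *\<^sub>R w"] by simp
      then show ?case using elim(1) by (auto simp: abs_mult intro!: mult_mono')
    qed
  qed measurable
qed

text \<open>The derivative is a sum over b of integrals of the same kind, with
  \<open>partial \<phi> b\<close> for \<phi> and with weight g w (w \<bullet> b); the induction
  therefore varies \<phi> and g. Since r ranges over the whole line, smoothness holds across r = 0,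
  as test functions on (-R, R) demand.\<close>

lemma smooth_sphere_integral:
  fixes \<phi> g :: "'a::euclidean_space \<Rightarrow> real"
  assumes \<phi>: "smooth \<phi>" and K: "compact K" "\<And>x. x \<notin> K \<Longrightarrow> \<phi> x = 0"
    and g: "g \<in> borel_measurable borel" "AE w in sphere_measure. \<bar>g w\<bar> \<le> C"
  shows "smooth (\<lambda>r. \<integral>w. g w * \<phi> (r *\<^sub>R w) \<partial>sphere_measure)"
proof -
  have "Ck k (\<lambda>r. \<integral>w. g w * \<phi> (r *\<^sub>R w) \<partial>sphere_measure)" for k
    using \<phi> K(2) g
  proof (induction k arbitrary: \<phi> g)
    case 0
    from DERIV_isCont[OF sphere_integral_DERIV[OF 0(1) K(1) 0(2,3,4)]] show ?case
      by (auto intro!: continuous_at_imp_continuous_on)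
  next
    case (Suc k)
    show ?case
    proof (rule Ck_Suc_realI[OF sphere_integral_DERIV[OF Suc.prems(1) K(1) Suc.prems(2-4)]])
      have m: "partial \<phi> b \<in> borel_measurable borel" if "b \<in> Basis" for b
        using smooth_borel_measurable[OF smooth_partial[OF Suc.prems(1) that]] .
      have p0: "partial \<phi> b x = 0" if "x \<notin> K" for b x
        using frechet_derivative_eq_0_outside[of K \<phi> x b] K(1) Suc.prems(2) that by auto
      have bd: "AE w in sphere_measure. \<bar>g w * (w \<bullet> b)\<bar> \<le> C" if "b \<in> Basis" for b
        using Suc.prems(4) AE_sphere_norm
      proof eventually_elim
        case (elim w)
        have "\<bar>w \<bullet> b\<bar> \<le> 1" using Basis_le_norm[OF that, of w] elim(2) by simp
        then have "\<bar>g w\<bar> * \<bar>w \<bullet> b\<bar> \<le> C * 1" using elim(1) by (intro mult_mono') auto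
        then show ?case by (simp add: abs_mult)
      qed
      have gm: "(\<lambda>w. g w * (w \<bullet> b)) \<in> borel_measurable borel" for b
        using Suc.prems(3) by measurable
      have int: "integrable sphere_measure (\<lambda>w. g w * (w \<bullet> b) * partial \<phi> b (r *\<^sub>R w))" if b: "b \<in> Basis" for b r
      proof -
        obtain B where B: "B > 0" "\<And>x. norm (partial \<phi> b x) \<le> B"
          using continuous_compact_support_bounded[OF smooth_continuous[OF smooth_partial[OF Suc.prems(1) b]] K(1) p0]
          by blast
        show ?thesis
        proof (rule sphere_integrable_bounded)
          show "(\<lambda>w. g w * (w \<bullet> b) * partial \<phi> b (r *\<^sub>R w)) \<in> borel_measurable borel"
            by (intro borel_measurable_times gm borel_measurable_scaled m b)
          show "AE w in sphere_measure. \<bar>g w * (w \<bullet> b) * partial \<phi> b (r *\<^sub>R w)\<bar> \<le> C * B"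
            using bd[OF b]
          proof eventually_elim
            case (elim w)
            then show ?case
              using B(2)[of "r *\<^sub>R w"] unfolding abs_mult[of "g w * (w \<bullet> b)"] by (intro mult_mono') auto
          qed
        qed
      qed
      have "(\<integral>w. g w * (grad \<phi> (r *\<^sub>R w) \<bullet> w) \<partial>sphere_measure) =
          (\<Sum>b\<in>Basis. \<integral>w. g w * (w \<bullet> b) * partial \<phi> b (r *\<^sub>R w) \<partial>sphere_measure)" for r
      proof -
        have "g w * (grad \<phi> (r *\<^sub>R w) \<bullet> w) = (\<Sum>b\<in>Basis. g w * (w \<bullet> b) * partial \<phi> b (r *\<^sub>R w))" for w
          by (simp add: grad_def inner_sum_left inner_sum_right sum_distrib_left inner_commute mult_ac)
        then show ?thesis using int by (simp add: Bochner_Integration.integral_sum)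
      qed
      moreover have "Ck k (\<lambda>r. \<Sum>b\<in>Basis. \<integral>w. g w * (w \<bullet> b) * partial \<phi> b (r *\<^sub>R w) \<partial>sphere_measure)"
        by (intro Ck_sum Suc.IH smooth_partial Suc.prems(1) gm bd p0)
      ultimately show "Ck k (\<lambda>r. \<integral>w. g w * (grad \<phi> (r *\<^sub>R w) \<bullet> w) \<partial>sphere_measure)" by simp
    qed
  qed
  then show ?thesis by (simp add: smooth_def)
qed

lemma sphere_integral_eq_0_outside:
  fixes \<phi> g :: "'a::euclidean_space \<Rightarrow> real"
  assumes "\<And>x. norm x > \<rho> \<Longrightarrow> \<phi> x = 0" and "\<bar>r\<bar> > \<rho>"
  shows "(\<integral>w. g w * \<phi> (r *\<^sub>R w) \<partial>sphere_measure) = 0"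
proof -
  have "AE w in sphere_measure. g w * \<phi> (r *\<^sub>R w) = 0"
    using AE_sphere_norm by eventually_elim (use assms in auto)
  then show ?thesis by (rule integral_eq_zero_AE)
qed

text \<open>Lebesgue measure on the ball is invariant under x to -x, while \<open>sgn\<close> is
  odd.\<close>

lemma sphere_integral_inner_eq_0:
  fixes b :: "'a::euclidean_space"
  shows "(\<integral>w. w \<bullet> b \<partial>sphere_measure) = 0"
proof -
  let ?F = "\<lambda>x::'a. indicator (cball 0 1) x * (sgn x \<bullet> b)"
  have F: "?F \<in> borel_measurable borel" by (intro borel_measurable_times borel_measurable_indicator borel_measurable_inner) auto
  have "(\<integral>w. w \<bullet> b \<partial>sphere_measure) = (\<integral>x. sgn x \<bullet> b \<partial>density lborel (indicator (cball 0 1)))"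
    unfolding sphere_measure_def by (subst integral_distr) auto
  also have "\<dots> = integral\<^sup>L lborel ?F"
  proof -
    have "density lborel (indicator (cball 0 1)) = density lborel (\<lambda>x::'a. ennreal (indicator (cball 0 1) x))"
      by (simp add: ennreal_indicator)
    then show ?thesis
      by (simp add: integral_density borel_measurable_indicator)
  qed
  finally have *: "(\<integral>w. w \<bullet> b \<partial>sphere_measure) = integral\<^sup>L lborel ?F" .
  have "distr lborel borel (\<lambda>x::'a. - x) = lborel"
    using lborel_affine[of "-1" "0::'a"] by (simp add: density_1)
  then have "integral\<^sup>L lborel ?F = (\<integral>x. ?F (- x) \<partial>lborel)"
    using integral_distr[of "\<lambda>x::'a. - x" lborel borel ?F] F by simp
  also have "\<dots> = - integral\<^sup>L lborel ?F"
    by (subst integral_minus[symmetric]) (simp add: sgn_minus indicator_def)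
  finally show ?thesis using * by simp
qed

text \<open>For r > 0 almost every w on the sphere satisfies norm (r w) = r, so W leaves the inner
  integral. Integrability of W is required only up to \<rho>, beyond which D vanishes.\<close>

lemma integral_radial_product:
  fixes D :: "'a::euclidean_space \<Rightarrow> real"
  assumes [measurable]: "W \<in> borel_measurable borel" "D \<in> borel_measurable borel"
    and B: "\<And>x. norm (D x) \<le> B" and D0: "\<And>x. norm x > \<rho> \<Longrightarrow> D x = 0"
    and W: "integrable (radial_measure DIM('a)) (\<lambda>r. indicator {..\<rho>} r * W r)"
  shows "integrable lborel (\<lambda>x. W (norm x) * D x)"
    and "(\<integral>x. W (norm x) * D x \<partial>lborel) =
      (\<integral>r. radial_density DIM('a) r * (W r * (\<integral>w. D (r *\<^sub>R w) \<partial>sphere_measure)) \<partial>lborel)"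
proof -
  have [measurable]: "{..\<rho>} \<in> sets borel" by simp
  show int: "integrable lborel (\<lambda>x. W (norm x) * D x)"
  proof (rule Bochner_Integration.integrable_bound)
    have "integrable lborel (\<lambda>x::'a. (\<lambda>r. indicator {..\<rho>} r * W r) (norm x))"
      using W by (subst integral_norm_compose(1)) measurable
    then show "integrable lborel (\<lambda>x::'a. B * (indicator {..\<rho>} (norm x) * W (norm x)))"
      by (intro integrable_mult_right) simp
    show "AE x in lborel. norm (W (norm x) * D x) \<le> norm (B * (indicator {..\<rho>} (norm x) * W (norm x)))"
    proof (rule AE_I2)
      fix x :: 'a
      show "norm (W (norm x) * D x) \<le> norm (B * (indicator {..\<rho>} (norm x) * W (norm x)))"
        using B[of x] D0[of x]
        by (cases "norm x > \<rho>")
          (auto simp: abs_mult indicator_def mult.commute[of B] mult.commute[of "\<bar>B\<bar>"] intro!: mult_left_mono)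
    qed
  qed measurable
  have "(\<integral>x. W (norm x) * D x \<partial>lborel) =
      (\<integral>r. (\<integral>w. W (norm (r *\<^sub>R w)) * D (r *\<^sub>R w) \<partial>sphere_measure) \<partial>radial_measure DIM('a))"
    by (rule integral_polar(2)[OF int])
  also have "\<dots> = (\<integral>r. W r * (\<integral>w. D (r *\<^sub>R w) \<partial>sphere_measure) \<partial>radial_measure DIM('a))"
  proof (rule integral_cong_AE)
    show "AE r in radial_measure DIM('a).
        (\<integral>w. W (norm (r *\<^sub>R w)) * D (r *\<^sub>R w) \<partial>sphere_measure) = W r * (\<integral>w. D (r *\<^sub>R w) \<partial>sphere_measure)"
    proof (subst AE_radial_measure; (intro AE_I2 impI)?)
      fix r :: real assume r: "0 < r"
      have "(\<integral>w. W (norm (r *\<^sub>R w)) * D (r *\<^sub>R w) \<partial>sphere_measure) =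
          (\<integral>w. W r * D (r *\<^sub>R w) \<partial>sphere_measure)"
      proof (rule integral_cong_AE)
        show "AE w in sphere_measure. W (norm (r *\<^sub>R w)) * D (r *\<^sub>R w) = W r * D (r *\<^sub>R w)"
          using AE_sphere_norm by eventually_elim (use r in simp)
      qed measurable
      then show "(\<integral>w. W (norm (r *\<^sub>R w)) * D (r *\<^sub>R w) \<partial>sphere_measure) = W r * (\<integral>w. D (r *\<^sub>R w) \<partial>sphere_measure)"
        by simp
    qed (simp add: Suc_le_eq)
  qed measurable
  also have "\<dots> = (\<integral>r. radial_density DIM('a) r * (W r * (\<integral>w. D (r *\<^sub>R w) \<partial>sphere_measure)) \<partial>lborel)"
    by (rule integral_radial_measure(1)) measurable
  finally show "(\<integral>x. W (norm x) * D x \<partial>lborel) =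
      (\<integral>r. radial_density DIM('a) r * (W r * (\<integral>w. D (r *\<^sub>R w) \<partial>sphere_measure)) \<partial>lborel)" .
qed

lemma integrable_radial_measure_bounded:
  fixes W :: "real \<Rightarrow> real"
  assumes n: "n \<ge> 1" and [measurable]: "W \<in> borel_measurable borel" and B: "\<And>r. r \<le> \<rho> \<Longrightarrow> 0 < r \<Longrightarrow> \<bar>W r\<bar> \<le> B"
  shows "integrable (radial_measure n) (\<lambda>r. indicator {..\<rho>} r * W r)"
proof (rule Bochner_Integration.integrable_bound)
  have [measurable]: "{..\<rho>} \<in> sets borel" by simp
  show "integrable (radial_measure n) (\<lambda>r. B * indicator {..\<rho>} r)"
    using emeasure_radial_measure_atMost[OF n, of \<rho>] by (intro integrable_mult_right integrable_real_indicator) auto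
  show "(\<lambda>r. indicator {..\<rho>} r * W r) \<in> borel_measurable (radial_measure n)" by measurable
  show "AE r in radial_measure n. norm (indicator {..\<rho>} r * W r) \<le> norm (B * indicator {..\<rho>} r)"
    unfolding AE_radial_measure[OF n]
  proof (intro AE_I2 impI)
    fix r :: real assume "0 < r"
    then show "norm (indicator {..\<rho>} r * W r) \<le> norm (B * indicator {..\<rho>} r)"
      using B[of r] by (cases "r \<le> \<rho>") auto
  qed
qed

lemma test_functions_vanish_below:
  fixes \<eta> :: "real \<Rightarrow> real"
  assumes "\<eta> \<in> test_functions {0<..}"
  obtains a where "a > 0" and "\<And>s. s < a \<Longrightarrow> \<eta> s = 0"
proof -
  obtain K where K: "compact K" "K \<subseteq> {0<..}" "\<And>x. x \<notin> K \<Longrightarrow> \<eta> x = 0"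
    using test_functionsE[OF assms] by metis
  show ?thesis
  proof (cases "K = {}")
    case True
    then show ?thesis using that[of 1] K(3) by simp
  next
    case False
    obtain a where a: "a \<in> K" "\<And>y. y \<in> K \<Longrightarrow> a \<le> y" using compact_attains_inf[OF K(1) False] by blast
    show ?thesis
    proof (rule that[of a])
      show "a > 0" using a(1) K(2) by auto
      show "\<eta> s = 0" if "s < a" for s using that a(2)[of s] K(3)[of s] by (cases "s \<in> K") auto
    qed
  qed
qed

lemma set_integral_lebesgue_eq_lborel:
  fixes f :: "'a::euclidean_space \<Rightarrow> real"
  assumes "f \<in> borel_measurable borel" and "U \<in> sets borel"
  shows "(LINT x:U|lebesgue. f x) = (\<integral>x. indicator U x * f x \<partial>lborel)"
    and "set_integrable lebesgue U f \<longleftrightarrow> integrable lborel (\<lambda>x. indicator U x * f x)"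
  unfolding set_lebesgue_integral_def set_integrable_def
  using assms by (auto simp: integral_completion integrable_completion)

lemma locally_integrable_continuous:
  fixes f :: "'a::euclidean_space \<Rightarrow> real"
  assumes "continuous_on UNIV f" shows "locally_integrable U f"
  unfolding locally_integrable_def
proof (intro allI impI)
  fix K :: "'a set" assume K: "compact K \<and> K \<subseteq> U"
  have "integrable lborel (\<lambda>x. indicator K x *\<^sub>R f x)"
    by (rule borel_integrable_compact) (use K continuous_on_subset[OF assms] in auto)
  then show "set_integrable lebesgue K f"
    using assms K by (subst set_integral_lebesgue_eq_lborel(2))
      (auto intro: borel_measurable_continuous_onI compact_imp_closed borel_closed)
qed

text \<open>The divergence theorem on spheres, obtained by testing the identity
  \<open>\<integral> div = 0\<close> with functions \<open>\<eta> |x| \<phi> x\<close>.\<close>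

lemma sphere_divergence:
  fixes \<phi> :: "'a::euclidean_space \<Rightarrow> real" and b :: 'a
  assumes \<phi>: "smooth \<phi>" and K: "compact K" "\<And>x. x \<notin> K \<Longrightarrow> \<phi> x = 0" and b: "b \<in> Basis"
  defines "n \<equiv> DIM('a)"
  defines "\<Psi> \<equiv> \<lambda>r. \<integral>w. (w \<bullet> b) * \<phi> (r *\<^sub>R w) \<partial>sphere_measure"
    and "A \<equiv> \<lambda>r. \<integral>w. partial \<phi> b (r *\<^sub>R w) \<partial>sphere_measure"
  shows "AE r in lborel. 0 < r \<longrightarrow> deriv (\<lambda>r. r ^ (n - 1) * \<Psi> r) r = r ^ (n - 1) * A r"
proof -
  have n: "n \<ge> 1" by (simp add: n_def Suc_le_eq)
  note wb = AE_sphere_inner_le[OF b]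
  have s\<Psi>: "smooth \<Psi>"
    unfolding \<Psi>_def by (rule smooth_sphere_integral[OF \<phi> K _ wb]) auto
  have pb: "smooth (partial \<phi> b)" by (rule smooth_partial[OF \<phi> b])
  have p0: "partial \<phi> b x = 0" if "x \<notin> K" for x
    using frechet_derivative_eq_0_outside[of K \<phi> x b] K(1) K(2) that by auto
  have sA: "smooth A"
    using smooth_sphere_integral[OF pb K(1) p0, of "\<lambda>w. 1" 1] unfolding A_def by simp
  define T where "T = (\<lambda>r. r ^ (n - 1) * \<Psi> r)"
  have sT: "smooth T" unfolding T_def by (intro smooth_mult smooth_power smooth_ident s\<Psi>)
  have srA: "smooth (\<lambda>r. r ^ (n - 1) * A r)" by (intro smooth_mult smooth_power smooth_ident sA)
  \<comment> \<open>The defect in the claimed identity, to be annihilated by the fundamental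
    lemma.\<close>
  define G where "G = (\<lambda>r. r ^ (n - 1) * A r - deriv T r)"
  have cG: "continuous_on UNIV G"
    unfolding G_def by (intro continuous_intros smooth_continuous smooth_deriv sT sA)
  have "AE r in lebesgue. r \<in> {0<..} \<longrightarrow> G r = 0"
  proof (rule fundamental_lemma_test_functions)
    show "locally_integrable {0<..} G" using cG by (rule locally_integrable_continuous)
    fix \<eta> :: "real \<Rightarrow> real" assume \<eta>: "\<eta> \<in> test_functions {0<..}"
    obtain L where L: "smooth \<eta>" "compact L" "L \<subseteq> {0<..}" "\<And>x. x \<notin> L \<Longrightarrow> \<eta> x = 0"
      using test_functionsE[OF \<eta>] by metis
    obtain a where a: "a > 0" "\<And>s. s < a \<Longrightarrow> \<eta> s = 0"
      using test_functions_vanish_below[OF \<eta>] by metis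
    have d0: "deriv \<eta> s = 0" if "s < a" for s using deriv_eq_0_below[of a \<eta> s] a(2) that by simp
    have dL: "deriv \<eta> s = 0" if "s \<notin> L" for s
      using deriv_eq_0_outside[of L \<eta> s] compact_imp_closed[OF L(2)] L(4) that by auto
    define h where "h = (\<lambda>x::'a. \<eta> (norm x) * \<phi> x)"
    \<comment> \<open>The product rule for \<eta> |x| \<phi> x. On the sphere of radius r its
      integral is \<eta> A + \<eta>' \<Psi>, because sgn (r w) = w there.\<close>
    define F where "F = (\<lambda>x::'a. \<eta> (norm x) * partial \<phi> b x + (deriv \<eta> (norm x) * (sgn x \<bullet> b)) * \<phi> x)"
    have sh: "smooth h"
      unfolding h_def using smooth_compose_norm[OF L(1) a(2,1)] \<phi> by (rule smooth_mult)
    have hF: "partial h b = F"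
    proof
      fix x
      have "(h has_derivative (\<lambda>y. \<eta> (norm x) * (grad \<phi> x \<bullet> y) + ((deriv \<eta> (norm x) *\<^sub>R sgn x) \<bullet> y) * \<phi> x)) (at x)"
        unfolding h_def
        by (rule has_derivative_mult[OF norm_compose_has_derivative[OF smooth_DERIV[OF L(1)] a(2,1)]
              smooth_grad_derivative[OF \<phi>]])
      from frechet_derivative_at[OF this, symmetric] show "partial h b x = F x"
        by (simp add: F_def grad_inner_Basis[OF b])
    qed
    have "integral\<^sup>L lborel F = 0"
      unfolding hF[symmetric] by (rule integral_partial_eq_0[OF sh K(1) _ b]) (simp add: h_def K(2))
    moreover have Fc: "continuous_on UNIV F"
      unfolding hF[symmetric] by (rule smooth_continuous[OF smooth_partial[OF sh b]])
    moreover have Fi: "integrable lborel F"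
      by (rule integrable_continuous_compact_support[OF Fc K(1)]) (simp add: F_def K(2) p0)
    ultimately have "(\<integral>r. (\<integral>w. F (r *\<^sub>R w) \<partial>sphere_measure) \<partial>radial_measure n) = 0"
      using integral_polar(2)[OF Fi] by (simp add: n_def)
    moreover have "(\<integral>r. (\<integral>w. F (r *\<^sub>R w) \<partial>sphere_measure) \<partial>radial_measure n) =
        (\<integral>r. \<eta> r * A r + deriv \<eta> r * \<Psi> r \<partial>radial_measure n)"
    proof (rule integral_cong_AE)
      show "(\<lambda>r. \<integral>w. F (r *\<^sub>R w) \<partial>sphere_measure) \<in> borel_measurable (radial_measure n)"
        using integral_polar(1)[OF Fi] by (simp add: n_def)
      show "(\<lambda>r. \<eta> r * A r + deriv \<eta> r * \<Psi> r) \<in> borel_measurable (radial_measure n)"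
        using smooth_borel_measurable[OF L(1)] smooth_borel_measurable[OF sA] smooth_borel_measurable[OF s\<Psi>]
          smooth_borel_measurable[OF smooth_deriv[OF L(1)]] by measurable
      show "AE r in radial_measure n. (\<integral>w. F (r *\<^sub>R w) \<partial>sphere_measure) = \<eta> r * A r + deriv \<eta> r * \<Psi> r"
        unfolding AE_radial_measure[OF n]
      proof (intro AE_I2 impI)
        fix r :: real assume r: "0 < r"
        note [measurable] = smooth_borel_measurable[OF \<phi>] smooth_borel_measurable[OF pb]
          borel_measurable_continuous_onI[OF Fc]
        have i1: "integrable sphere_measure (\<lambda>w. partial \<phi> b (r *\<^sub>R w))"
        proof -
          obtain B where B: "\<And>x. norm (partial \<phi> b x) \<le> B"
            using continuous_compact_support_bounded[OF smooth_continuous[OF pb] K(1) p0] by blast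
          then show ?thesis by (intro sphere_integrable_bounded[where B=B]) auto
        qed
        have i2: "integrable sphere_measure (\<lambda>w. (w \<bullet> b) * \<phi> (r *\<^sub>R w))"
        proof -
          obtain B where B: "\<And>x. norm (\<phi> x) \<le> B"
            using continuous_compact_support_bounded[OF smooth_continuous[OF \<phi>] K] by blast
          have "AE w in sphere_measure. \<bar>(w \<bullet> b) * \<phi> (r *\<^sub>R w)\<bar> \<le> 1 * B"
            using wb
          proof eventually_elim
            case (elim w)
            then show ?case using B[of "r *\<^sub>R w"] unfolding abs_mult by (intro mult_mono') auto
          qed
          then show ?thesis by (intro sphere_integrable_bounded[where B="1 * B"]) measurable
        qed
        have "(\<integral>w. F (r *\<^sub>R w) \<partial>sphere_measure) =
            (\<integral>w. \<eta> r * partial \<phi> b (r *\<^sub>R w) + deriv \<eta> r * ((w \<bullet> b) * \<phi> (r *\<^sub>R w)) \<partial>sphere_measure)"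
        proof (rule integral_cong_AE)
          show "AE w in sphere_measure. F (r *\<^sub>R w) =
              \<eta> r * partial \<phi> b (r *\<^sub>R w) + deriv \<eta> r * ((w \<bullet> b) * \<phi> (r *\<^sub>R w))"
            using AE_sphere_norm
          proof eventually_elim
            case (elim w)
            then have "sgn (r *\<^sub>R w) = w" using r by (simp add: sgn_scaleR sgn_div_norm)
            then show ?case using elim r by (simp add: F_def)
          qed
        qed measurable
        also have "\<dots> = \<eta> r * A r + deriv \<eta> r * \<Psi> r"
          unfolding A_def \<Psi>_def using i1 i2 by simp
        finally show "(\<integral>w. F (r *\<^sub>R w) \<partial>sphere_measure) = \<eta> r * A r + deriv \<eta> r * \<Psi> r" .
      qed
    qed
    moreover have "(\<integral>r. \<eta> r * A r + deriv \<eta> r * \<Psi> r \<partial>radial_measure n) =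
        (\<integral>r. n * (\<eta> r * (r ^ (n - 1) * A r) + deriv \<eta> r * T r) \<partial>lborel)"
    proof (subst integral_radial_measure(1))
      show "(\<lambda>r. \<eta> r * A r + deriv \<eta> r * \<Psi> r) \<in> borel_measurable borel"
        using smooth_borel_measurable[OF L(1)] smooth_borel_measurable[OF sA] smooth_borel_measurable[OF s\<Psi>]
          smooth_borel_measurable[OF smooth_deriv[OF L(1)]] by measurable
      \<comment> \<open>No indicator of (0, \<infinity>) is left over: \<eta> and its derivative
        vanish below a > 0.\<close>
      show "(\<integral>r. radial_density n r * (\<eta> r * A r + deriv \<eta> r * \<Psi> r) \<partial>lborel) =
          (\<integral>r. n * (\<eta> r * (r ^ (n - 1) * A r) + deriv \<eta> r * T r) \<partial>lborel)"
        using a d0 by (intro Bochner_Integration.integral_cong refl)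
          (auto simp: radial_density_def T_def algebra_simps)
    qed
    ultimately have e1: "(\<integral>r. \<eta> r * (r ^ (n - 1) * A r) + deriv \<eta> r * T r \<partial>lborel) = 0"
      using n by simp
    have sc: "smooth (\<lambda>r. \<eta> r * T r)" using L(1) sT by (rule smooth_mult)
    have "deriv (\<lambda>r. \<eta> r * T r) = (\<lambda>r. deriv \<eta> r * T r + \<eta> r * deriv T r)"
      by (rule ext, rule DERIV_imp_deriv) (auto intro!: derivative_eq_intros smooth_DERIV L sT)
    \<comment> \<open>While e1 identifies r^(n-1) A as the weak derivative of T, this is integration
      by parts with the classical one; their difference is the integral of G \<eta>.\<close>
    then have e2: "(\<integral>r. deriv \<eta> r * T r + \<eta> r * deriv T r \<partial>lborel) = 0"
      using integral_deriv_eq_0[OF sc L(2)] L(4) by simp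
    have i1: "integrable lborel (\<lambda>r. \<eta> r * (r ^ (n - 1) * A r) + deriv \<eta> r * T r)"
      by (rule integrable_continuous_compact_support[OF smooth_continuous L(2)])
        (auto simp: L(4) dL intro!: smooth_add smooth_mult smooth_power smooth_ident L(1) smooth_deriv sA sT)
    have i2: "integrable lborel (\<lambda>r. deriv \<eta> r * T r + \<eta> r * deriv T r)"
      by (rule integrable_continuous_compact_support[OF smooth_continuous L(2)])
        (auto simp: L(4) dL intro!: smooth_add smooth_mult smooth_power smooth_ident L(1) smooth_deriv sA sT)
    have "(LINT r:{0<..}|lebesgue. G r * \<eta> r) = (\<integral>r. indicator {0<..} r * (G r * \<eta> r) \<partial>lborel)"
      by (rule set_integral_lebesgue_eq_lborel)
        (auto intro!: borel_measurable_times borel_measurable_continuous_onI[OF cG] smooth_borel_measurable[OF L(1)])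
    also have "\<dots> = (\<integral>r. (\<eta> r * (r ^ (n - 1) * A r) + deriv \<eta> r * T r) -
        (deriv \<eta> r * T r + \<eta> r * deriv T r) \<partial>lborel)"
      using a d0 by (intro Bochner_Integration.integral_cong refl)
        (auto simp: G_def indicator_def algebra_simps)
    also have "\<dots> = 0" unfolding Bochner_Integration.integral_diff[OF i1 i2] e1 e2 by simp
    finally show "(LINT r:{0<..}|lebesgue. G r * \<eta> r) = 0" .
  qed simp
  then have "AE r in lborel. r \<in> {0<..} \<longrightarrow> G r = 0" by (simp add: AE_completion_iff)
  then show ?thesis by eventually_elim (simp add: G_def T_def)
qed

section \<open>Weak gradients of radial functions\<close>

text \<open>With m = k + 1 and t = m r - 1 the left side is r times the derivative of the cut-off
  \<open>exp_bump 0 (m r - 1)\<close>, so this bound is uniform in k. The constant 2 comes from exp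
  y >= 1 + y + y^2 / 2 at y = 1 / t.\<close>

lemma exp_bump_2_bound: "(t + 1) * exp_bump 2 t \<le> 2"
proof (cases "t > 0")
  case True
  have "1 + 1 / t + (1 / t)\<^sup>2 / 2 \<le> exp (1 / t)"
    by (rule exp_lower_Taylor_quadratic) (use True in simp)
  moreover have "0 \<le> 1 / t" using True by simp
  ultimately have "1 / t + (1 / t)\<^sup>2 \<le> 2 * exp (1 / t)" by linarith
  moreover have "(t + 1) * exp_bump 2 t = (1 / t + (1 / t)\<^sup>2) / exp (1 / t)"
    using True by (simp add: exp_bump_def exp_minus field_simps power2_eq_square)
  ultimately show ?thesis by (simp add: divide_le_eq)
qed (simp add: exp_bump_def)

lemma exp_bump_0_cutoff_tendsto:
  fixes r :: real
  assumes "r > 0" shows "(\<lambda>k. exp_bump 0 (Suc k * r - 1)) \<longlonglongrightarrow> 1"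
proof -
  have "filterlim (\<lambda>k. real (Suc k) * r) at_top sequentially"
    using filterlim_tendsto_pos_mult_at_top[OF tendsto_const assms filterlim_compose[OF filterlim_real_sequentially filterlim_Suc]]
    by (simp only: mult.commute)
  then have top: "filterlim (\<lambda>k. real (Suc k) * r - 1) at_top sequentially"
    using filterlim_tendsto_add_at_top[OF tendsto_const[of "-1"]] by fastforce
  have "((\<lambda>t. exp (- (1 / t))) \<longlongrightarrow> exp (- 0)) (at_top :: real filter)"
    by (intro tendsto_intros tendsto_divide_0[OF tendsto_const] filterlim_at_top_imp_at_infinity filterlim_ident)
  moreover have "\<forall>\<^sub>F t in at_top. exp (- (1 / t)) = exp_bump 0 t"
    using eventually_gt_at_top[of "0::real"] by eventually_elim (simp add: exp_bump_def)
  ultimately have "(exp_bump 0 \<longlongrightarrow> 1) at_top"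
    using Lim_transform_eventually by fastforce
  from filterlim_compose[OF this top] show ?thesis .
qed

text \<open>The derivative of the cut-off at a fixed radius: \<open>exp_bump 2 t\<close> is at most
  1 / t^2 for t > 0, so the product with k + 1 decays like 1 / k.\<close>

lemma exp_bump_2_cutoff_tendsto:
  fixes r :: real
  assumes r: "r > 0" shows "(\<lambda>k. Suc k * exp_bump 2 (Suc k * r - 1)) \<longlonglongrightarrow> 0"
proof (rule tendsto_sandwich[OF _ _ tendsto_const])
  show "\<forall>\<^sub>F k in sequentially. 0 \<le> Suc k * exp_bump 2 (Suc k * r - 1)"
    by (simp add: exp_bump_nonneg)
  \<comment> \<open>Beyond this index m r >= 2, hence m r - 1 >= m r / 2.\<close>
  have "\<forall>\<^sub>F k in sequentially. 2 / r \<le> real k"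
    using filterlim_real_sequentially by (simp add: filterlim_at_top)
  then show "\<forall>\<^sub>F k in sequentially. Suc k * exp_bump 2 (Suc k * r - 1) \<le> 4 / r\<^sup>2 * inverse (Suc k)"
  proof eventually_elim
    case (elim k)
    define m t where "m = real (Suc k)" and "t = m * r - 1"
    have m: "m > 0" by (simp add: m_def)
    have "2 \<le> m * r" using elim r by (simp add: m_def field_simps)
    then have t: "t > 0" "m * r / 2 \<le> t" by (simp_all add: t_def)
    have "exp_bump 2 t \<le> 1 / t\<^sup>2" using t by (simp add: exp_bump_def divide_right_mono)
    also have "\<dots> \<le> 1 / (m * r / 2)\<^sup>2" using t m r by (intro divide_left_mono power_mono) auto
    finally have "m * exp_bump 2 t \<le> m * (1 / (m * r / 2)\<^sup>2)" using m by (intro mult_left_mono) auto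
    also have "\<dots> = 4 / r\<^sup>2 * inverse m" using m r by (simp add: field_simps power2_eq_square)
    finally show ?case by (simp add: m_def t_def)
  qed
  show "(\<lambda>k. 4 / r\<^sup>2 * inverse (Suc k)) \<longlonglongrightarrow> 0"
    using tendsto_mult[OF tendsto_const LIMSEQ_inverse_real_of_nat, of "4 / r\<^sup>2"] by simp
qed

lemma compact_subset_ballE:
  fixes K :: "'a::euclidean_space set"
  assumes "compact K" and "K \<subseteq> ball 0 R" and "R > 0"
  obtains \<rho> where "0 < \<rho>" and "\<rho> < R" and "K \<subseteq> cball 0 \<rho>"
proof (cases "K = {}")
  case True
  then show ?thesis using that[of "R / 2"] assms(3) by simp
next
  case False
  obtain x where x: "x \<in> K" "\<And>y. y \<in> K \<Longrightarrow> norm y \<le> norm x"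
    using continuous_attains_sup[OF assms(1) False continuous_on_norm_id] by blast
  \<comment> \<open>The maximum with R / 2 keeps the radius positive when K = {0}.\<close>
  show ?thesis
  proof (rule that[of "max (norm x) (R / 2)"])
    show "max (norm x) (R / 2) < R" using x(1) assms by auto
    show "K \<subseteq> cball 0 (max (norm x) (R / 2))" using x(2) by fastforce
  qed (use assms in auto)
qed

lemma radial_density_ge:
  assumes "n \<ge> 1" and "r > 0" shows "r ^ (n - 1) \<le> radial_density n r"
  using assms mult_right_mono[of 1 "real n" "r ^ (n - 1)"] by (simp add: radial_density_def)

text \<open>The cut-off \<open>exp_bump 0 (k r - 1)\<close> has derivative of order \<open>1 / r\<close>; this is compensated by
  \<open>\<bar>\<Psi> r\<bar> \<le> C r\<close>, which holds because \<open>\<Psi> 0 = 0\<close> by symmetry.  Hence \<open>v\<close> need not be controlled near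
  the origin beyond integrability.\<close>

lemma weak_derivative_sphere_integral:
  fixes \<phi> :: "'a::euclidean_space \<Rightarrow> real" and b :: 'a and v v' :: "real \<Rightarrow> real"
  assumes \<phi>: "smooth \<phi>" and K: "compact K" "\<And>x. x \<notin> K \<Longrightarrow> \<phi> x = 0" and b: "b \<in> Basis"
    and \<rho>: "0 < \<rho>" "\<rho> < R" "K \<subseteq> cball 0 \<rho>"
    and vm[measurable]: "v \<in> borel_measurable borel" "v' \<in> borel_measurable borel"
    and wg: "has_weak_gradient {0<..<R} v v'"
    and Hv: "integrable (radial_measure DIM('a)) (\<lambda>r. indicator {..\<rho>} r * v r)"
    and Hv': "integrable (radial_measure DIM('a)) (\<lambda>r. indicator {..\<rho>} r * v' r)"
  defines "n \<equiv> DIM('a)"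
  defines "\<Psi> \<equiv> \<lambda>r. \<integral>w. (w \<bullet> b) * \<phi> (r *\<^sub>R w) \<partial>sphere_measure"
    and "A \<equiv> \<lambda>r. \<integral>w. partial \<phi> b (r *\<^sub>R w) \<partial>sphere_measure"
  shows "(\<integral>r. radial_density n r * (v r * A r) \<partial>lborel) = - (\<integral>r. radial_density n r * (v' r * \<Psi> r) \<partial>lborel)"
proof -
  have n: "n \<ge> 1" by (simp add: n_def Suc_le_eq)
  note wb = AE_sphere_inner_le[OF b]
  have s\<Psi>: "smooth \<Psi>"
    unfolding \<Psi>_def by (rule smooth_sphere_integral[OF \<phi> K _ wb]) auto
  have pb: "smooth (partial \<phi> b)" by (rule smooth_partial[OF \<phi> b])
  have p0: "partial \<phi> b x = 0" if "x \<notin> K" for x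
    using frechet_derivative_eq_0_outside[of K \<phi> x b] K(1) K(2) that by auto
  have sA: "smooth A"
    using smooth_sphere_integral[OF pb K(1) p0, of "\<lambda>w. 1" 1] unfolding A_def by simp
  have K\<rho>: "x \<notin> K" if "norm x > \<rho>" for x using \<rho>(3) that by auto
  have \<Psi>0: "\<Psi> r = 0" if "\<bar>r\<bar> > \<rho>" for r
    unfolding \<Psi>_def by (rule sphere_integral_eq_0_outside[OF _ that]) (use K\<rho> K(2) in blast)
  have A0: "A r = 0" if "\<bar>r\<bar> > \<rho>" for r
    using sphere_integral_eq_0_outside[where g="\<lambda>w. 1" and \<phi>="partial \<phi> b", OF _ that] K\<rho> p0
    unfolding A_def by simp
  have out: "\<bar>r\<bar> > \<rho>" if "r \<notin> {-\<rho>..\<rho>}" for r using that by auto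
  obtain BA where BA: "BA > 0" "\<And>r. norm (A r) \<le> BA"
    using continuous_compact_support_bounded[OF smooth_continuous[OF sA] compact_Icc A0[OF out]] by blast
  obtain BP where BP: "BP > 0" "\<And>r. norm (\<Psi> r) \<le> BP"
    using continuous_compact_support_bounded[OF smooth_continuous[OF s\<Psi>] compact_Icc \<Psi>0[OF out]] by blast
  have d\<Psi>0: "deriv \<Psi> r = 0" if "r \<notin> {-\<rho>..\<rho>}" for r
    by (rule deriv_eq_0_outside[OF _ _ that]) (use \<Psi>0 out in auto)
  obtain C where C: "C > 0" "\<And>r. norm (deriv \<Psi> r) \<le> C"
    using continuous_compact_support_bounded[OF smooth_continuous[OF smooth_deriv[OF s\<Psi>]] compact_Icc d\<Psi>0] by blast
  have \<Psi>_at_0: "\<Psi> 0 = 0"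
    using sphere_integral_inner_eq_0[of b] by (simp add: \<Psi>_def)
  have \<Psi>_le: "\<bar>\<Psi> r\<bar> \<le> C * \<bar>r\<bar>" for r
  proof -
    have "norm (\<Psi> r - \<Psi> 0) \<le> C * norm (r - 0)"
      by (rule field_differentiable_bound[where S=UNIV and f'="deriv \<Psi>"])
        (use C smooth_DERIV[OF s\<Psi>] in auto)
    then show ?thesis by (simp add: \<Psi>_at_0)
  qed
  \<comment> \<open>By \<open>sphere_divergence\<close> the claim reads: the integral of v T' is
    minus the integral of v' T. Only the support of T, which may reach 0, prevents T from being a
    test function on (0, R); the functions \<xi> below repair this, as they vanish for r <= 1 / (k +
    1).\<close>
  define T where "T = (\<lambda>r. r ^ (n - 1) * \<Psi> r)"
  have sT: "smooth T" unfolding T_def by (intro smooth_mult smooth_power smooth_ident s\<Psi>)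
  have dT: "AE r in lborel. 0 < r \<longrightarrow> deriv T r = r ^ (n - 1) * A r"
    unfolding T_def A_def \<Psi>_def n_def by (rule sphere_divergence[OF \<phi> K b])
  note [measurable] = smooth_borel_measurable[OF sA] smooth_borel_measurable[OF s\<Psi>] smooth_borel_measurable[OF sT]
  define \<xi> where "\<xi> k r = exp_bump 0 (Suc k * r - 1) * T r" for k and r :: real
  have s\<xi>: "smooth (\<xi> k)" for k
  proof -
    have "smooth (\<lambda>r. exp_bump 0 (real (Suc k) * r + (- 1)) * T r)"
      by (intro smooth_mult smooth_compose[OF smooth_exp_bump] smooth_add smooth_const smooth_ident sT)
    then show ?thesis unfolding \<xi>_def by simp
  qed
  have d\<xi>: "deriv (\<xi> k) r = Suc k * exp_bump 2 (Suc k * r - 1) * T r + exp_bump 0 (Suc k * r - 1) * deriv T r" for k and r :: real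
  proof (rule DERIV_imp_deriv)
    have "((\<lambda>r. exp_bump 0 (Suc k * r - 1)) has_real_derivative exp_bump 2 (Suc k * r - 1) * Suc k) (at r)"
      by (rule DERIV_chain2[where f="exp_bump 0", OF _])
        (use exp_bump_DERIV[of 0] in \<open>auto intro!: derivative_eq_intros simp: numeral_2_eq_2\<close>)
    from DERIV_mult[OF this smooth_DERIV[OF sT]]
    show "(\<xi> k has_real_derivative Suc k * exp_bump 2 (Suc k * r - 1) * T r + exp_bump 0 (Suc k * r - 1) * deriv T r) (at r)"
      unfolding \<xi>_def by (simp add: mult_ac add.commute)
  qed
  have t\<xi>: "\<xi> k \<in> test_functions {0<..<R}" for k
  proof (rule test_functionsI[OF s\<xi>])
    show "compact {1 / Suc k..\<rho>}" by (rule compact_Icc)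
    show "{1 / real (Suc k)..\<rho>} \<subseteq> {0<..<R}"
    proof
      fix r assume r: "r \<in> {1 / real (Suc k)..\<rho>}"
      have "0 < 1 / real (Suc k)" by simp
      also have "\<dots> \<le> r" using r by simp
      finally show "r \<in> {0<..<R}" using r \<rho> by simp
    qed
    show "\<xi> k r = 0" if "r \<notin> {1 / Suc k..\<rho>}" for r
    proof (cases "r > \<rho>")
      case True
      then show ?thesis using \<Psi>0[of r] \<rho> by (simp add: \<xi>_def T_def)
    next
      case False
      then have "r < 1 / Suc k" using that by auto
      then have "Suc k * r - 1 < 0" by (simp add: field_simps)
      then show ?thesis by (simp add: \<xi>_def exp_bump_def)
    qed
  qed
  note [measurable] = smooth_borel_measurable[OF s\<xi>] smooth_borel_measurable[OF smooth_deriv[OF s\<xi>]]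
  have eq: "(\<integral>r. indicator {0<..<R} r * (v r * deriv (\<xi> k) r) \<partial>lborel) =
      - (\<integral>r. indicator {0<..<R} r * (v' r * \<xi> k r) \<partial>lborel)" for k
  proof -
    have "(LINT r:{0<..<R}|lebesgue. v r * partial (\<xi> k) 1 r) = - (LINT r:{0<..<R}|lebesgue. v' r \<bullet> 1 * \<xi> k r)"
      using wg t\<xi>[of k] unfolding has_weak_gradient_def by simp
    then show ?thesis
      by (simp add: fun_cong[OF partial_one_eq_deriv[OF s\<xi>]] set_integral_lebesgue_eq_lborel)
  qed
  have dom: "integrable lborel (\<lambda>r. c * norm (radial_density n r * (indicator {..\<rho>} r * W r)))"
    if "integrable (radial_measure n) (\<lambda>r. indicator {..\<rho>} r * W r)" "W \<in> borel_measurable borel" for c W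
  proof (intro integrable_mult_right integrable_norm)
    have [measurable]: "{..\<rho>} \<in> sets borel" "W \<in> borel_measurable borel" using that(2) by simp_all
    show "integrable lborel (\<lambda>r. radial_density n r * (indicator {..\<rho>} r * W r))"
      using that(1) by (subst (asm) integral_radial_measure(2)) measurable
  qed
  have lim1: "(\<lambda>k. \<integral>r. indicator {0<..<R} r * (v r * deriv (\<xi> k) r) \<partial>lborel) \<longlonglongrightarrow>
      (\<integral>r. indicator {0<..<R} r * (v r * (r ^ (n - 1) * A r)) \<partial>lborel)"
  proof (rule integral_dominated_convergence[OF _ _ dom[OF Hv[folded n_def] vm(1)]])
    show "AE r in lborel. (\<lambda>k. indicator {0<..<R} r * (v r * deriv (\<xi> k) r)) \<longlonglongrightarrow>
        indicator {0<..<R} r * (v r * (r ^ (n - 1) * A r))"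
      using dT
    proof eventually_elim
      case (elim r)
      show ?case
      proof (cases "0 < r")
        case True
        have "(\<lambda>k. Suc k * exp_bump 2 (Suc k * r - 1) * T r + exp_bump 0 (Suc k * r - 1) * deriv T r)
            \<longlonglongrightarrow> 0 * T r + 1 * deriv T r"
          by (intro tendsto_intros exp_bump_2_cutoff_tendsto exp_bump_0_cutoff_tendsto True)
        then show ?thesis using elim True unfolding d\<xi> by (intro tendsto_mult tendsto_const) simp
      qed simp
    qed
    show "AE r in lborel. norm (indicator {0<..<R} r * (v r * deriv (\<xi> k) r)) \<le>
        (2 * C + BA) * norm (radial_density n r * (indicator {..\<rho>} r * v r))" for k
      using dT
    proof eventually_elim
      case (elim r)
      show ?case
      proof (cases "0 < r \<and> r \<le> \<rho>")
        case True
        define t where "t = Suc k * r - 1"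
        have "\<bar>Suc k * exp_bump 2 t * \<Psi> r\<bar> = Suc k * exp_bump 2 t * \<bar>\<Psi> r\<bar>"
          by (simp add: abs_mult exp_bump_nonneg)
        also have "\<dots> \<le> Suc k * exp_bump 2 t * (C * r)"
          using \<Psi>_le[of r] True by (intro mult_left_mono) (auto simp: exp_bump_nonneg)
        \<comment> \<open>The factor r supplied by the bound on \<Psi> absorbs the growing factor:
          \<open>Suc k * r\<close> is t + 1.\<close>
        also have "\<dots> = C * ((t + 1) * exp_bump 2 t)" by (simp add: t_def)
        also have "\<dots> \<le> C * 2" using exp_bump_2_bound C(1) by (intro mult_left_mono) auto
        finally have b1: "\<bar>Suc k * exp_bump 2 t * \<Psi> r\<bar> \<le> 2 * C" by simp
        have b2: "\<bar>exp_bump 0 t * A r\<bar> \<le> BA"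
          using mult_mono'[OF exp_bump_0_le_1 BA(2)[of r]] exp_bump_nonneg[of 0 t]
          by (simp add: abs_mult exp_bump_nonneg)
        have "deriv (\<xi> k) r = r ^ (n - 1) * (Suc k * exp_bump 2 t * \<Psi> r + exp_bump 0 t * A r)"
          using elim True by (simp add: d\<xi> t_def T_def algebra_simps)
        then have "\<bar>deriv (\<xi> k) r\<bar> \<le> radial_density n r * (2 * C + BA)"
          using radial_density_ge[OF n, of r] True b1 b2
          by (auto simp: abs_mult intro!: mult_mono' order_trans[OF abs_triangle_ineq])
        then have "\<bar>v r\<bar> * \<bar>deriv (\<xi> k) r\<bar> \<le> \<bar>v r\<bar> * (radial_density n r * (2 * C + BA))"
          by (rule mult_left_mono) simp
        then show ?thesis using True \<rho> by (simp add: abs_mult mult_ac)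
      next
        case False
        have "\<not> 0 < r \<or> deriv (\<xi> k) r = 0"
          using elim False \<Psi>0[of r] A0[of r] by (auto simp: d\<xi> T_def)
        then show ?thesis using C BA by (auto simp: indicator_def)
      qed
    qed
  qed measurable
  have lim2: "(\<lambda>k. \<integral>r. indicator {0<..<R} r * (v' r * \<xi> k r) \<partial>lborel) \<longlonglongrightarrow>
      (\<integral>r. indicator {0<..<R} r * (v' r * T r) \<partial>lborel)"
  proof (rule integral_dominated_convergence[OF _ _ dom[OF Hv'[folded n_def] vm(2)]])
    show "AE r in lborel. (\<lambda>k. indicator {0<..<R} r * (v' r * \<xi> k r)) \<longlonglongrightarrow> indicator {0<..<R} r * (v' r * T r)"
    proof (rule AE_I2)
      fix r :: real
      show "(\<lambda>k. indicator {0<..<R} r * (v' r * \<xi> k r)) \<longlonglongrightarrow> indicator {0<..<R} r * (v' r * T r)"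
      proof (cases "0 < r")
        case True
        have "(\<lambda>k. exp_bump 0 (Suc k * r - 1) * T r) \<longlonglongrightarrow> 1 * T r"
          by (intro tendsto_intros exp_bump_0_cutoff_tendsto True)
        then show ?thesis unfolding \<xi>_def by (intro tendsto_mult tendsto_const) simp
      qed simp
    qed
    show "AE r in lborel. norm (indicator {0<..<R} r * (v' r * \<xi> k r)) \<le>
        BP * norm (radial_density n r * (indicator {..\<rho>} r * v' r))" for k
    proof (rule AE_I2)
      fix r :: real
      show "norm (indicator {0<..<R} r * (v' r * \<xi> k r)) \<le> BP * norm (radial_density n r * (indicator {..\<rho>} r * v' r))"
      proof (cases "0 < r \<and> r \<le> \<rho>")
        case True
        have "\<bar>exp_bump 0 (Suc k * r - 1) * \<Psi> r\<bar> \<le> BP"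
          using mult_mono'[OF exp_bump_0_le_1 BP(2)[of r]] exp_bump_nonneg[of 0 "Suc k * r - 1"]
          by (simp add: abs_mult exp_bump_nonneg)
        moreover have "\<xi> k r = r ^ (n - 1) * (exp_bump 0 (Suc k * r - 1) * \<Psi> r)"
          by (simp add: \<xi>_def T_def mult_ac)
        ultimately have "\<bar>\<xi> k r\<bar> \<le> radial_density n r * BP"
          using radial_density_ge[OF n, of r] True by (auto simp: abs_mult intro!: mult_mono')
        then have "\<bar>v' r\<bar> * \<bar>\<xi> k r\<bar> \<le> \<bar>v' r\<bar> * (radial_density n r * BP)"
          by (rule mult_left_mono) simp
        then show ?thesis using True \<rho> by (simp add: abs_mult mult_ac)
      next
        case False
        have "\<not> 0 < r \<or> \<xi> k r = 0"
          using False \<Psi>0[of r] by (auto simp: \<xi>_def T_def)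
        then show ?thesis using BP by (auto simp: indicator_def)
      qed
    qed
  qed measurable
  have main: "(\<integral>r. indicator {0<..<R} r * (v r * (r ^ (n - 1) * A r)) \<partial>lborel) =
      - (\<integral>r. indicator {0<..<R} r * (v' r * T r) \<partial>lborel)"
    using LIMSEQ_unique[OF lim1 tendsto_minus[OF lim2, folded eq]] .
  have "(\<integral>r. radial_density n r * (v r * A r) \<partial>lborel) =
      (\<integral>r. n * (indicator {0<..<R} r * (v r * (r ^ (n - 1) * A r))) \<partial>lborel)"
  proof (intro Bochner_Integration.integral_cong refl)
    fix r
    show "radial_density n r * (v r * A r) = n * (indicator {0<..<R} r * (v r * (r ^ (n - 1) * A r)))"
      using A0[of r] \<rho> by (cases "r < R") (auto simp: radial_density_def indicator_def)
  qed
  also have "\<dots> = - (\<integral>r. n * (indicator {0<..<R} r * (v' r * T r)) \<partial>lborel)"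
    using main by simp
  also have "(\<integral>r. n * (indicator {0<..<R} r * (v' r * T r)) \<partial>lborel) = (\<integral>r. radial_density n r * (v' r * \<Psi> r) \<partial>lborel)"
  proof (intro Bochner_Integration.integral_cong refl)
    fix r
    show "n * (indicator {0<..<R} r * (v' r * T r)) = radial_density n r * (v' r * \<Psi> r)"
      using \<Psi>0[of r] \<rho> by (cases "r < R") (auto simp: radial_density_def indicator_def T_def)
  qed
  finally show ?thesis .
qed

section \<open>From the weak derivative of v to the weak gradient of u\<close>

lemma set_integral_lebesgue_eq_lborel_support:
  fixes f :: "'a::euclidean_space \<Rightarrow> real"
  assumes "f \<in> borel_measurable borel" and "U \<in> sets borel" and "\<And>x. x \<notin> U \<Longrightarrow> f x = 0"
  shows "(LINT x:U|lebesgue. f x) = integral\<^sup>L lborel f"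
  unfolding set_integral_lebesgue_eq_lborel(1)[OF assms(1,2)]
  using assms(3) by (intro Bochner_Integration.integral_cong refl) (auto simp: indicator_def)

lemma set_borel_measurable_lebesgueI:
  fixes f :: "'a::euclidean_space \<Rightarrow> 'b::euclidean_space"
  assumes "f \<in> borel_measurable borel" and "U \<in> sets borel"
  shows "set_borel_measurable lebesgue U f"
  unfolding set_borel_measurable_def using assms
  by (intro measurable_completion borel_measurable_scaleR borel_measurable_indicator) simp_all

lemma set_integrable_norm_compose:
  fixes W :: "real \<Rightarrow> real"
  assumes [measurable]: "W \<in> borel_measurable borel"
  shows "set_integrable lebesgue (cball (0::'a::euclidean_space) \<rho>) (\<lambda>x. W (norm x)) \<longleftrightarrow>
    integrable (radial_measure DIM('a)) (\<lambda>r. indicator {..\<rho>} r * W r)"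
proof -
  have [measurable]: "{..\<rho>} \<in> sets borel" by simp
  have "set_integrable lebesgue (cball (0::'a) \<rho>) (\<lambda>x. W (norm x)) \<longleftrightarrow>
      integrable lborel (\<lambda>x::'a. indicator (cball 0 \<rho>) x * W (norm x))"
    by (rule set_integral_lebesgue_eq_lborel(2)) auto
  also have "(\<lambda>x::'a. indicator (cball 0 \<rho>) x * W (norm x)) = (\<lambda>x. (\<lambda>r. indicator {..\<rho>} r * W r) (norm x))"
    by (auto simp: indicator_def)
  also have "integrable lborel \<dots> \<longleftrightarrow> integrable (radial_measure DIM('a)) (\<lambda>r. indicator {..\<rho>} r * W r)"
    by (rule integral_norm_compose(1)) measurable
  finally show ?thesis .
qed

text \<open>In polar coordinates v |x| pairs with the spherical integral of the partial derivative
  of \<phi>, and the b-component of the proposed gradient with the integral of (w \<bullet> b)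
  \<phi>. The identity between them is \<open>weak_derivative_sphere_integral\<close>.\<close>

lemma has_weak_gradient_radial:
  fixes v v' :: "real \<Rightarrow> real"
  assumes R: "R > 0" and vm[measurable]: "v \<in> borel_measurable borel" "v' \<in> borel_measurable borel"
    and wg: "has_weak_gradient {0<..<R} v v'"
    and Hv: "\<And>\<rho>. 0 < \<rho> \<Longrightarrow> \<rho> < R \<Longrightarrow> integrable (radial_measure DIM('a)) (\<lambda>r. indicator {..\<rho>} r * v r)"
    and Hv': "\<And>\<rho>. 0 < \<rho> \<Longrightarrow> \<rho> < R \<Longrightarrow> integrable (radial_measure DIM('a)) (\<lambda>r. indicator {..\<rho>} r * v' r)"
  shows "has_weak_gradient (ball (0::'a::euclidean_space) R) (\<lambda>x. v (norm x)) (\<lambda>x. v' (norm x) *\<^sub>R sgn x)"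
  unfolding has_weak_gradient_def
proof (intro conjI ballI)
  show "locally_integrable (ball (0::'a) R) (\<lambda>x. v (norm x))"
    unfolding locally_integrable_def
  proof (intro allI impI)
    fix K :: "'a set" assume K: "compact K \<and> K \<subseteq> ball 0 R"
    obtain \<rho> where \<rho>: "0 < \<rho>" "\<rho> < R" "K \<subseteq> cball 0 \<rho>" using compact_subset_ballE[of K R] K R by metis
    then have "set_integrable lebesgue (cball (0::'a) \<rho>) (\<lambda>x. v (norm x))"
      using Hv by (simp add: set_integrable_norm_compose)
    then show "set_integrable lebesgue K (\<lambda>x. v (norm x))"
      by (rule set_integrable_subset) (use K \<rho> in \<open>auto intro: fmeasurableD lmeasurable_compact\<close>)
  qed
  show "locally_integrable (ball (0::'a) R) (\<lambda>x. v' (norm x) *\<^sub>R sgn x)"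
    unfolding locally_integrable_def
  proof (intro allI impI)
    fix K :: "'a set" assume K: "compact K \<and> K \<subseteq> ball 0 R"
    obtain \<rho> where \<rho>: "0 < \<rho>" "\<rho> < R" "K \<subseteq> cball 0 \<rho>" using compact_subset_ballE[of K R] K R by metis
    then have *: "set_integrable lebesgue (cball (0::'a) \<rho>) (\<lambda>x. v' (norm x))"
      using Hv' by (simp add: set_integrable_norm_compose)
    have "set_integrable lebesgue (cball (0::'a) \<rho>) (\<lambda>x. v' (norm x) *\<^sub>R sgn x)"
    proof (rule set_integrable_bound[OF *])
      show "set_borel_measurable lebesgue (cball (0::'a) \<rho>) (\<lambda>x. v' (norm x) *\<^sub>R sgn x)"
      proof -
        have "(\<lambda>x::'a. v' (norm x) *\<^sub>R sgn x) \<in> borel_measurable borel" by measurable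
        then show ?thesis by (intro set_borel_measurable_lebesgueI) auto
      qed
    qed (auto simp: norm_sgn)
    then show "set_integrable lebesgue K (\<lambda>x. v' (norm x) *\<^sub>R sgn x)"
      by (rule set_integrable_subset) (use K \<rho> in \<open>auto intro: fmeasurableD lmeasurable_compact\<close>)
  qed
  fix b :: 'a assume b: "b \<in> Basis"
  fix \<phi> :: "'a \<Rightarrow> real" assume t: "\<phi> \<in> test_functions (ball 0 R)"
  obtain K where K: "smooth \<phi>" "compact K" "K \<subseteq> ball 0 R" "\<And>x. x \<notin> K \<Longrightarrow> \<phi> x = 0"
    using test_functionsE[OF t] by metis
  obtain \<rho> where \<rho>: "0 < \<rho>" "\<rho> < R" "K \<subseteq> cball 0 \<rho>" using compact_subset_ballE[OF K(2,3) R] by metis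
  have K\<rho>: "x \<notin> K" if "norm x > \<rho>" for x using \<rho>(3) that by auto
  have p0: "partial \<phi> b x = 0" if "x \<notin> K" for x
    using frechet_derivative_eq_0_outside[of K \<phi> x b] K(2) K(4) that by auto
  note sp = smooth_partial[OF K(1) b]
  note [measurable] = smooth_borel_measurable[OF K(1)] smooth_borel_measurable[OF sp]
  obtain B where B: "B > 0" "\<And>x. norm (\<phi> x) \<le> B"
    using continuous_compact_support_bounded[OF smooth_continuous[OF K(1)] K(2,4)] by blast
  obtain B' where B': "B' > 0" "\<And>x. norm (partial \<phi> b x) \<le> B'"
    using continuous_compact_support_bounded[OF smooth_continuous[OF sp] K(2) p0] by blast
  have "(LINT x:ball 0 R|lebesgue. v (norm x) * partial \<phi> b x) =
      (\<integral>x. v (norm x) * partial \<phi> b x \<partial>lborel)"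
  proof (rule set_integral_lebesgue_eq_lborel_support)
    show "v (norm x) * partial \<phi> b x = 0" if "x \<notin> ball 0 R" for x
      using p0[of x] subsetD[OF K(3), of x] that by auto
  qed measurable
  also have "\<dots> = (\<integral>r. radial_density DIM('a) r * (v r * (\<integral>w. partial \<phi> b (r *\<^sub>R w) \<partial>sphere_measure)) \<partial>lborel)"
    by (rule integral_radial_product(2)[OF vm(1) _ B'(2) _ Hv[OF \<rho>(1,2)]]) (auto simp: p0 K\<rho>)
  also have "\<dots> = - (\<integral>r. radial_density DIM('a) r * (v' r * (\<integral>w. (w \<bullet> b) * \<phi> (r *\<^sub>R w) \<partial>sphere_measure)) \<partial>lborel)"
    by (rule weak_derivative_sphere_integral[OF K(1,2,4) b \<rho> vm wg Hv[OF \<rho>(1,2)] Hv'[OF \<rho>(1,2)]])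
  also have "(\<integral>r. radial_density DIM('a) r * (v' r * (\<integral>w. (w \<bullet> b) * \<phi> (r *\<^sub>R w) \<partial>sphere_measure)) \<partial>lborel) =
      (\<integral>r. radial_density DIM('a) r * (v' r * (\<integral>w. (sgn (r *\<^sub>R w) \<bullet> b) * \<phi> (r *\<^sub>R w) \<partial>sphere_measure)) \<partial>lborel)"
  proof (intro Bochner_Integration.integral_cong refl)
    fix r
    show "radial_density DIM('a) r * (v' r * (\<integral>w. (w \<bullet> b) * \<phi> (r *\<^sub>R w) \<partial>sphere_measure)) =
        radial_density DIM('a) r * (v' r * (\<integral>w. (sgn (r *\<^sub>R w) \<bullet> b) * \<phi> (r *\<^sub>R w) \<partial>sphere_measure))"
    proof (cases "0 < r")
      case True
      have "(\<integral>w. (w \<bullet> b) * \<phi> (r *\<^sub>R w) \<partial>sphere_measure) =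
          (\<integral>w. (sgn (r *\<^sub>R w) \<bullet> b) * \<phi> (r *\<^sub>R w) \<partial>sphere_measure)"
      proof (rule integral_cong_AE)
        show "AE w in sphere_measure. (w \<bullet> b) * \<phi> (r *\<^sub>R w) = (sgn (r *\<^sub>R w) \<bullet> b) * \<phi> (r *\<^sub>R w)"
          using AE_sphere_norm by eventually_elim (use True in \<open>simp add: sgn_scaleR sgn_div_norm\<close>)
      qed measurable
      then show ?thesis by simp
    qed (simp add: radial_density_def)
  qed
  also have "\<dots> = (\<integral>x. v' (norm x) * ((sgn x \<bullet> b) * \<phi> x) \<partial>lborel)"
  proof (rule integral_radial_product(2)[OF vm(2) _ _ _ Hv'[OF \<rho>(1,2)], symmetric])
    show "(\<lambda>x. (sgn x \<bullet> b) * \<phi> x) \<in> borel_measurable borel" by measurable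
    show "norm ((sgn x \<bullet> b) * \<phi> x) \<le> 1 * B" for x
    proof -
      have "\<bar>sgn x \<bullet> b\<bar> \<le> 1" using Basis_le_norm[OF b, of "sgn x"] by (simp add: norm_sgn split: if_splits)
      then show ?thesis using B(2)[of x] unfolding norm_mult by (intro mult_mono') auto
    qed
  qed (use K(4) K\<rho> in auto)
  also have "\<dots> = (LINT x:ball 0 R|lebesgue. (v' (norm x) *\<^sub>R sgn x) \<bullet> b * \<phi> x)"
  proof -
    have "(LINT x:ball 0 R|lebesgue. v' (norm x) * ((sgn x \<bullet> b) * \<phi> x)) =
        (\<integral>x. v' (norm x) * ((sgn x \<bullet> b) * \<phi> x) \<partial>lborel)"
    proof (rule set_integral_lebesgue_eq_lborel_support)
      show "v' (norm x) * ((sgn x \<bullet> b) * \<phi> x) = 0" if "x \<notin> ball 0 R" for x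
        using K(4)[of x] subsetD[OF K(3), of x] that by auto
    qed measurable
    then show ?thesis by (simp add: mult.assoc)
  qed
  finally show "(LINT x:ball 0 R|lebesgue. v (norm x) * partial \<phi> b x) =
      - (LINT x:ball 0 R|lebesgue. (v' (norm x) *\<^sub>R sgn x) \<bullet> b * \<phi> x)" .
qed

text \<open>On a compact subset of (0, R) the density is at least its value c at the smallest point,
  so the weight can be divided out.\<close>

lemma locally_integrable_if_radial:
  fixes W :: "real \<Rightarrow> real"
  assumes n: "n \<ge> 1" and Wm[measurable]: "W \<in> borel_measurable borel"
    and H: "\<And>\<rho>. 0 < \<rho> \<Longrightarrow> \<rho> < R \<Longrightarrow> integrable (radial_measure n) (\<lambda>r. indicator {..\<rho>} r * W r)"
  shows "locally_integrable {0<..<R} W"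
  unfolding locally_integrable_def
proof (intro allI impI)
  fix K :: "real set" assume "compact K \<and> K \<subseteq> {0<..<R}"
  then have K: "compact K" "K \<subseteq> {0<..<R}" by auto
  show "set_integrable lebesgue K W"
  proof (cases "K = {}")
    case False
    obtain a where a: "a \<in> K" "\<And>y. y \<in> K \<Longrightarrow> a \<le> y" using compact_attains_inf[OF K(1) False] by blast
    obtain \<rho> where \<rho>: "\<rho> \<in> K" "\<And>y. y \<in> K \<Longrightarrow> y \<le> \<rho>" using compact_attains_sup[OF K(1) False] by blast
    have pos: "0 < a" "0 < \<rho>" "\<rho> < R" using a(1) \<rho>(1) K(2) by auto
    have [measurable]: "K \<in> sets borel" using compact_imp_closed[OF K(1)] by simp
    have [measurable]: "{..\<rho>} \<in> sets borel" by simp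
    define c where "c = radial_density n a"
    have c: "c > 0" using n pos by (simp add: c_def radial_density_def)
    have "integrable lborel (\<lambda>r. indicator K r * W r)"
    proof (rule Bochner_Integration.integrable_bound)
      have "integrable lborel (\<lambda>r. radial_density n r * (indicator {..\<rho>} r * W r))"
        using H[OF pos(2,3)] by (subst (asm) integral_radial_measure(2)) measurable
      then show "integrable lborel (\<lambda>r. (1 / c) * (radial_density n r * (indicator {..\<rho>} r * W r)))"
        by (rule integrable_mult_right)
      show "AE r in lborel. norm (indicator K r * W r) \<le> norm ((1 / c) * (radial_density n r * (indicator {..\<rho>} r * W r)))"
      proof (rule AE_I2)
        fix r
        show "norm (indicator K r * W r) \<le> norm ((1 / c) * (radial_density n r * (indicator {..\<rho>} r * W r)))"
        proof (cases "r \<in> K")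
          case True
          have "c \<le> radial_density n r"
            using a(2)[OF True] pos(1) by (auto simp: c_def radial_density_def intro!: mult_left_mono power_mono)
          then have "\<bar>W r\<bar> * 1 \<le> \<bar>W r\<bar> * ((1 / c) * radial_density n r)"
            using c by (intro mult_left_mono) auto
          then show ?thesis using True \<rho>(2)[OF True] c by (simp add: abs_mult mult_ac)
        qed simp
      qed
    qed measurable
    then show ?thesis by (subst set_integral_lebesgue_eq_lborel(2)) measurable
  qed (simp add: set_integrable_def)
qed

lemma set_integral_sum_lebesgue:
  fixes f :: "'i \<Rightarrow> 'a::euclidean_space \<Rightarrow> real"
  assumes "\<And>i. i \<in> I \<Longrightarrow> set_integrable lebesgue U (f i)"
  shows "(LINT x:U|lebesgue. \<Sum>i\<in>I. f i x) = (\<Sum>i\<in>I. LINT x:U|lebesgue. f i x)"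
  using assms unfolding set_lebesgue_integral_def set_integrable_def
  by (simp add: scaleR_sum_right sum_distrib_left Bochner_Integration.integral_sum)

section \<open>From the weak gradient of u to the weak derivative of v\<close>

definition radial_derivative :: "('a::euclidean_space \<Rightarrow> 'a) \<Rightarrow> real \<Rightarrow> real" where
  "radial_derivative Du r = (\<integral>w. Du (r *\<^sub>R w) \<bullet> w \<partial>sphere_measure) / sphere_area TYPE('a)"

lemma radial_derivative_measurable:
  assumes [measurable]: "Du \<in> borel_measurable borel"
  shows "radial_derivative Du \<in> borel_measurable borel"
  unfolding radial_derivative_def[abs_def] by measurable

text \<open>A radial weight is constant on spheres, so Du contributes to such an integral only
  through the mean of its radial component.\<close>

lemma integral_polar_radial_derivative:
  fixes Du :: "'a::euclidean_space \<Rightarrow> 'a"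
  assumes [measurable]: "Du \<in> borel_measurable borel" "W \<in> borel_measurable borel"
    and int: "integrable lborel (\<lambda>x. W (norm x) * (Du x \<bullet> sgn x))"
  shows "(\<integral>x. W (norm x) * (Du x \<bullet> sgn x) \<partial>lborel) =
      sphere_area TYPE('a) * (\<integral>r. radial_density DIM('a) r * (W r * radial_derivative Du r) \<partial>lborel)"
    and "integrable (radial_measure DIM('a)) (\<lambda>r. W r * radial_derivative Du r)"
proof -
  note [measurable] = radial_derivative_measurable[OF assms(1)]
  let ?F = "\<lambda>x. W (norm x) * (Du x \<bullet> sgn x)"
  let ?c = "sphere_area TYPE('a)"
  have c: "?c > 0" by (rule sphere_area_pos)
  have ae: "AE r in radial_measure DIM('a). (\<integral>w. ?F (r *\<^sub>R w) \<partial>sphere_measure) = ?c * (W r * radial_derivative Du r)"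
  proof (subst AE_radial_measure; (intro AE_I2 impI)?)
    fix r :: real assume r: "0 < r"
    have "(\<integral>w. ?F (r *\<^sub>R w) \<partial>sphere_measure) = (\<integral>w. W r * (Du (r *\<^sub>R w) \<bullet> w) \<partial>sphere_measure)"
    proof (rule integral_cong_AE)
      show "AE w in sphere_measure. ?F (r *\<^sub>R w) = W r * (Du (r *\<^sub>R w) \<bullet> w)"
        using AE_sphere_norm by eventually_elim (use r in \<open>simp add: sgn_scaleR sgn_div_norm\<close>)
    qed measurable
    then show "(\<integral>w. ?F (r *\<^sub>R w) \<partial>sphere_measure) = ?c * (W r * radial_derivative Du r)"
      using c by (simp add: radial_derivative_def)
  qed (simp add: Suc_le_eq)
  have "integrable (radial_measure DIM('a)) (\<lambda>r. ?c * (W r * radial_derivative Du r))"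
    by (rule integrable_cong_AE_imp[OF integral_polar(1)[OF int] _ ae]) measurable
  then show "integrable (radial_measure DIM('a)) (\<lambda>r. W r * radial_derivative Du r)"
    using c by simp
  have "(\<integral>x. ?F x \<partial>lborel) = (\<integral>r. (\<integral>w. ?F (r *\<^sub>R w) \<partial>sphere_measure) \<partial>radial_measure DIM('a))"
    by (rule integral_polar(2)[OF int])
  also have "\<dots> = (\<integral>r. ?c * (W r * radial_derivative Du r) \<partial>radial_measure DIM('a))"
    by (rule integral_cong_AE[OF _ _ ae]) measurable
  also have "\<dots> = ?c * (\<integral>r. W r * radial_derivative Du r \<partial>radial_measure DIM('a))"
    by simp
  also have "(\<integral>r. W r * radial_derivative Du r \<partial>radial_measure DIM('a)) =
      (\<integral>r. radial_density DIM('a) r * (W r * radial_derivative Du r) \<partial>lborel)"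
    by (rule integral_radial_measure(1)) measurable
  finally show "(\<integral>x. ?F x \<partial>lborel) =
      ?c * (\<integral>r. radial_density DIM('a) r * (W r * radial_derivative Du r) \<partial>lborel)" .
qed

lemma radial_function_integrable:
  fixes v :: "real \<Rightarrow> real" and Du :: "'a::euclidean_space \<Rightarrow> 'a"
  assumes vm[measurable]: "v \<in> borel_measurable borel" and Dm[measurable]: "Du \<in> borel_measurable borel"
    and wg: "has_weak_gradient (ball (0::'a) R) (\<lambda>x. v (norm x)) Du"
    and \<rho>: "0 < \<rho>" "\<rho> < R"
  shows "integrable (radial_measure DIM('a)) (\<lambda>r. indicator {..\<rho>} r * v r)"
    and "integrable (radial_measure DIM('a)) (\<lambda>r. indicator {..\<rho>} r * radial_derivative Du r)"
proof -
  have sub: "compact (cball (0::'a) \<rho>)" "cball (0::'a) \<rho> \<subseteq> ball 0 R" using \<rho> by auto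
  then have v: "set_integrable lebesgue (cball (0::'a) \<rho>) (\<lambda>x. v (norm x))"
    and D: "set_integrable lebesgue (cball 0 \<rho>) Du"
    using wg unfolding has_weak_gradient_def locally_integrable_def by blast+
  show "integrable (radial_measure DIM('a)) (\<lambda>r. indicator {..\<rho>} r * v r)"
    using v by (simp add: set_integrable_norm_compose)
  have [measurable]: "{..\<rho>} \<in> sets borel" by simp
  have cm[measurable]: "indicat_real (cball (0::'a) \<rho>) \<in> borel_measurable borel"
    by (simp add: borel_measurable_indicator)
  have "integrable lborel (\<lambda>x. indicator (cball 0 \<rho>) x *\<^sub>R Du x)"
    using D unfolding set_integrable_def by (subst (asm) integrable_completion) auto
  then have "integrable lborel (\<lambda>x. indicator {..\<rho>} (norm x) * (Du x \<bullet> sgn x))"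
  proof (rule Bochner_Integration.integrable_bound)
    show "AE x in lborel. norm (indicator {..\<rho>} (norm x) * (Du x \<bullet> sgn x)) \<le> norm (indicator (cball 0 \<rho>) x *\<^sub>R Du x)"
    proof (rule AE_I2)
      fix x :: 'a
      have "\<bar>Du x \<bullet> sgn x\<bar> \<le> norm (Du x) * norm (sgn x)" by (rule Cauchy_Schwarz_ineq2)
      also have "\<dots> \<le> norm (Du x) * 1" by (intro mult_left_mono) (auto simp: norm_sgn)
      finally show "norm (indicator {..\<rho>} (norm x) * (Du x \<bullet> sgn x)) \<le> norm (indicator (cball 0 \<rho>) x *\<^sub>R Du x)"
        by (auto simp: indicator_def)
    qed
  qed measurable
  then show "integrable (radial_measure DIM('a)) (\<lambda>r. indicator {..\<rho>} r * radial_derivative Du r)"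
    by (intro integral_polar_radial_derivative(2)) measurable
qed

text \<open>The weak derivative is found by testing the gradient with the field
  \<open>\<phi> |x| |x|\<^sup>-\<^sup>n x\<close>, whose divergence is \<open>\<phi>' |x| |x|\<^sup>1\<^sup>-\<^sup>n\<close>.\<close>

lemma has_weak_gradient_of_radial:
  fixes v :: "real \<Rightarrow> real" and Du :: "'a::euclidean_space \<Rightarrow> 'a"
  assumes vm[measurable]: "v \<in> borel_measurable borel" and Dm[measurable]: "Du \<in> borel_measurable borel"
    and wg: "has_weak_gradient (ball (0::'a) R) (\<lambda>x. v (norm x)) Du"
  shows "has_weak_gradient {0<..<R} v (radial_derivative Du)"
  unfolding has_weak_gradient_def
proof (intro conjI ballI)
  define n where "n = DIM('a)"
  have n: "n \<ge> 1" by (simp add: n_def Suc_le_eq)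
  note [measurable] = radial_derivative_measurable[OF Dm]
  show "locally_integrable {0<..<R} v" "locally_integrable {0<..<R} (radial_derivative Du)"
    using radial_function_integrable[OF vm Dm wg]
    by (auto intro!: locally_integrable_if_radial[OF n] radial_derivative_measurable simp: n_def)
  fix b :: real assume "b \<in> Basis"
  then have b: "b = 1" by simp
  fix \<phi> :: "real \<Rightarrow> real" assume t: "\<phi> \<in> test_functions {0<..<R}"
  obtain K where K: "smooth \<phi>" "compact K" "K \<subseteq> {0<..<R}" "\<And>x. x \<notin> K \<Longrightarrow> \<phi> x = 0"
    using test_functionsE[OF t] by metis
  have t': "\<phi> \<in> test_functions {0<..}" using t by (rule subsetD[OF test_functions_mono, rotated]) auto
  obtain a where a: "a > 0" "\<And>s. s < a \<Longrightarrow> \<phi> s = 0" using test_functions_vanish_below[OF t'] by metis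
  have dK: "deriv \<phi> s = 0" if "s \<notin> K" for s
    using deriv_eq_0_outside[of K \<phi> s] compact_imp_closed[OF K(2)] K(4) that by auto
  show "(LINT x:{0<..<R}|lebesgue. v x * partial \<phi> b x) =
      - (LINT x:{0<..<R}|lebesgue. radial_derivative Du x \<bullet> b * \<phi> x)"
  proof (cases "K = {}")
    case True
    then show ?thesis using K(4) dK by (simp add: b fun_cong[OF partial_one_eq_deriv[OF K(1)]])
  next
    case False
    then have R: "R > 0" using K(3) by auto
    obtain \<rho> where "\<rho> \<in> K" "\<And>y. y \<in> K \<Longrightarrow> y \<le> \<rho>" using compact_attains_sup[OF K(2) False] by blast
    then have \<rho>: "0 < \<rho>" "\<rho> < R" "\<And>s. s > \<rho> \<Longrightarrow> s \<notin> K" using K(3) by fastforce+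
    \<comment> \<open>The field is \<zeta> |x| x, with components \<tau> b. It is smooth at the
      origin because \<phi> vanishes below a.\<close>
    define \<zeta> where "\<zeta> s = \<phi> s / s ^ n" for s
    have s\<zeta>: "smooth \<zeta>" unfolding \<zeta>_def using K(1) a(2,1) by (rule smooth_divide_power)
    have \<zeta>0: "\<zeta> s = 0" if "s < a" for s using a(2)[OF that] by (simp add: \<zeta>_def)
    have d\<zeta>: "deriv \<zeta> s = deriv \<phi> s / s ^ n - n * (\<phi> s / s ^ Suc n)" if "s > 0" for s
      unfolding \<zeta>_def by (rule DERIV_imp_deriv[OF DERIV_divide_power[OF smooth_DERIV[OF K(1)]]]) (use that in simp)
    have d\<zeta>0: "deriv \<zeta> s = 0" if "s < a" for s using deriv_eq_0_below[of a \<zeta> s] \<zeta>0 that by simp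
    define \<tau> where "\<tau> b x = \<zeta> (norm x) * (x \<bullet> b)" for b x :: 'a
    have s\<tau>: "smooth (\<tau> b)" for b
      unfolding \<tau>_def by (intro smooth_mult smooth_compose_norm[OF s\<zeta> \<zeta>0 a(1)] smooth_inner)
    have \<tau>0: "\<tau> b x = 0" if "x \<notin> cball 0 \<rho>" for b x
      using that K(4)[OF \<rho>(3)[of "norm x"]] by (simp add: \<tau>_def \<zeta>_def)
    have sub: "compact (cball (0::'a) \<rho>)" "cball (0::'a) \<rho> \<subseteq> ball 0 R" using \<rho> by auto
    have t\<tau>: "\<tau> b \<in> test_functions (ball 0 R)" for b
      by (rule test_functionsI[OF s\<tau> sub \<tau>0])
    have p\<tau>: "partial (\<tau> b) b x = deriv \<zeta> (norm x) * (sgn x \<bullet> b) * (x \<bullet> b) + \<zeta> (norm x)" if "b \<in> Basis" for b x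
    proof -
      have "((\<lambda>x. x \<bullet> b) has_derivative (\<lambda>h. h \<bullet> b)) (at x)"
        by (auto intro!: derivative_eq_intros)
      from has_derivative_mult[OF norm_compose_has_derivative[OF smooth_DERIV[OF s\<zeta>] \<zeta>0 a(1)] this]
      have "(\<tau> b has_derivative (\<lambda>h. \<zeta> (norm x) * (h \<bullet> b) + ((deriv \<zeta> (norm x) *\<^sub>R sgn x) \<bullet> h) * (x \<bullet> b))) (at x)"
        unfolding \<tau>_def .
      from frechet_derivative_at[OF this, symmetric] show ?thesis
        using that by (simp add: inner_Basis)
    qed
    have p\<tau>0: "partial (\<tau> b) b x = 0" if "x \<notin> cball 0 \<rho>" for b x
      using frechet_derivative_eq_0_outside[of "cball 0 \<rho>" "\<tau> b" x b] \<tau>0 that by auto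
    \<comment> \<open>In \<zeta>' |x| + n \<zeta> the divergence n of the field x cancels the term
      that comes from differentiating s^(-n).\<close>
    have div: "(\<Sum>b\<in>Basis. partial (\<tau> b) b x) = deriv \<phi> (norm x) / norm x ^ (n - 1)" for x
    proof (cases "norm x < a")
      case True
      then show ?thesis
        using deriv_eq_0_below[of a \<phi> "norm x"] a(2) by (simp add: p\<tau> d\<zeta>0 \<zeta>0)
    next
      case False
      then have x: "norm x > 0" using a(1) by linarith
      have "(\<Sum>b\<in>Basis. partial (\<tau> b) b x) =
          deriv \<zeta> (norm x) * (\<Sum>b\<in>Basis. (sgn x \<bullet> b) * (x \<bullet> b)) + n * \<zeta> (norm x)"
        by (simp add: p\<tau> sum.distrib sum_distrib_left n_def mult.assoc)
      also have "(\<Sum>b\<in>Basis. (sgn x \<bullet> b) * (x \<bullet> b)) = norm x"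
        unfolding euclidean_inner[symmetric] using x
        by (simp add: sgn_div_norm power2_norm_eq_inner[symmetric] power2_eq_square)
      also have "deriv \<zeta> (norm x) * norm x + n * \<zeta> (norm x) = deriv \<phi> (norm x) / norm x ^ (n - 1)"
        unfolding d\<zeta>[OF x] \<zeta>_def using x power_minus_mult[of n "norm x"] n by (simp add: field_simps)
      finally show ?thesis .
    qed
    have vint: "set_integrable lebesgue (cball (0::'a) \<rho>) (\<lambda>x. v (norm x))"
      and Dint: "set_integrable lebesgue (cball 0 \<rho>) (\<lambda>x. Du x \<bullet> b)" for b
      using wg sub locally_integrable_inner[of "ball 0 R" Du b]
      unfolding has_weak_gradient_def locally_integrable_def by blast+
    have "(LINT x:ball 0 R|lebesgue. \<Sum>b\<in>Basis. v (norm x) * partial (\<tau> b) b x) =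
        (\<Sum>b\<in>Basis. LINT x:ball 0 R|lebesgue. v (norm x) * partial (\<tau> b) b x)"
      by (intro set_integral_sum_lebesgue set_integrable_mult_compact_support[OF vint sub]
          smooth_continuous smooth_partial s\<tau> p\<tau>0)
    also have "\<dots> = (\<Sum>b\<in>Basis. - (LINT x:ball 0 R|lebesgue. Du x \<bullet> b * \<tau> b x))"
      using wg t\<tau> unfolding has_weak_gradient_def by (intro sum.cong refl) blast
    also have "\<dots> = - (LINT x:ball 0 R|lebesgue. \<Sum>b\<in>Basis. Du x \<bullet> b * \<tau> b x)"
    proof -
      have "set_integrable lebesgue (ball 0 R) (\<lambda>x. Du x \<bullet> b * \<tau> b x)" for b
        by (intro set_integrable_mult_compact_support[OF Dint sub] smooth_continuous s\<tau> \<tau>0)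
      from set_integral_sum_lebesgue[OF this] show ?thesis
        unfolding sum_negf by (rule arg_cong[where f=uminus, OF sym])
    qed
    finally have w: "(LINT x:ball 0 R|lebesgue. \<Sum>b\<in>Basis. v (norm x) * partial (\<tau> b) b x) =
        - (LINT x:ball 0 R|lebesgue. \<Sum>b\<in>Basis. Du x \<bullet> b * \<tau> b x)" .
    note [measurable] = smooth_borel_measurable[OF K(1)] smooth_borel_measurable[OF smooth_deriv[OF K(1)]]
    define c where "c = sphere_area TYPE('a)"
    have c: "c > 0" unfolding c_def by (rule sphere_area_pos)
    have wR: "norm x < R" if "norm x \<in> K" for x :: 'a using K(3) that by auto
    have "(LINT x:ball 0 R|lebesgue. \<Sum>b\<in>Basis. v (norm x) * partial (\<tau> b) b x) =
        (LINT x:ball (0::'a) R|lebesgue. v (norm x) * (deriv \<phi> (norm x) / norm x ^ (n - 1)))"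
      by (simp add: sum_distrib_left[symmetric] div)
    also have "\<dots> = (\<integral>x. (\<lambda>r. v r * (deriv \<phi> r / r ^ (n - 1))) (norm (x::'a)) \<partial>lborel)"
    proof (subst set_integral_lebesgue_eq_lborel(1))
      show "(\<integral>x. indicator (ball (0::'a) R) x * (v (norm x) * (deriv \<phi> (norm x) / norm x ^ (n - 1))) \<partial>lborel) =
          (\<integral>x. (\<lambda>r. v r * (deriv \<phi> r / r ^ (n - 1))) (norm (x::'a)) \<partial>lborel)"
        using dK wR by (intro Bochner_Integration.integral_cong refl) (auto simp: indicator_def)
    qed measurable
    also have "\<dots> = c * (\<integral>r. radial_density n r * (v r * (deriv \<phi> r / r ^ (n - 1))) \<partial>lborel)"
      unfolding c_def n_def by (subst integral_norm_compose(2), measurable, subst integral_radial_measure(1), measurable)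
    \<comment> \<open>The field was chosen so that its divergence cancels the power in the density,
      leaving the unweighted integral of v \<phi>'.\<close>
    also have "(\<integral>r. radial_density n r * (v r * (deriv \<phi> r / r ^ (n - 1))) \<partial>lborel) =
        (\<integral>r. n * (indicator {0<..<R} r * (v r * deriv \<phi> r)) \<partial>lborel)"
    proof (intro Bochner_Integration.integral_cong refl)
      fix r
      show "radial_density n r * (v r * (deriv \<phi> r / r ^ (n - 1))) = n * (indicator {0<..<R} r * (v r * deriv \<phi> r))"
        using dK[of r] K(3) by (cases "r \<in> K") (auto simp: radial_density_def indicator_def)
    qed
    finally have lhs: "(LINT x:ball 0 R|lebesgue. \<Sum>b\<in>Basis. v (norm x) * partial (\<tau> b) b x) =
        c * (n * (LINT x:{0<..<R}|lebesgue. v x * deriv \<phi> x))"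
      by (simp add: set_integral_lebesgue_eq_lborel)
    define W where "W r = \<zeta> r * r" for r
    have Wm[measurable]: "W \<in> borel_measurable borel"
      unfolding W_def using smooth_borel_measurable[OF s\<zeta>] by measurable
    have \<tau>W: "(\<Sum>b\<in>Basis. Du x \<bullet> b * \<tau> b x) = W (norm x) * (Du x \<bullet> sgn x)" for x
    proof -
      have "(\<Sum>b\<in>Basis. Du x \<bullet> b * \<tau> b x) = \<zeta> (norm x) * (Du x \<bullet> x)"
        unfolding euclidean_inner[of "Du x" x] by (simp add: \<tau>_def sum_distrib_left mult_ac)
      also have "Du x \<bullet> x = norm x * (Du x \<bullet> sgn x)"
        by (metis inner_scaleR_right norm_scaleR_sgn)
      finally show ?thesis by (simp add: W_def mult_ac)
    qed
    have WK: "W r = 0" if "r \<notin> K" for r using K(4)[OF that] by (simp add: W_def \<zeta>_def)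
    have iW: "integrable lborel (\<lambda>x. W (norm x) * (Du x \<bullet> sgn x))"
    proof -
      have "set_integrable lebesgue (ball 0 R) (\<lambda>x. \<Sum>b\<in>Basis. Du x \<bullet> b * \<tau> b x)"
        unfolding set_integrable_def scaleR_sum_right
        by (intro Bochner_Integration.integrable_sum)
          (fold set_integrable_def, intro set_integrable_mult_compact_support[OF Dint sub] smooth_continuous s\<tau> \<tau>0)
      then have "integrable lborel (\<lambda>x. indicator (ball 0 R) x * (W (norm x) * (Du x \<bullet> sgn x)))"
        unfolding \<tau>W by (subst (asm) set_integral_lebesgue_eq_lborel(2)) measurable
      moreover have "indicator (ball 0 R) x * (W (norm x) * (Du x \<bullet> sgn x)) = W (norm x) * (Du x \<bullet> sgn x)" for x
        using WK[of "norm x"] wR[of x] by (auto simp: indicator_def)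
      ultimately show ?thesis by simp
    qed
    have "(LINT x:ball 0 R|lebesgue. \<Sum>b\<in>Basis. Du x \<bullet> b * \<tau> b x) = (\<integral>x. W (norm x) * (Du x \<bullet> sgn x) \<partial>lborel)"
      unfolding \<tau>W
    proof (subst set_integral_lebesgue_eq_lborel(1))
      show "(\<integral>x. indicator (ball 0 R) x * (W (norm x) * (Du x \<bullet> sgn x)) \<partial>lborel) =
          (\<integral>x. W (norm x) * (Du x \<bullet> sgn x) \<partial>lborel)"
        using WK wR by (intro Bochner_Integration.integral_cong refl) (auto simp: indicator_def)
    qed measurable
    also have "\<dots> = c * (\<integral>r. radial_density n r * (W r * radial_derivative Du r) \<partial>lborel)"
      unfolding c_def n_def by (rule integral_polar_radial_derivative(1)[OF Dm Wm iW])
    also have "(\<integral>r. radial_density n r * (W r * radial_derivative Du r) \<partial>lborel) =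
        (\<integral>r. n * (indicator {0<..<R} r * (radial_derivative Du r * \<phi> r)) \<partial>lborel)"
    proof (intro Bochner_Integration.integral_cong refl)
      fix r
      show "radial_density n r * (W r * radial_derivative Du r) =
          n * (indicator {0<..<R} r * (radial_derivative Du r * \<phi> r))"
      proof (cases "r \<in> K")
        case True
        then have r: "0 < r" "r < R" using K(3) by auto
        have "r ^ (n - 1) * W r = \<phi> r"
          using r power_minus_mult[of n r] n by (simp add: W_def \<zeta>_def field_simps)
        then show ?thesis using r by (simp add: radial_density_def mult_ac)
      qed (use WK K(4) in simp)
    qed
    finally have "(LINT x:ball 0 R|lebesgue. \<Sum>b\<in>Basis. Du x \<bullet> b * \<tau> b x) =
        c * (n * (LINT x:{0<..<R}|lebesgue. radial_derivative Du x * \<phi> x))"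
      by (simp add: set_integral_lebesgue_eq_lborel)
    \<comment> \<open>Both sides carry the same constant: c from the sphere and n from the
      density.\<close>
    with w lhs have "(c * n) * (LINT x:{0<..<R}|lebesgue. v x * deriv \<phi> x) =
        (c * n) * - (LINT x:{0<..<R}|lebesgue. radial_derivative Du x * \<phi> x)" by simp
    moreover have "c * n \<noteq> 0" using c n by simp
    ultimately have "(LINT x:{0<..<R}|lebesgue. v x * deriv \<phi> x) =
        - (LINT x:{0<..<R}|lebesgue. radial_derivative Du x * \<phi> x)"
      by (simp only: mult_cancel_left simp_thms)
    then show ?thesis by (simp add: b fun_cong[OF partial_one_eq_deriv[OF K(1)]])
  qed
qed

section \<open>Supersolutions\<close>

lemma powr_eq_power:
  assumes "n \<ge> 1" and "r > 0" shows "r powr (real n - 1) = r ^ (n - 1)"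
  using powr_realpow[OF assms(2), of "n - 1"] assms(1) by (simp add: of_nat_diff)

lemma integrable_radial_measure_power:
  fixes g :: "real \<Rightarrow> real"
  assumes n: "n \<ge> 1" and [measurable]: "g \<in> borel_measurable borel"
  shows "set_integrable lebesgue {0<..<\<rho>} (\<lambda>r. g r * r powr (real n - 1)) \<longleftrightarrow>
    integrable (radial_measure n) (\<lambda>r. indicator {..<\<rho>} r * g r)"
proof -
  have [measurable]: "{..<\<rho>} \<in> sets borel" by simp
  have "set_integrable lebesgue {0<..<\<rho>} (\<lambda>r. g r * r powr (real n - 1)) \<longleftrightarrow>
      integrable lborel (\<lambda>r. indicator {0<..<\<rho>} r * (g r * r powr (real n - 1)))"
    by (rule set_integral_lebesgue_eq_lborel(2)) measurable
  also have "\<dots> \<longleftrightarrow> integrable lborel (\<lambda>r. n * (indicator {0<..<\<rho>} r * (g r * r powr (real n - 1))))"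
    using n by simp
  also have "(\<lambda>r. n * (indicator {0<..<\<rho>} r * (g r * r powr (real n - 1)))) =
      (\<lambda>r. radial_density n r * (indicator {..<\<rho>} r * g r))"
    using powr_eq_power[OF n] by (auto simp: fun_eq_iff radial_density_def indicator_def)
  also have "integrable lborel \<dots> \<longleftrightarrow> integrable (radial_measure n) (\<lambda>r. indicator {..<\<rho>} r * g r)"
    by (subst integral_radial_measure(2)) measurable
  finally show ?thesis .
qed

text \<open>One statement for the function v |x| and the field v' |x| sgn x. The condition excludes
  x = 0, since \<open>sgn 0 = 0\<close> makes the field vanish there whatever v' 0 is.\<close>

lemma Lq_space_radial_iff:
  fixes W :: "real \<Rightarrow> real" and G :: "'a::euclidean_space \<Rightarrow> 'b::euclidean_space"
  assumes Wm[measurable]: "W \<in> borel_measurable borel" and Gm[measurable]: "G \<in> borel_measurable borel"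
    and norm: "\<And>x. x \<noteq> 0 \<Longrightarrow> norm (G x) = \<bar>W (norm x)\<bar>"
  shows "W \<in> Lq_space (\<lambda>r. r powr (real DIM('a) - 1)) q {0<..<\<rho>} \<longleftrightarrow> G \<in> Lq_space (\<lambda>_. 1) q (ball 0 \<rho>)"
proof -
  have [measurable]: "{..<\<rho>} \<in> sets borel" by simp
  have cm[measurable]: "indicat_real (ball (0::'a) \<rho>) \<in> borel_measurable borel"
    by (simp add: borel_measurable_indicator)
  have "set_integrable lebesgue {0<..<\<rho>} (\<lambda>r. \<bar>W r\<bar> powr q * r powr (real DIM('a) - 1)) \<longleftrightarrow>
      integrable (radial_measure DIM('a)) (\<lambda>r. indicator {..<\<rho>} r * \<bar>W r\<bar> powr q)"
    by (rule integrable_radial_measure_power) (auto simp: Suc_le_eq)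
  also have "\<dots> \<longleftrightarrow> integrable lborel (\<lambda>x. (\<lambda>r. indicator {..<\<rho>} r * \<bar>W r\<bar> powr q) (norm (x::'a)))"
    by (rule integral_norm_compose(1)[symmetric]) measurable
  also have "\<dots> \<longleftrightarrow> integrable lborel (\<lambda>x. indicator (ball 0 \<rho>) x * (norm (G x) powr q * 1))"
  proof (rule integrable_cong_AE)
    show "AE x in lborel. (\<lambda>r. indicator {..<\<rho>} r * \<bar>W r\<bar> powr q) (norm (x::'a)) =
        indicator (ball 0 \<rho>) x * (norm (G x) powr q * 1)"
      using AE_lborel_singleton[of "0::'a"] by eventually_elim (use norm in \<open>simp add: indicator_def\<close>)
  qed measurable
  also have "\<dots> \<longleftrightarrow> set_integrable lebesgue (ball 0 \<rho>) (\<lambda>x. norm (G x) powr q * 1)"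
    by (rule set_integral_lebesgue_eq_lborel(2)[symmetric]) measurable
  finally show ?thesis
    unfolding Lq_space_def by (simp add: set_borel_measurable_lebesgueI)
qed

lemma Lq_space_subset:
  fixes g :: "'a::euclidean_space \<Rightarrow> 'b::euclidean_space"
  assumes "g \<in> Lq_space \<rho> q U" and "V \<subseteq> U" and "V \<in> sets lebesgue"
  shows "g \<in> Lq_space \<rho> q V"
proof -
  have "(\<lambda>x. indicator V x *\<^sub>R (indicator U x *\<^sub>R g x)) \<in> borel_measurable lebesgue"
    using assms(1,3) unfolding Lq_space_def set_borel_measurable_def
    by (elim CollectE conjE) (rule borel_measurable_scaleR[OF borel_measurable_indicator])
  also have "(\<lambda>x. indicator V x *\<^sub>R (indicator U x *\<^sub>R g x)) = (\<lambda>x. indicator V x *\<^sub>R g x)"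
    using assms(2) by (auto simp: fun_eq_iff indicator_def)
  finally show ?thesis
    using assms set_integrable_subset[of lebesgue U _ V] unfolding Lq_space_def set_borel_measurable_def by auto
qed

text \<open>An elementary replacement for Hoelder's inequality: where the measure is finite, a
  function bounded by 1 + |w|^q is integrable once |w|^q is.\<close>

lemma abs_le_1_plus_powr:
  fixes w :: real assumes "q \<ge> 1" shows "\<bar>w\<bar> \<le> 1 + \<bar>w\<bar> powr q"
proof (cases "\<bar>w\<bar> \<le> 1")
  case False
  then have "\<bar>w\<bar> powr 1 \<le> \<bar>w\<bar> powr q" using assms by (intro powr_mono) auto
  then show ?thesis by simp
qed (simp add: add_increasing2)

text \<open>The flux has size |w|^(q-1), which is at most 1 or at most |w|^q according to whether
  |w| <= 1.\<close>

lemma abs_powr_minus_1_le: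
  fixes w :: real assumes "q > 1" shows "\<bar>\<bar>w\<bar> powr (q - 2) * w\<bar> \<le> 1 + \<bar>w\<bar> powr q"
proof (cases "w = 0")
  case False
  have "\<bar>\<bar>w\<bar> powr (q - 2) * w\<bar> = \<bar>w\<bar> powr (q - 2) * \<bar>w\<bar> powr 1"
    by (simp add: abs_mult)
  also have "\<dots> = \<bar>w\<bar> powr (q - 1)" unfolding powr_add[symmetric] by simp
  also have "\<dots> \<le> 1 + \<bar>w\<bar> powr q"
  proof (cases "\<bar>w\<bar> \<le> 1")
    case True
    then have "\<bar>w\<bar> powr (q - 1) \<le> 1" using assms by (intro powr_le1) auto
    then show ?thesis by (simp add: add_increasing2)
  next
    case False
    then have "\<bar>w\<bar> powr (q - 1) \<le> \<bar>w\<bar> powr q" by (intro powr_mono) auto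
    then show ?thesis by simp
  qed
  finally show ?thesis .
qed simp

text \<open>Used with h = W for v and v' and with h the flux of v'. Up to the radius \<rho> the
  radial measure is finite, so the constant 1 in the bound is integrable.\<close>

lemma Lq_space_imp_integrable:
  fixes W h :: "real \<Rightarrow> real"
  assumes n: "n \<ge> 1" and [measurable]: "W \<in> borel_measurable borel" "h \<in> borel_measurable borel"
    and W: "W \<in> Lq_space (\<lambda>r. r powr (real n - 1)) q {0<..<R'}" and \<rho>: "\<rho> < R'"
    and h: "\<And>r. \<bar>h r\<bar> \<le> 1 + \<bar>W r\<bar> powr q"
  shows "integrable (radial_measure n) (\<lambda>r. indicator {..\<rho>} r * h r)"
proof (rule Bochner_Integration.integrable_bound)
  have [measurable]: "{..\<rho>} \<in> sets borel" by simp
  have "integrable (radial_measure n) (\<lambda>r. indicator {..<R'} r * \<bar>W r\<bar> powr q)"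
    using W by (subst integrable_radial_measure_power[OF n, symmetric]) (auto simp: Lq_space_def)
  moreover have "integrable (radial_measure n) (\<lambda>r. indicator {..\<rho>} r * (1::real))"
    by (rule integrable_radial_measure_bounded[OF n, where B=1 and W="\<lambda>_. 1"]) auto
  ultimately show "integrable (radial_measure n) (\<lambda>r. indicator {..\<rho>} r * 1 + indicator {..<R'} r * \<bar>W r\<bar> powr q)"
    by (rule Bochner_Integration.integrable_add[rotated])
  show "(\<lambda>r. indicator {..\<rho>} r * h r) \<in> borel_measurable (radial_measure n)" by measurable
  show "AE r in radial_measure n. norm (indicator {..\<rho>} r * h r) \<le>
      norm (indicator {..\<rho>} r * 1 + indicator {..<R'} r * \<bar>W r\<bar> powr q)"
  proof (rule AE_I2)
    fix r
    show "norm (indicator {..\<rho>} r * h r) \<le> norm (indicator {..\<rho>} r * 1 + indicator {..<R'} r * \<bar>W r\<bar> powr q)"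
      using h[of r] \<rho> by (auto simp: indicator_def)
  qed
qed

section \<open>The two energy integrals in Borel form\<close>

text \<open>The factor n matches the normalisation of \<open>radial_density\<close>. F stands for a
  Borel function on the line that agrees with f on [0, R), as f may be arbitrary elsewhere.\<close>

lemma radial_energy:
  fixes v' \<phi> \<phi>' f F :: "real \<Rightarrow> real"
  assumes n: "n \<ge> 1" and [measurable]: "v' \<in> borel_measurable borel" "\<phi> \<in> borel_measurable borel"
      "\<phi>' \<in> borel_measurable borel" "F \<in> borel_measurable borel"
    and F: "\<And>r. r \<in> {0..<R} \<Longrightarrow> F r = f r"
    and \<phi>: "\<And>r. r \<ge> R \<Longrightarrow> \<phi> r = 0" "\<And>r. r \<ge> R \<Longrightarrow> \<phi>' r = 0"
  shows "n * (LINT r:{0<..<R}|lebesgue. \<kappa> * \<bar>v' r\<bar> powr (q - 2) * v' r * \<phi>' r * r powr (real n - 1)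
      - \<phi> r * f r * r powr (real n - 1)) =
    (\<integral>r. radial_density n r * (\<kappa> * ((\<bar>v' r\<bar> powr (q - 2) * v' r) * \<phi>' r) - F r * \<phi> r) \<partial>lborel)"
proof -
  define g where "g r = (\<kappa> * ((\<bar>v' r\<bar> powr (q - 2) * v' r) * \<phi>' r) - F r * \<phi> r) * r powr (real n - 1)" for r
  have [measurable]: "g \<in> borel_measurable borel" unfolding g_def by measurable
  have "(LINT r:{0<..<R}|lebesgue. \<kappa> * \<bar>v' r\<bar> powr (q - 2) * v' r * \<phi>' r * r powr (real n - 1)
      - \<phi> r * f r * r powr (real n - 1)) = (LINT r:{0<..<R}|lebesgue. g r)"
    unfolding set_lebesgue_integral_def
    by (intro Bochner_Integration.integral_cong refl) (auto simp: g_def F indicator_def algebra_simps)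
  also have "\<dots> = (\<integral>r. indicator {0<..<R} r * g r \<partial>lborel)"
    by (rule set_integral_lebesgue_eq_lborel(1)) measurable
  finally have "n * (LINT r:{0<..<R}|lebesgue. \<kappa> * \<bar>v' r\<bar> powr (q - 2) * v' r * \<phi>' r * r powr (real n - 1)
      - \<phi> r * f r * r powr (real n - 1)) = (\<integral>r. n * (indicator {0<..<R} r * g r) \<partial>lborel)" by simp
  also have "\<dots> = (\<integral>r. radial_density n r * (\<kappa> * ((\<bar>v' r\<bar> powr (q - 2) * v' r) * \<phi>' r) - F r * \<phi> r) \<partial>lborel)"
  proof (intro Bochner_Integration.integral_cong refl)
    fix r
    show "n * (indicator {0<..<R} r * g r) =
        radial_density n r * (\<kappa> * ((\<bar>v' r\<bar> powr (q - 2) * v' r) * \<phi>' r) - F r * \<phi> r)"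
      using powr_eq_power[OF n, of r] \<phi>[of r]
      by (cases "r < R") (auto simp: radial_density_def g_def indicator_def)
  qed
  finally show ?thesis .
qed

text \<open>Away from the origin |Du| = |v'|, so the flux is |v'|^(q-2) v' sgn x; at the origin both
  sides lose their gradient term because \<open>sgn 0 = 0\<close>.\<close>

lemma ball_energy:
  fixes v' f F :: "real \<Rightarrow> real" and \<phi> :: "'a::euclidean_space \<Rightarrow> real"
  assumes [measurable]: "v' \<in> borel_measurable borel" "F \<in> borel_measurable borel"
    and F: "\<And>r. r \<in> {0..<R} \<Longrightarrow> F r = f r"
    and \<phi>: "smooth \<phi>" and \<phi>0: "\<And>x. norm x \<ge> R \<Longrightarrow> \<phi> x = 0" "\<And>x. norm x \<ge> R \<Longrightarrow> grad \<phi> x = 0"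
  shows "(LINT x:ball 0 R|lebesgue. norm (v' (norm x) *\<^sub>R sgn x) powr (q - 2) * ((v' (norm x) *\<^sub>R sgn x) \<bullet> grad \<phi> x)
      - \<phi> x * (f (norm x) / \<kappa>)) =
    (\<integral>x. (\<bar>v' (norm x)\<bar> powr (q - 2) * v' (norm x)) * (grad \<phi> x \<bullet> sgn x) - F (norm x) * \<phi> x / \<kappa> \<partial>lborel)"
proof -
  note [measurable] = smooth_borel_measurable[OF \<phi>] grad_borel_measurable[OF \<phi>]
  let ?g = "\<lambda>x. (\<bar>v' (norm x)\<bar> powr (q - 2) * v' (norm x)) * (grad \<phi> x \<bullet> sgn x) - F (norm x) * \<phi> x / \<kappa>"
  have "(LINT x:ball 0 R|lebesgue. norm (v' (norm x) *\<^sub>R sgn x) powr (q - 2) * ((v' (norm x) *\<^sub>R sgn x) \<bullet> grad \<phi> x)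
      - \<phi> x * (f (norm x) / \<kappa>)) = (LINT x:ball 0 R|lebesgue. ?g x)"
    unfolding set_lebesgue_integral_def
  proof (intro Bochner_Integration.integral_cong refl)
    fix x :: 'a
    show "indicator (ball 0 R) x *\<^sub>R (norm (v' (norm x) *\<^sub>R sgn x) powr (q - 2) * ((v' (norm x) *\<^sub>R sgn x) \<bullet> grad \<phi> x)
      - \<phi> x * (f (norm x) / \<kappa>)) = indicator (ball 0 R) x *\<^sub>R ?g x"
      using F[of "norm x"] by (cases "x = 0") (auto simp: indicator_def norm_sgn inner_commute)
  qed
  also have "\<dots> = integral\<^sup>L lborel ?g"
  proof (rule set_integral_lebesgue_eq_lborel_support)
    show "?g x = 0" if "x \<notin> ball 0 R" for x using \<phi>0[of x] that by simp
    show "?g \<in> borel_measurable borel" by measurable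
  qed simp
  finally show ?thesis .
qed

text \<open>Extension by zero. Since f may blow up at R, a bound is available only up to each \<rho>
  < R, which is enough for compactly supported test functions.\<close>

lemma continuous_on_Borel_extension:
  fixes f :: "real \<Rightarrow> real"
  assumes "continuous_on {0..<R} f"
  obtains F where "F \<in> borel_measurable borel" and "\<And>r. r \<in> {0..<R} \<Longrightarrow> F r = f r"
    and "\<And>\<rho>. \<rho> < R \<Longrightarrow> \<exists>B. \<forall>r. r \<le> \<rho> \<longrightarrow> \<bar>F r\<bar> \<le> B"
proof (rule that[of "\<lambda>r. indicator {0..<R} r *\<^sub>R f r"])
  show "(\<lambda>r. indicator {0..<R} r *\<^sub>R f r) \<in> borel_measurable borel"
    using assms by (intro borel_measurable_continuous_on_indicator) auto
  fix \<rho> assume "\<rho> < R"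
  then have "bounded (f ` {0..\<rho>})"
    using assms by (intro compact_imp_bounded compact_continuous_image) (auto elim: continuous_on_subset)
  then obtain B where B: "B > 0" "\<And>r. r \<in> {0..\<rho>} \<Longrightarrow> \<bar>f r\<bar> \<le> B" unfolding bounded_pos by auto
  then have "\<forall>r. r \<le> \<rho> \<longrightarrow> \<bar>indicator {0..<R} r *\<^sub>R f r\<bar> \<le> B"
    by (auto simp: indicator_def)
  then show "\<exists>B. \<forall>r. r \<le> \<rho> \<longrightarrow> \<bar>indicator {0..<R} r *\<^sub>R f r\<bar> \<le> B" by blast
qed simp

section \<open>The two implications for Borel functions\<close>

text \<open>For a test function \<phi> on the ball with spherical integral \<Phi>, \<kappa> times
  the energy on the ball equals n times the radial energy of \<Phi>. This is an identity, so the
  sign carries over at once.\<close>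

lemma qLaplace_of_radial_Borel:
  fixes v f :: "real \<Rightarrow> real" and q R \<kappa> :: real
  assumes q: "q > 1" and R: "R > 0" and \<kappa>: "\<kappa> > 0" and f: "continuous_on {0..<R} f"
    and vm[measurable]: "v \<in> borel_measurable borel"
    and rad: "radial_weak_supersolution \<kappa> q (real DIM('a)) R f v"
  shows "qLaplace_weak_supersolution q R (\<lambda>r. f r / \<kappa>) (\<lambda>x::'a::euclidean_space. v (norm x))"
proof -
  define n where "n = DIM('a)"
  have n: "n \<ge> 1" by (simp add: n_def Suc_le_eq)
  let ?\<rho> = "\<lambda>r. r powr (real DIM('a) - 1)"
  have W: "v \<in> W1q_space ?\<rho> q {0<..<R'}" if "R' \<in> {0<..<R}" for R'
    using rad that unfolding radial_weak_supersolution_def by blast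
  obtain v1 where v1: "has_weak_gradient {0<..<R} v v1"
    and E1: "\<forall>\<phi>\<in>test_functions {-R<..<R}. (\<forall>r. \<phi> r \<ge> 0) \<longrightarrow>
      (LINT r:{0<..<R}|lebesgue. \<kappa> * \<bar>v1 r\<bar> powr (q - 2) * v1 r * deriv \<phi> r * ?\<rho> r - \<phi> r * f r * ?\<rho> r) \<ge> 0"
    using rad unfolding radial_weak_supersolution_def by (elim conjE exE)
  have "locally_integrable {0<..<R} v1" using v1 unfolding has_weak_gradient_def by blast
  then obtain v' where v'm[measurable]: "v' \<in> borel_measurable borel"
    and ae: "AE r in lebesgue. r \<in> {0<..<R} \<longrightarrow> v1 r = v' r"
    by (rule locally_integrable_Borel_representative[OF open_greaterThanLessThan])
  have wg: "has_weak_gradient {0<..<R} v v'"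
    using has_weak_gradient_cong_AE[of "{0<..<R}" v v v1 v'] ae v1 by simp
  have E: "(LINT r:{0<..<R}|lebesgue. \<kappa> * \<bar>v' r\<bar> powr (q - 2) * v' r * deriv \<phi> r * ?\<rho> r - \<phi> r * f r * ?\<rho> r) \<ge> 0"
    if "\<phi> \<in> test_functions {-R<..<R}" "\<forall>r. \<phi> r \<ge> 0" for \<phi>
  proof -
    have "(LINT r:{0<..<R}|lebesgue. \<kappa> * \<bar>v1 r\<bar> powr (q - 2) * v1 r * deriv \<phi> r * ?\<rho> r - \<phi> r * f r * ?\<rho> r) =
        (LINT r:{0<..<R}|lebesgue. \<kappa> * \<bar>v' r\<bar> powr (q - 2) * v' r * deriv \<phi> r * ?\<rho> r - \<phi> r * f r * ?\<rho> r)"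
    proof (rule set_integral_lebesgue_cong_AE(2))
      show "AE r in lebesgue. r \<in> {0<..<R} \<longrightarrow>
          \<kappa> * \<bar>v1 r\<bar> powr (q - 2) * v1 r * deriv \<phi> r * ?\<rho> r - \<phi> r * f r * ?\<rho> r =
          \<kappa> * \<bar>v' r\<bar> powr (q - 2) * v' r * deriv \<phi> r * ?\<rho> r - \<phi> r * f r * ?\<rho> r"
        using ae by eventually_elim simp
    qed
    moreover have "0 \<le> (LINT r:{0<..<R}|lebesgue. \<kappa> * \<bar>v1 r\<bar> powr (q - 2) * v1 r * deriv \<phi> r * ?\<rho> r - \<phi> r * f r * ?\<rho> r)"
      using E1 that by blast
    ultimately show ?thesis by simp
  qed
  have Lv: "v \<in> Lq_space ?\<rho> q {0<..<R'}" "v' \<in> Lq_space ?\<rho> q {0<..<R'}" if R': "R' \<in> {0<..<R}" for R'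
  proof -
    \<comment> \<open>The Sobolev condition yields some derivative on each (0, R'); by uniqueness it
      is v' up to a null set, which puts v' into the weighted space.\<close>
    obtain G where G: "v \<in> Lq_space ?\<rho> q {0<..<R'}" "has_weak_gradient {0<..<R'} v G" "G \<in> Lq_space ?\<rho> q {0<..<R'}"
      using W[OF R'] unfolding W1q_space_def by blast
    have "has_weak_gradient {0<..<R'} v v'"
      by (rule has_weak_gradient_subset[OF wg]) (use R' in auto)
    from has_weak_gradient_unique[OF _ G(2) this]
    have "AE r in lebesgue. r \<in> {0<..<R'} \<longrightarrow> G r = v' r" by simp
    from Lq_space_cong_AE[OF this] G show "v \<in> Lq_space ?\<rho> q {0<..<R'}" "v' \<in> Lq_space ?\<rho> q {0<..<R'}" by auto
  qed
  have int: "integrable (radial_measure n) (\<lambda>r. indicator {..\<rho>} r * v r)"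
      "integrable (radial_measure n) (\<lambda>r. indicator {..\<rho>} r * v' r)"
      "integrable (radial_measure n) (\<lambda>r. indicator {..\<rho>} r * (\<bar>v' r\<bar> powr (q - 2) * v' r))"
    if "0 < \<rho>" "\<rho> < R" for \<rho>
  proof -
    \<comment> \<open>The Sobolev condition is available only below R, so a radius strictly between
      \<rho> and R is inserted.\<close>
    have R': "(\<rho> + R) / 2 \<in> {0<..<R}" "\<rho> < (\<rho> + R) / 2" using that by auto
    note * = Lv[OF R'(1), folded n_def]
    show "integrable (radial_measure n) (\<lambda>r. indicator {..\<rho>} r * v r)"
      by (rule Lq_space_imp_integrable[OF n vm vm *(1) R'(2)]) (use abs_le_1_plus_powr q in auto)
    show "integrable (radial_measure n) (\<lambda>r. indicator {..\<rho>} r * v' r)"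
      by (rule Lq_space_imp_integrable[OF n v'm v'm *(2) R'(2)]) (use abs_le_1_plus_powr q in auto)
    show "integrable (radial_measure n) (\<lambda>r. indicator {..\<rho>} r * (\<bar>v' r\<bar> powr (q - 2) * v' r))"
      by (rule Lq_space_imp_integrable[OF n v'm _ *(2) R'(2) abs_powr_minus_1_le[OF q]]) measurable
  qed
  define G where "G x = v' (norm x) *\<^sub>R sgn x" for x :: 'a
  have Gm[measurable]: "G \<in> borel_measurable borel" unfolding G_def by measurable
  have wgu: "has_weak_gradient (ball 0 R) (\<lambda>x. v (norm x)) G"
    unfolding G_def by (rule has_weak_gradient_radial[OF R vm v'm wg int(1,2)[unfolded n_def]])
  have "(\<lambda>x::'a. v (norm x)) \<in> W1q_loc q (ball 0 R)"
    unfolding W1q_loc_def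
  proof (intro CollectI allI impI)
    fix V :: "'a set" assume V: "open V \<and> compact (closure V) \<and> closure V \<subseteq> ball 0 R"
    then obtain \<rho> where \<rho>: "0 < \<rho>" "\<rho> < R" "closure V \<subseteq> cball 0 \<rho>"
      using compact_subset_ballE[of "closure V" R] R by metis
    define R' where "R' = (\<rho> + R) / 2"
    have R': "R' \<in> {0<..<R}" "\<rho> < R'" using \<rho> by (auto simp: R'_def)
    have VR: "V \<subseteq> ball 0 R'" "V \<subseteq> ball 0 R" using \<rho>(3) R' closure_subset[of V] V by fastforce+
    have Vs: "V \<in> sets lebesgue" using V by simp
    have "(\<lambda>x::'a. v (norm x)) \<in> Lq_space (\<lambda>_. 1) q (ball 0 R')"
      using Lv(1)[OF R'(1)] by (subst (asm) Lq_space_radial_iff[where G="\<lambda>x::'a. v (norm x)"]) auto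
    moreover have "G \<in> Lq_space (\<lambda>_. 1) q (ball 0 R')"
      using Lv(2)[OF R'(1)] by (subst (asm) Lq_space_radial_iff[where G=G]) (auto simp: G_def norm_sgn)
    ultimately show "(\<lambda>x::'a. v (norm x)) \<in> W1q_space (\<lambda>_. 1) q V"
      unfolding W1q_space_def
      by (intro CollectI conjI exI[of _ G] has_weak_gradient_subset[OF wgu VR(2)] Lq_space_subset[OF _ VR(1) Vs])
  qed
  moreover have "(LINT x:ball 0 R|lebesgue. norm (G x) powr (q - 2) * (G x \<bullet> grad \<phi> x) - \<phi> x * (f (norm x) / \<kappa>)) \<ge> 0"
    if t: "\<phi> \<in> test_functions (ball 0 R)" and nn: "\<forall>x. \<phi> x \<ge> 0" for \<phi>
  proof -
    obtain K where K: "smooth \<phi>" "compact K" "K \<subseteq> ball 0 R" "\<And>x. x \<notin> K \<Longrightarrow> \<phi> x = 0"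
      using test_functionsE[OF t] by metis
    obtain \<rho> where \<rho>: "0 < \<rho>" "\<rho> < R" "K \<subseteq> cball 0 \<rho>" using compact_subset_ballE[OF K(2,3) R] by metis
    have K\<rho>: "x \<notin> K" if "norm x > \<rho>" for x using \<rho>(3) that by auto
    have g0: "grad \<phi> x = 0" if "x \<notin> K" for x
      using grad_eq_0_outside[of K \<phi> x] K(2) K(4) that by auto
    note [measurable] = smooth_borel_measurable[OF K(1)] grad_borel_measurable[OF K(1)]
    obtain B where B: "B > 0" "\<And>x. norm (\<phi> x) \<le> B"
      using continuous_compact_support_bounded[OF smooth_continuous[OF K(1)] K(2,4)] by blast
    obtain B' where B': "B' > 0" "\<And>x. norm (grad \<phi> x) \<le> B'"
      using continuous_compact_support_bounded[OF smooth_grad_continuous[OF K(1)] K(2) g0] by blast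
    obtain F where Fm[measurable]: "F \<in> borel_measurable borel" and F: "\<And>r. r \<in> {0..<R} \<Longrightarrow> F r = f r"
      and FB: "\<And>\<rho>. \<rho> < R \<Longrightarrow> \<exists>B. \<forall>r. r \<le> \<rho> \<longrightarrow> \<bar>F r\<bar> \<le> B"
      using continuous_on_Borel_extension[OF f] by metis
    \<comment> \<open>The spherical mean is left unnormalised: a positive factor does not affect the
      inequality, and this way the constant of the sphere never appears.\<close>
    define \<Phi> where "\<Phi> r = (\<integral>w. \<phi> (r *\<^sub>R w) \<partial>sphere_measure)" for r
    have s\<Phi>: "smooth \<Phi>"
      using smooth_sphere_integral[OF K(1,2,4), of "\<lambda>w. 1" 1] unfolding \<Phi>_def by simp
    have d\<Phi>: "deriv \<Phi> r = (\<integral>w. grad \<phi> (r *\<^sub>R w) \<bullet> w \<partial>sphere_measure)" for r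
      using DERIV_imp_deriv[OF sphere_integral_DERIV[OF K(1,2,4), of "\<lambda>w. 1" 1]] unfolding \<Phi>_def by simp
    have \<Phi>0: "\<Phi> r = 0" if "\<bar>r\<bar> > \<rho>" for r
      using sphere_integral_eq_0_outside[where g="\<lambda>w. 1" and \<phi>=\<phi>, OF _ that] K\<rho> K(4)
      unfolding \<Phi>_def by simp
    have d\<Phi>0: "deriv \<Phi> r = 0" if "r \<notin> {-\<rho>..\<rho>}" for r
      by (rule deriv_eq_0_outside[OF _ _ that]) (use \<Phi>0 in auto)
    have "\<Phi> \<in> test_functions {-R<..<R}"
      by (rule test_functionsI[OF s\<Phi> compact_Icc[of "-\<rho>" \<rho>]]) (use \<rho> \<Phi>0 in auto)
    moreover have "\<forall>r. \<Phi> r \<ge> 0" unfolding \<Phi>_def using nn by (auto intro: Bochner_Integration.integral_nonneg)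
    ultimately have pos: "(LINT r:{0<..<R}|lebesgue. \<kappa> * \<bar>v' r\<bar> powr (q - 2) * v' r * deriv \<Phi> r * ?\<rho> r - \<Phi> r * f r * ?\<rho> r) \<ge> 0"
      by (rule E)
    note [measurable] = smooth_borel_measurable[OF s\<Phi>] smooth_borel_measurable[OF smooth_deriv[OF s\<Phi>]]
    have e1: "n * (LINT r:{0<..<R}|lebesgue. \<kappa> * \<bar>v' r\<bar> powr (q - 2) * v' r * deriv \<Phi> r * ?\<rho> r - \<Phi> r * f r * ?\<rho> r) =
        (\<integral>r. radial_density n r * (\<kappa> * ((\<bar>v' r\<bar> powr (q - 2) * v' r) * deriv \<Phi> r) - F r * \<Phi> r) \<partial>lborel)"
      unfolding n_def[symmetric]
      by (rule radial_energy[OF n v'm _ _ Fm F]) (use \<Phi>0 d\<Phi>0 \<rho> in \<open>auto intro!: smooth_borel_measurable s\<Phi> smooth_deriv\<close>)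
    define h where "h r = \<bar>v' r\<bar> powr (q - 2) * v' r" for r
    have hm[measurable]: "h \<in> borel_measurable borel" unfolding h_def by measurable
    have hi: "integrable (radial_measure DIM('a)) (\<lambda>r. indicator {..\<rho>} r * h r)"
      using int(3)[OF \<rho>(1,2)] by (simp add: h_def n_def)
    have Fi: "integrable (radial_measure DIM('a)) (\<lambda>r. indicator {..\<rho>} r * F r)"
    proof -
      obtain C where "\<And>r. r \<le> \<rho> \<Longrightarrow> \<bar>F r\<bar> \<le> C" using FB[OF \<rho>(2)] by blast
      then show ?thesis by (intro integrable_radial_measure_bounded[where B=C]) (auto simp: Suc_le_eq)
    qed
    have Db: "norm (grad \<phi> x \<bullet> sgn x) \<le> B'" for x
    proof -
      have "\<bar>grad \<phi> x \<bullet> sgn x\<bar> \<le> norm (grad \<phi> x) * norm (sgn x)" by (rule Cauchy_Schwarz_ineq2)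
      also have "\<dots> \<le> B' * 1" using B' by (intro mult_mono) (auto simp: norm_sgn)
      finally show ?thesis by simp
    qed
    have Dm: "(\<lambda>x. grad \<phi> x \<bullet> sgn x) \<in> borel_measurable borel" by measurable
    have D0: "grad \<phi> x \<bullet> sgn x = 0" if "norm x > \<rho>" for x using g0[OF K\<rho>[OF that]] by simp
    have \<phi>0: "\<phi> x = 0" if "norm x > \<rho>" for x using K(4)[OF K\<rho>[OF that]] .
    have P1: "integrable lborel (\<lambda>x. h (norm x) * (grad \<phi> x \<bullet> sgn x))"
      "(\<integral>x. h (norm x) * (grad \<phi> x \<bullet> sgn x) \<partial>lborel) =
        (\<integral>r. radial_density DIM('a) r * (h r * (\<integral>w. grad \<phi> (r *\<^sub>R w) \<bullet> sgn (r *\<^sub>R w) \<partial>sphere_measure)) \<partial>lborel)"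
      by (rule integral_radial_product[OF hm Dm Db _ hi], rule D0, assumption)+
    have P2: "integrable lborel (\<lambda>x. F (norm x) * \<phi> x)"
      "(\<integral>x. F (norm x) * \<phi> x \<partial>lborel) =
        (\<integral>r. radial_density DIM('a) r * (F r * (\<integral>w. \<phi> (r *\<^sub>R w) \<partial>sphere_measure)) \<partial>lborel)"
      by (rule integral_radial_product[OF Fm smooth_borel_measurable[OF K(1)] B(2) _ Fi], rule \<phi>0, assumption)+
    have "(LINT x:ball 0 R|lebesgue. norm (G x) powr (q - 2) * (G x \<bullet> grad \<phi> x) - \<phi> x * (f (norm x) / \<kappa>)) =
        (\<integral>x. h (norm x) * (grad \<phi> x \<bullet> sgn x) - F (norm x) * \<phi> x / \<kappa> \<partial>lborel)"
      unfolding G_def h_def by (rule ball_energy[OF v'm Fm F K(1)]) (use \<phi>0 g0 K\<rho> \<rho>(2) in auto)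
    also have "\<dots> = (\<integral>x. h (norm x) * (grad \<phi> x \<bullet> sgn x) \<partial>lborel) - (\<integral>x. F (norm x) * \<phi> x \<partial>lborel) / \<kappa>"
      using P1(1) P2(1) by simp
    also have "(\<integral>x. h (norm x) * (grad \<phi> x \<bullet> sgn x) \<partial>lborel) = (\<integral>r. radial_density n r * (h r * deriv \<Phi> r) \<partial>lborel)"
      unfolding n_def
    proof (rule P1(2)[THEN trans], rule Bochner_Integration.integral_cong[OF refl])
      fix r
      show "radial_density DIM('a) r * (h r * (\<integral>w. grad \<phi> (r *\<^sub>R w) \<bullet> sgn (r *\<^sub>R w) \<partial>sphere_measure)) =
          radial_density DIM('a) r * (h r * deriv \<Phi> r)"
      proof (cases "0 < r")
        case True
        have "(\<integral>w. grad \<phi> (r *\<^sub>R w) \<bullet> sgn (r *\<^sub>R w) \<partial>sphere_measure) = deriv \<Phi> r"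
          unfolding d\<Phi>
        proof (rule integral_cong_AE)
          show "AE w in sphere_measure. grad \<phi> (r *\<^sub>R w) \<bullet> sgn (r *\<^sub>R w) = grad \<phi> (r *\<^sub>R w) \<bullet> w"
            using AE_sphere_norm by eventually_elim (use True in \<open>simp add: sgn_scaleR sgn_div_norm\<close>)
        qed measurable
        then show ?thesis by simp
      qed (simp add: radial_density_def)
    qed
    also have "(\<integral>x. F (norm x) * \<phi> x \<partial>lborel) = (\<integral>r. radial_density n r * (F r * \<Phi> r) \<partial>lborel)"
      unfolding n_def \<Phi>_def by (rule P2(2))
    finally have e2: "(LINT x:ball 0 R|lebesgue. norm (G x) powr (q - 2) * (G x \<bullet> grad \<phi> x) - \<phi> x * (f (norm x) / \<kappa>)) =
        (\<integral>r. radial_density n r * (h r * deriv \<Phi> r) \<partial>lborel) - (\<integral>r. radial_density n r * (F r * \<Phi> r) \<partial>lborel) / \<kappa>" .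
    obtain C where C: "\<And>r. norm (\<Phi> r) \<le> C"
      by (rule continuous_compact_support_bounded[OF smooth_continuous[OF s\<Phi>] compact_Icc[of "-\<rho>" \<rho>]])
        (use \<Phi>0 in auto)
    obtain C' where C': "\<And>r. norm (deriv \<Phi> r) \<le> C'"
      by (rule continuous_compact_support_bounded[OF smooth_continuous[OF smooth_deriv[OF s\<Phi>]] compact_Icc[of "-\<rho>" \<rho>] d\<Phi>0])
        auto
    have prod: "integrable lborel (\<lambda>r. radial_density n r * (W r * D r))"
      if [measurable]: "W \<in> borel_measurable borel" "D \<in> borel_measurable borel"
        and W: "integrable (radial_measure n) (\<lambda>r. indicator {..\<rho>} r * W r)"
        and D: "\<And>r. norm (D r) \<le> c" "\<And>r. \<bar>r\<bar> > \<rho> \<Longrightarrow> D r = 0" for W D c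
    proof -
      have "integrable (radial_measure n) (\<lambda>r. W r * D r)"
      proof (rule Bochner_Integration.integrable_bound[OF integrable_mult_right[OF W, of c]])
        show "AE r in radial_measure n. norm (W r * D r) \<le> norm (c * (indicator {..\<rho>} r * W r))"
        proof (rule AE_I2)
          fix r
          show "norm (W r * D r) \<le> norm (c * (indicator {..\<rho>} r * W r))"
          proof (cases "r \<le> \<rho>")
            case True
            have "\<bar>W r\<bar> * \<bar>D r\<bar> \<le> \<bar>W r\<bar> * \<bar>c\<bar>" using D(1)[of r] by (intro mult_left_mono) auto
            then show ?thesis using True by (simp add: abs_mult mult.commute)
          qed (use D(2)[of r] in simp)
        qed
      qed measurable
      then show ?thesis by (subst (asm) integral_radial_measure(2)) measurable
    qed
    have i1: "integrable lborel (\<lambda>r. radial_density n r * (h r * deriv \<Phi> r))"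
      by (rule prod[OF hm _ hi[folded n_def] C' d\<Phi>0]) (auto intro: smooth_borel_measurable smooth_deriv s\<Phi>)
    have i2: "integrable lborel (\<lambda>r. radial_density n r * (F r * \<Phi> r))"
      by (rule prod[OF Fm _ Fi[folded n_def] C]) (use \<Phi>0 in \<open>auto intro: smooth_borel_measurable s\<Phi>\<close>)
    have "(\<integral>r. radial_density n r * (\<kappa> * (h r * deriv \<Phi> r) - F r * \<Phi> r) \<partial>lborel) =
        (\<integral>r. \<kappa> * (radial_density n r * (h r * deriv \<Phi> r)) - radial_density n r * (F r * \<Phi> r) \<partial>lborel)"
      by (simp add: algebra_simps)
    also have "\<dots> = \<kappa> * (\<integral>r. radial_density n r * (h r * deriv \<Phi> r) \<partial>lborel) - (\<integral>r. radial_density n r * (F r * \<Phi> r) \<partial>lborel)"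
      using i1 i2 by simp
    finally have "\<kappa> * (LINT x:ball 0 R|lebesgue. norm (G x) powr (q - 2) * (G x \<bullet> grad \<phi> x) - \<phi> x * (f (norm x) / \<kappa>)) =
        n * (LINT r:{0<..<R}|lebesgue. \<kappa> * \<bar>v' r\<bar> powr (q - 2) * v' r * deriv \<Phi> r * ?\<rho> r - \<Phi> r * f r * ?\<rho> r)"
      unfolding e1 e2 h_def using \<kappa> by (simp add: right_diff_distrib)
    then have "0 \<le> \<kappa> * (LINT x:ball 0 R|lebesgue. norm (G x) powr (q - 2) * (G x \<bullet> grad \<phi> x) - \<phi> x * (f (norm x) / \<kappa>))"
      using pos by simp
    then show ?thesis using \<kappa> by (simp only: zero_le_mult_iff) linarith
  qed
  ultimately show ?thesis
    unfolding qLaplace_weak_supersolution_def using wgu by blast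
qed

lemma sqrt_has_derivative:
  fixes x :: "'a::euclidean_space"
  assumes "c > 0"
  shows "((\<lambda>x. sqrt (x \<bullet> x + c)) has_derivative (\<lambda>h. (x \<bullet> h) / sqrt (x \<bullet> x + c))) (at x)"
proof -
  have pos: "x \<bullet> x + c > 0" using assms by (smt (verit) inner_ge_zero)
  have "((\<lambda>x. x \<bullet> x + c) has_derivative (\<lambda>h. 2 * (x \<bullet> h))) (at x)"
    by (auto intro!: derivative_eq_intros simp: inner_commute)
  from DERIV_compose_FDERIV[where f=sqrt and g="\<lambda>x. x \<bullet> x + c", OF DERIV_real_sqrt[OF pos] this]
  show ?thesis by (simp add: field_simps)
qed

text \<open>Unless \<open>\<phi>\<close> is even, \<open>\<phi> |x|\<close> is not smooth at the origin; it is approximated by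
  \<open>\<phi> (sqrt (|x|\<^sup>2 + \<epsilon>))\<close>.\<close>

lemma radial_of_qLaplace_Borel:
  fixes v f :: "real \<Rightarrow> real" and q R \<kappa> :: real
  assumes q: "q > 1" and R: "R > 0" and \<kappa>: "\<kappa> > 0" and f: "continuous_on {0..<R} f"
    and vm[measurable]: "v \<in> borel_measurable borel"
    and qL: "qLaplace_weak_supersolution q R (\<lambda>r. f r / \<kappa>) (\<lambda>x::'a::euclidean_space. v (norm x))"
  shows "radial_weak_supersolution \<kappa> q (real DIM('a)) R f v"
proof -
  define n where "n = DIM('a)"
  have n: "n \<ge> 1" by (simp add: n_def Suc_le_eq)
  let ?\<rho> = "\<lambda>r. r powr (real DIM('a) - 1)"
  have W: "(\<lambda>x::'a. v (norm x)) \<in> W1q_loc q (ball 0 R)"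
    using qL unfolding qLaplace_weak_supersolution_def by blast
  obtain D1 where D1: "has_weak_gradient (ball 0 R) (\<lambda>x::'a. v (norm x)) D1"
    and E1: "\<forall>\<phi>\<in>test_functions (ball 0 R). (\<forall>x. \<phi> x \<ge> 0) \<longrightarrow>
      (LINT x:ball 0 R|lebesgue. norm (D1 x) powr (q - 2) * (D1 x \<bullet> grad \<phi> x) - \<phi> x * (f (norm x) / \<kappa>)) \<ge> 0"
    using qL unfolding qLaplace_weak_supersolution_def by (elim conjE exE)
  have "locally_integrable (ball 0 R) D1" using D1 unfolding has_weak_gradient_def by blast
  then obtain Du where Dm[measurable]: "Du \<in> borel_measurable borel"
    and aeD: "AE x in lebesgue. x \<in> ball 0 R \<longrightarrow> D1 x = Du x"
    by (rule locally_integrable_Borel_representative[OF open_ball])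
  have wgD: "has_weak_gradient (ball 0 R) (\<lambda>x::'a. v (norm x)) Du"
    using has_weak_gradient_cong_AE[of "ball 0 R" "\<lambda>x::'a. v (norm x)" "\<lambda>x. v (norm x)" D1 Du] aeD D1 by simp
  define v' where "v' = radial_derivative Du"
  have v'm[measurable]: "v' \<in> borel_measurable borel"
    unfolding v'_def by (rule radial_derivative_measurable[OF Dm])
  have wg: "has_weak_gradient {0<..<R} v v'"
    unfolding v'_def by (rule has_weak_gradient_of_radial[OF vm Dm wgD])
  define G where "G x = v' (norm x) *\<^sub>R sgn x" for x :: 'a
  have Gm[measurable]: "G \<in> borel_measurable borel" unfolding G_def by measurable
  have wgu: "has_weak_gradient (ball 0 R) (\<lambda>x. v (norm x)) G"
    unfolding G_def using radial_function_integrable[OF vm Dm wgD]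
    by (intro has_weak_gradient_radial[OF R vm v'm wg]) (auto simp: v'_def)
  \<comment> \<open>Uniqueness makes the given gradient radial almost everywhere; only now may the
    nonlinear flux of D1 be rewritten in terms of v'.\<close>
  have aeG: "AE x in lebesgue. x \<in> ball 0 R \<longrightarrow> D1 x = G x"
    using has_weak_gradient_unique[OF _ D1 wgu] by simp
  have Lv: "v \<in> Lq_space ?\<rho> q {0<..<R'}" "v' \<in> Lq_space ?\<rho> q {0<..<R'}" if R': "R' \<in> {0<..<R}" for R'
  proof -
    have cl: "closure (ball (0::'a) R') = cball 0 R'" using R' by simp
    have "(\<lambda>x::'a. v (norm x)) \<in> W1q_space (\<lambda>_. 1) q (ball 0 R')"
    proof -
      have "open (ball (0::'a) R')" "compact (closure (ball (0::'a) R'))" "closure (ball (0::'a) R') \<subseteq> ball 0 R"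
        unfolding cl using R' by auto
      then show ?thesis using W unfolding W1q_loc_def by blast
    qed
    then obtain H where H: "(\<lambda>x::'a. v (norm x)) \<in> Lq_space (\<lambda>_. 1) q (ball 0 R')"
        "has_weak_gradient (ball 0 R') (\<lambda>x::'a. v (norm x)) H" "H \<in> Lq_space (\<lambda>_. 1) q (ball 0 R')"
      unfolding W1q_space_def by blast
    have "has_weak_gradient (ball 0 R') (\<lambda>x::'a. v (norm x)) G"
      by (rule has_weak_gradient_subset[OF wgu]) (use R' in auto)
    from has_weak_gradient_unique[OF _ H(2) this]
    have "AE x in lebesgue. x \<in> ball 0 R' \<longrightarrow> H x = G x" by simp
    from Lq_space_cong_AE[OF this] H(3) have GL: "G \<in> Lq_space (\<lambda>_. 1) q (ball 0 R')" by simp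
    show "v \<in> Lq_space ?\<rho> q {0<..<R'}"
      using H(1) by (subst Lq_space_radial_iff[where G="\<lambda>x::'a. v (norm x)"]) auto
    show "v' \<in> Lq_space ?\<rho> q {0<..<R'}"
      using GL by (subst Lq_space_radial_iff[where G=G]) (auto simp: G_def norm_sgn)
  qed
  have "v \<in> W1q_space ?\<rho> q {0<..<R'}" if R': "R' \<in> {0<..<R}" for R'
  proof -
    have "has_weak_gradient {0<..<R'} v v'"
      by (rule has_weak_gradient_subset[OF wg]) (use R' in auto)
    then show ?thesis using Lv[OF R'] unfolding W1q_space_def by blast
  qed
  moreover have "(LINT r:{0<..<R}|lebesgue. \<kappa> * \<bar>v' r\<bar> powr (q - 2) * v' r * deriv \<phi> r * ?\<rho> r - \<phi> r * f r * ?\<rho> r) \<ge> 0"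
    if t: "\<phi> \<in> test_functions {-R<..<R}" and nn: "\<forall>r. \<phi> r \<ge> 0" for \<phi>
  proof -
    obtain K where K: "smooth \<phi>" "compact K" "K \<subseteq> {-R<..<R}" "\<And>x. x \<notin> K \<Longrightarrow> \<phi> x = 0"
      using test_functionsE[OF t] by metis
    have "K \<subseteq> ball 0 R" using K(3) by (force simp: dist_real_def)
    then obtain \<rho> where \<rho>: "0 < \<rho>" "\<rho> < R" "K \<subseteq> cball 0 \<rho>" using compact_subset_ballE[OF K(2) _ R] by metis
    have \<phi>0: "\<phi> r = 0" if "\<bar>r\<bar> > \<rho>" for r
      by (rule K(4)) (use \<rho>(3) that in auto)
    have d\<phi>0: "deriv \<phi> r = 0" if "\<bar>r\<bar> > \<rho>" for r
      by (rule deriv_eq_0_outside[of "cball 0 \<rho>"]) (use \<phi>0 that in auto)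
    note [measurable] = smooth_borel_measurable[OF K(1)] smooth_borel_measurable[OF smooth_deriv[OF K(1)]]
    obtain B where B: "B > 0" "\<And>x. norm (\<phi> x) \<le> B"
      using continuous_compact_support_bounded[OF smooth_continuous[OF K(1)] K(2,4)] by blast
    have "deriv \<phi> x = 0" if "x \<notin> K" for x
      using deriv_eq_0_outside[of K \<phi> x] compact_imp_closed[OF K(2)] K(4) that by auto
    then obtain B' where B': "B' > 0" "\<And>x. norm (deriv \<phi> x) \<le> B'"
      using continuous_compact_support_bounded[OF smooth_continuous[OF smooth_deriv[OF K(1)]] K(2)] by blast
    obtain F where Fm[measurable]: "F \<in> borel_measurable borel" and F: "\<And>r. r \<in> {0..<R} \<Longrightarrow> F r = f r"
      and FB: "\<And>\<rho>. \<rho> < R \<Longrightarrow> \<exists>B. \<forall>r. r \<le> \<rho> \<longrightarrow> \<bar>F r\<bar> \<le> B"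
      using continuous_on_Borel_extension[OF f] by metis
    define h where "h r = \<bar>v' r\<bar> powr (q - 2) * v' r" for r
    have hm[measurable]: "h \<in> borel_measurable borel" unfolding h_def by measurable
    define s where "s k x = sqrt (x \<bullet> x + inverse (real (Suc k)))" for k and x :: 'a
    have c: "inverse (real (Suc k)) > 0" for k by simp
    \<comment> \<open>This keeps the approximations zero for norm x > \<rho>, and norm x / s k x <=
      1 bounds their gradients uniformly in k.\<close>
    have s_ge: "norm x \<le> s k x" for k x
      unfolding s_def norm_eq_sqrt_inner by (intro real_sqrt_le_mono) simp
    have s_pos: "s k x > 0" for k x
      unfolding s_def using c[of k] by (smt (verit) inner_ge_zero real_sqrt_gt_zero)
    have ss: "smooth (s k)" for k
    proof -
      have "s k = (\<lambda>x. (x \<bullet> x + inverse (real (Suc k))) powr (1 / 2))"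
        using c[of k] by (auto simp: s_def fun_eq_iff powr_half_sqrt)
      then show ?thesis unfolding smooth_def by (simp only: Ck_powr_norm[OF c] simp_thms)
    qed
    have s_lim: "(\<lambda>k. s k x) \<longlonglongrightarrow> norm x" for x
    proof -
      have "(\<lambda>k. sqrt (x \<bullet> x + inverse (real (Suc k)))) \<longlonglongrightarrow> sqrt (x \<bullet> x + 0)"
        by (intro tendsto_intros LIMSEQ_inverse_real_of_nat)
      then show ?thesis by (simp add: s_def norm_eq_sqrt_inner)
    qed
    define \<phi>k where "\<phi>k k x = \<phi> (s k x)" for k and x :: 'a
    have s\<phi>k: "smooth (\<phi>k k)" for k unfolding \<phi>k_def using K(1) ss by (rule smooth_compose)
    have g\<phi>k: "grad (\<phi>k k) x = (deriv \<phi> (s k x) / s k x) *\<^sub>R x" for k x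
    proof (rule has_derivative_grad)
      have "(s k has_derivative (\<lambda>h. (x \<bullet> h) / s k x)) (at x)"
        unfolding s_def[abs_def] using sqrt_has_derivative[OF c[of k]] .
      from DERIV_compose_FDERIV[OF smooth_DERIV[OF K(1)] this]
      show "(\<phi>k k has_derivative (\<lambda>h. (deriv \<phi> (s k x) / s k x) *\<^sub>R x \<bullet> h)) (at x)"
        unfolding \<phi>k_def by (simp add: mult.commute)
    qed
    have \<phi>k0: "\<phi>k k x = 0" if "norm x > \<rho>" for k x
      unfolding \<phi>k_def using s_ge[of x k] that by (intro \<phi>0) simp
    have g\<phi>k0: "grad (\<phi>k k) x = 0" if "norm x > \<rho>" for k x
      using d\<phi>0[of "s k x"] s_ge[of x k] that by (simp add: g\<phi>k)
    note [measurable] = smooth_borel_measurable[OF s\<phi>k] grad_borel_measurable[OF s\<phi>k]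
    have Ek: "(\<integral>x. h (norm x) * (grad (\<phi>k k) x \<bullet> sgn x) - F (norm x) * \<phi>k k x / \<kappa> \<partial>lborel) \<ge> 0" for k
    proof -
      have "\<phi>k k \<in> test_functions (ball 0 R)"
        by (rule test_functionsI[OF s\<phi>k compact_cball[of 0 \<rho>]]) (use \<rho> \<phi>k0 in auto)
      moreover have "\<forall>x. \<phi>k k x \<ge> 0" using nn by (simp add: \<phi>k_def)
      ultimately have "0 \<le> (LINT x:ball 0 R|lebesgue. norm (D1 x) powr (q - 2) * (D1 x \<bullet> grad (\<phi>k k) x)
          - \<phi>k k x * (f (norm x) / \<kappa>))"
        using E1 by blast
      also have "\<dots> = (LINT x:ball 0 R|lebesgue. norm (G x) powr (q - 2) * (G x \<bullet> grad (\<phi>k k) x)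
          - \<phi>k k x * (f (norm x) / \<kappa>))"
      proof (rule set_integral_lebesgue_cong_AE(2))
        show "AE x in lebesgue. x \<in> ball 0 R \<longrightarrow>
            norm (D1 x) powr (q - 2) * (D1 x \<bullet> grad (\<phi>k k) x) - \<phi>k k x * (f (norm x) / \<kappa>) =
            norm (G x) powr (q - 2) * (G x \<bullet> grad (\<phi>k k) x) - \<phi>k k x * (f (norm x) / \<kappa>)"
          using aeG by eventually_elim simp
      qed
      also have "\<dots> = (\<integral>x. h (norm x) * (grad (\<phi>k k) x \<bullet> sgn x) - F (norm x) * \<phi>k k x / \<kappa> \<partial>lborel)"
        unfolding G_def h_def
        by (rule ball_energy[OF v'm Fm F s\<phi>k]) (use \<phi>k0 g\<phi>k0 \<rho>(2) in auto)
      finally show ?thesis .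
    qed
    have hi: "integrable (radial_measure DIM('a)) (\<lambda>r. indicator {..\<rho>} r * h r)"
    proof -
      have R': "(\<rho> + R) / 2 \<in> {0<..<R}" "\<rho> < (\<rho> + R) / 2" using \<rho> by auto
      show ?thesis
        unfolding h_def n_def[symmetric]
        by (rule Lq_space_imp_integrable[OF n v'm _ Lv(2)[OF R'(1), folded n_def] R'(2) abs_powr_minus_1_le[OF q]]) measurable
    qed
    obtain C where C: "\<And>r. r \<le> \<rho> \<Longrightarrow> \<bar>F r\<bar> \<le> C" using FB[OF \<rho>(2)] by blast
    have Fi: "integrable (radial_measure DIM('a)) (\<lambda>r. indicator {..\<rho>} r * F r)"
      using C by (intro integrable_radial_measure_bounded[where B=C]) (auto simp: Suc_le_eq)
    have [measurable]: "{..\<rho>} \<in> sets borel" by simp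
    \<comment> \<open>The constants B' and B bound \<phi>' and \<phi>; the majorant is radial and
      independent of k.\<close>
    define dom where "dom r = B' * \<bar>indicator {..\<rho>} r * h r\<bar> + B / \<kappa> * \<bar>indicator {..\<rho>} r * F r\<bar>" for r
    have domi: "integrable lborel (\<lambda>x::'a. dom (norm x))"
    proof (subst integral_norm_compose(1))
      show "dom \<in> borel_measurable borel" unfolding dom_def by measurable
      show "integrable (radial_measure DIM('a)) dom"
        unfolding dom_def by (intro Bochner_Integration.integrable_add integrable_mult_right integrable_abs hi Fi)
    qed
    have lim: "(\<lambda>k. \<integral>x. h (norm x) * (grad (\<phi>k k) x \<bullet> sgn x) - F (norm x) * \<phi>k k x / \<kappa> \<partial>lborel) \<longlonglongrightarrow>
        (\<integral>x. (\<lambda>r. h r * deriv \<phi> r - F r * \<phi> r / \<kappa>) (norm (x::'a)) \<partial>lborel)"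
    proof (rule integral_dominated_convergence[OF _ _ domi])
      show "AE x in lborel. (\<lambda>k. h (norm x) * (grad (\<phi>k k) x \<bullet> sgn x) - F (norm x) * \<phi>k k x / \<kappa>) \<longlonglongrightarrow>
          (\<lambda>r. h r * deriv \<phi> r - F r * \<phi> r / \<kappa>) (norm x)"
        using AE_lborel_singleton[of "0::'a"]
      proof eventually_elim
        case (elim x)
        have xs: "x \<bullet> sgn x = norm x"
          using elim by (simp add: sgn_div_norm power2_norm_eq_inner[symmetric] power2_eq_square)
        have l1: "(\<lambda>k. deriv \<phi> (s k x)) \<longlonglongrightarrow> deriv \<phi> (norm x)" and l2: "(\<lambda>k. \<phi> (s k x)) \<longlonglongrightarrow> \<phi> (norm x)"
          using smooth_continuous[OF smooth_deriv[OF K(1)]] smooth_continuous[OF K(1)]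
          by (auto intro!: isCont_tendsto_compose[OF _ s_lim] simp: continuous_on_eq_continuous_at)
        \<comment> \<open>The null set {0} has been excluded, so the denominators have the nonzero
          limit norm x. At the origin itself the gradients are 0, whatever \<phi>' 0 is.\<close>
        have "(\<lambda>k. h (norm x) * (deriv \<phi> (s k x) / s k x * norm x) - F (norm x) * \<phi> (s k x) / \<kappa>) \<longlonglongrightarrow>
            h (norm x) * (deriv \<phi> (norm x) / norm x * norm x) - F (norm x) * \<phi> (norm x) / \<kappa>"
          using elim \<kappa> by (intro tendsto_intros l1 l2 s_lim) auto
        then show ?case using elim by (simp add: g\<phi>k \<phi>k_def xs)
      qed
      show "AE x in lborel. norm (h (norm x) * (grad (\<phi>k k) x \<bullet> sgn x) - F (norm x) * \<phi>k k x / \<kappa>) \<le> dom (norm x)" for k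
      proof (rule AE_I2)
        fix x :: 'a
        show "norm (h (norm x) * (grad (\<phi>k k) x \<bullet> sgn x) - F (norm x) * \<phi>k k x / \<kappa>) \<le> dom (norm x)"
        proof (cases "norm x \<le> \<rho>")
          case True
          have "norm (grad (\<phi>k k) x) = \<bar>deriv \<phi> (s k x)\<bar> * (norm x / s k x)"
            using s_pos[of k x] by (simp add: g\<phi>k)
          also have "\<dots> \<le> B' * 1"
            using B'(1) B'(2)[of "s k x"] s_pos[of k x] s_ge[of x k] by (intro mult_mono) auto
          finally have gb: "norm (grad (\<phi>k k) x) \<le> B'" by simp
          have "\<bar>grad (\<phi>k k) x \<bullet> sgn x\<bar> \<le> norm (grad (\<phi>k k) x) * norm (sgn x)"
            by (rule Cauchy_Schwarz_ineq2)
          also have "\<dots> \<le> B' * 1" using B'(1) gb by (intro mult_mono) (auto simp: norm_sgn)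
          finally have b1: "\<bar>h (norm x)\<bar> * \<bar>grad (\<phi>k k) x \<bullet> sgn x\<bar> \<le> \<bar>h (norm x)\<bar> * B'"
            by (intro mult_left_mono) auto
          have b2: "\<bar>F (norm x)\<bar> * \<bar>\<phi>k k x\<bar> / \<kappa> \<le> \<bar>F (norm x)\<bar> * B / \<kappa>"
            using B(2)[of "s k x"] \<kappa> by (intro divide_right_mono mult_left_mono) (auto simp: \<phi>k_def)
          have "norm (h (norm x) * (grad (\<phi>k k) x \<bullet> sgn x) - F (norm x) * \<phi>k k x / \<kappa>) \<le>
              \<bar>h (norm x)\<bar> * \<bar>grad (\<phi>k k) x \<bullet> sgn x\<bar> + \<bar>F (norm x)\<bar> * \<bar>\<phi>k k x\<bar> / \<kappa>"
            using norm_triangle_ineq4[of "h (norm x) * (grad (\<phi>k k) x \<bullet> sgn x)" "F (norm x) * \<phi>k k x / \<kappa>"] \<kappa>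
            by (simp add: abs_mult)
          also have "\<dots> \<le> \<bar>h (norm x)\<bar> * B' + \<bar>F (norm x)\<bar> * B / \<kappa>" using b1 b2 by (rule add_mono)
          also have "\<dots> = dom (norm x)" using True by (simp add: dom_def abs_mult)
          finally show ?thesis .
        next
          case False
          then show ?thesis using \<phi>k0[of x k] g\<phi>k0[of x k] by (simp add: dom_def)
        qed
      qed
    qed measurable
    have "0 \<le> (\<integral>x. (\<lambda>r. h r * deriv \<phi> r - F r * \<phi> r / \<kappa>) (norm (x::'a)) \<partial>lborel)"
      by (rule LIMSEQ_le_const[OF lim]) (use Ek in blast)
    also have "\<dots> = sphere_area TYPE('a) * (\<integral>r. radial_density n r * (h r * deriv \<phi> r - F r * \<phi> r / \<kappa>) \<partial>lborel)"
      unfolding n_def by (subst integral_norm_compose(2), measurable, subst integral_radial_measure(1), measurable)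
    finally have "0 \<le> (\<integral>r. radial_density n r * (h r * deriv \<phi> r - F r * \<phi> r / \<kappa>) \<partial>lborel)"
      using sphere_area_pos[where 'a='a] by (simp add: zero_le_mult_iff)
    then have "0 \<le> \<kappa> * (\<integral>r. radial_density n r * (h r * deriv \<phi> r - F r * \<phi> r / \<kappa>) \<partial>lborel)"
      using \<kappa> by simp
    also have "\<dots> = (\<integral>r. \<kappa> * (radial_density n r * (h r * deriv \<phi> r - F r * \<phi> r / \<kappa>)) \<partial>lborel)" by simp
    also have "\<dots> = (\<integral>r. radial_density n r * (\<kappa> * (h r * deriv \<phi> r) - F r * \<phi> r) \<partial>lborel)"
      using \<kappa> by (intro Bochner_Integration.integral_cong refl) (simp add: field_simps)
    also have "\<dots> = n * (LINT r:{0<..<R}|lebesgue. \<kappa> * \<bar>v' r\<bar> powr (q - 2) * v' r * deriv \<phi> r * ?\<rho> r - \<phi> r * f r * ?\<rho> r)"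
      unfolding h_def n_def[symmetric]
      by (rule radial_energy[OF n v'm _ _ Fm F, symmetric])
        (use \<phi>0 d\<phi>0 \<rho> in \<open>auto intro!: smooth_borel_measurable K(1) smooth_deriv\<close>)
    finally show ?thesis using n by (simp add: zero_le_mult_iff)
  qed
  ultimately show ?thesis
    unfolding radial_weak_supersolution_def using wg by blast
qed

section \<open>Passing from Borel functions to arbitrary ones\<close>

lemma AE_norm_eq:
  fixes v w :: "real \<Rightarrow> real"
  assumes "AE r in lebesgue. r \<in> {0<..<R} \<longrightarrow> v r = w r"
  shows "AE x in lebesgue. x \<in> ball (0::'a::euclidean_space) R \<longrightarrow> v (norm x) = w (norm x)"
proof -
  have "AE r in lborel. 0 < r \<longrightarrow> (r < R \<longrightarrow> v r = w r)"
    using assms unfolding AE_completion_iff by eventually_elim simp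
  then have "AE x in lborel. norm (x::'a) < R \<longrightarrow> v (norm x) = w (norm x)" by (rule AE_norm_compose)
  then show ?thesis by (simp add: AE_completion_iff)
qed

text \<open>A Borel representative u of v |x| need not be radial. By polar coordinates it equals v r
  at almost every point of almost every sphere in the ball, so its spherical mean, a Borel function
  of r, agrees with v almost everywhere.\<close>

lemma radial_Borel_representative:
  fixes v :: "real \<Rightarrow> real"
  assumes "locally_integrable (ball (0::'a::euclidean_space) R) (\<lambda>x. v (norm x))"
  obtains w where "w \<in> borel_measurable borel" and "AE r in lebesgue. r \<in> {0<..<R} \<longrightarrow> v r = w r"
proof -
  obtain u where um[measurable]: "u \<in> borel_measurable borel"
    and ae: "AE x in lebesgue. x \<in> ball (0::'a) R \<longrightarrow> v (norm x) = u x"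
    by (rule locally_integrable_Borel_representative[OF open_ball assms])
  define c where "c = sphere_area TYPE('a)"
  have c: "c > 0" unfolding c_def by (rule sphere_area_pos)
  define w where "w r = (\<integral>\<omega>. u (r *\<^sub>R \<omega>) \<partial>sphere_measure) / c" for r
  have wm: "w \<in> borel_measurable borel" unfolding w_def by measurable
  have "AE x in lborel. x \<in> ball 0 R \<longrightarrow> v (norm x) = u x" using ae by (simp add: AE_completion_iff)
  from AE_polar[OF this]
  have "AE r in lborel. 0 < r \<longrightarrow> (AE \<omega> in sphere_measure. r *\<^sub>R \<omega> \<in> ball 0 R \<longrightarrow> v (norm (r *\<^sub>R \<omega>)) = u (r *\<^sub>R \<omega>))"
    by (simp add: AE_radial_measure Suc_le_eq)
  then have "AE r in lborel. r \<in> {0<..<R} \<longrightarrow> v r = w r"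
  proof eventually_elim
    case (elim r)
    show ?case
    proof
      assume r: "r \<in> {0<..<R}"
      with elim have "AE \<omega> in sphere_measure. r *\<^sub>R \<omega> \<in> ball 0 R \<longrightarrow> v (norm (r *\<^sub>R \<omega>)) = u (r *\<^sub>R \<omega>)" by simp
      then have "AE \<omega> in sphere_measure. u (r *\<^sub>R \<omega>) = v r"
        using AE_sphere_norm by eventually_elim (use r in auto)
      then have "(\<integral>\<omega>. u (r *\<^sub>R \<omega>) \<partial>sphere_measure) = (\<integral>\<omega>. v r \<partial>(sphere_measure :: 'a measure))"
        by (intro integral_cong_AE) measurable
      then show "v r = w r" using c by (simp add: w_def c_def sphere_area_def)
    qed
  qed
  then have "AE r in lebesgue. r \<in> {0<..<R} \<longrightarrow> v r = w r" by (rule AE_completion)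
  with wm show ?thesis by (rule that)
qed

text \<open>Either side makes v or v |x| locally integrable and thereby provides the Borel
  representative on which both implications are available; both sides are invariant under this
  exchange.\<close>

lemma radial_iff_qLaplace:
  fixes v f :: "real \<Rightarrow> real" and q R \<kappa> :: real
  assumes "q > 1" and "R > 0" and "\<kappa> > 0" and "continuous_on {0..<R} f"
  shows "radial_weak_supersolution \<kappa> q (real DIM('a)) R f v \<longleftrightarrow>
    qLaplace_weak_supersolution q R (\<lambda>r. f r / \<kappa>) (\<lambda>x::'a::euclidean_space. v (norm x))" (is "?L \<longleftrightarrow> ?Q")
proof -
  have *: "?L \<longleftrightarrow> ?Q" if w: "w \<in> borel_measurable borel" and ae: "AE r in lebesgue. r \<in> {0<..<R} \<longrightarrow> v r = w r" for w
  proof -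
    have "?L \<longleftrightarrow> radial_weak_supersolution \<kappa> q (real DIM('a)) R f w"
      by (rule radial_weak_supersolution_cong_AE[OF ae])
    also have "\<dots> \<longleftrightarrow> qLaplace_weak_supersolution q R (\<lambda>r. f r / \<kappa>) (\<lambda>x::'a. w (norm x))"
      using qLaplace_of_radial_Borel[OF assms w] radial_of_qLaplace_Borel[OF assms w] by blast
    also have "\<dots> \<longleftrightarrow> ?Q"
      by (rule qLaplace_weak_supersolution_cong_AE[OF AE_norm_eq[OF ae], symmetric])
    finally show ?thesis .
  qed
  show ?thesis
  proof
    assume ?L
    then have "locally_integrable {0<..<R} v"
      unfolding radial_weak_supersolution_def has_weak_gradient_def by blast
    then obtain w where "w \<in> borel_measurable borel" "AE r in lebesgue. r \<in> {0<..<R} \<longrightarrow> v r = w r"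
      by (rule locally_integrable_Borel_representative[OF open_greaterThanLessThan])
    from *[OF this] \<open>?L\<close> show ?Q by blast
  next
    assume ?Q
    then have "locally_integrable (ball (0::'a) R) (\<lambda>x. v (norm x))"
      unfolding qLaplace_weak_supersolution_def has_weak_gradient_def by blast
    then obtain w where "w \<in> borel_measurable borel" "AE r in lebesgue. r \<in> {0<..<R} \<longrightarrow> v r = w r"
      by (rule radial_Borel_representative)
    from *[OF this] \<open>?Q\<close> show ?L by blast
  qed
qed

theorem theorem5p3:
  fixes N :: nat and p q R \<kappa> d :: real and f v :: "real \<Rightarrow> real"
  assumes "N \<ge> 2" and "p > 1" and "q > 1" and "R > 0"
    and "continuous_on {0..<R} f"
    and "\<kappa> = (p - 1) / (q - 1)"
    and "d = (real N - 1) * (q - 1) / (p - 1) + 1"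
    and "d = real CARD('n::finite)"
  shows "radial_weak_supersolution \<kappa> q d R f v \<longleftrightarrow>
    qLaplace_weak_supersolution q R (\<lambda>r. f r / \<kappa>) (\<lambda>x :: real ^ 'n. v (norm x))"
proof -
  have "\<kappa> > 0" using assms(2,3,6) by simp
  from radial_iff_qLaplace[OF assms(3,4) this assms(5), of v, where 'a="real ^ 'n"]
  show ?thesis using assms(8) by simp
qed

end
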